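(* Let $\mathbb{K}$ be a field, $n\ge 1$, $\alpha,\beta\in\mathbb{K}$ and $\phi\in\mathbb{K}[t_1,\dots,t_n]$. Then the set $\{u^{i}(du)^{j}d^{k}t_{1}^{m_{1}}\cdots t_{n}^{m_{n}}\mid i,j,k,m_{1},\dots,m_{n}\geq 0\}$ is a $\mathbb{K}$-basis of the algebra $\mathcal{A}(\alpha,\beta,\phi)$. Furthermore, the algebra $\mathcal{A}(\alpha,\beta,\phi)$ has Gelfand-Kirillov dimension $n+3$.
   Context: $\mathcal{A}(\alpha,\beta,\phi)$ denotes the (unital associative) $\mathbb{K}$-algebra generated by $u,d,t_1,\dots,t_n$ subject to the relations $t_it_j=t_jt_i$, $t_iu=ut_i$, $t_id=dt_i$ for all $i,j\in\{1,\dots,n\}$, together with $d^{2}u=\alpha\, dud+\beta\, ud^{2}+\phi(t_1,\dots,t_n)d$ and $du^{2}=\alpha\, udu+\beta\, u^{2}d+u\phi(t_1,\dots,t_n)$. *)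

theory Defs
  imports
    "HOL-Algebra.QuotRing"
    "HOL-Algebra.Indexed_Polynomials"
    "HOL-Library.Extended_Real"
    "HOL-Library.Liminf_Limsup"
    "Jordan_Normal_Form.Missing_VectorSpace"
begin

section \<open>Associative algebras given by generators and relations\<close>

text \<open>
  Associative (not necessarily commutative) \<open>K\<close>-algebras are carried by the \<open>module\<close> record, which
  has both a ring multiplication and a scalar multiplication. The library's \<open>algebra\<close> locale is not
  used, since it demands commutativity.

  An element of the free algebra on \<open>S\<close> is a finitely supported coefficient function on the words
  over \<open>S\<close>. In a product, the coefficient of \<open>w\<close> is the sum over all splittings of \<open>w\<close> into a prefix
  and a suffix.
\<close>

definition free_algebra :: "('k, 'm) ring_scheme \<Rightarrow> 'g set \<Rightarrow> ('k, 'g list \<Rightarrow> 'k) module" where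
  "free_algebra K S =
    \<lparr>carrier = {f. (\<forall>w. f w \<in> carrier K) \<and> (\<forall>w. w \<notin> lists S \<longrightarrow> f w = \<zero>\<^bsub>K\<^esub>) \<and>
                   finite {w. f w \<noteq> \<zero>\<^bsub>K\<^esub>}},
     monoid.mult = (\<lambda>f g w. \<Oplus>\<^bsub>K\<^esub>i\<in>{..length w}. f (take i w) \<otimes>\<^bsub>K\<^esub> g (drop i w)),
     one = (\<lambda>w. if w = [] then \<one>\<^bsub>K\<^esub> else \<zero>\<^bsub>K\<^esub>),
     zero = (\<lambda>w. \<zero>\<^bsub>K\<^esub>),
     add = (\<lambda>f g w. f w \<oplus>\<^bsub>K\<^esub> g w),
     smult = (\<lambda>c f w. c \<otimes>\<^bsub>K\<^esub> f w)\<rparr>"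

definition free_gen :: "('k, 'm) ring_scheme \<Rightarrow> 'g \<Rightarrow> 'g list \<Rightarrow> 'k" where
  "free_gen K x = (\<lambda>w. if w = [x] then \<one>\<^bsub>K\<^esub> else \<zero>\<^bsub>K\<^esub>)"

text \<open>
  The library's quotient ring, equipped with the induced scalar multiplication \<open>c (I + x) = I + c x\<close>.
  As for the library's \<open>rcoset_mult\<close>, the union is over representatives that all yield the same coset.
\<close>

definition quotient_algebra :: "('k, 'a, 'm) module_scheme \<Rightarrow> 'a set \<Rightarrow> ('k, 'a set) module" where
  "quotient_algebra A I =
    \<lparr>carrier = carrier (A Quot I),
     monoid.mult = monoid.mult (A Quot I),
     one = one (A Quot I),
     zero = zero (A Quot I),
     add = add (A Quot I),
     smult = (\<lambda>c Y. \<Union>x\<in>Y. I +>\<^bsub>A\<^esub> (c \<odot>\<^bsub>A\<^esub> x))\<rparr>"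

text \<open>The product \<open>t\<^sub>1\<^bsup>m\<^sub>1\<^esup> \<cdots> t\<^sub>n\<^bsup>m\<^sub>n\<^esup>\<close>, multiplied in this order.\<close>

definition ordered_monomial ::
    "('a, 'm) ring_scheme \<Rightarrow> nat \<Rightarrow> (nat \<Rightarrow> 'a) \<Rightarrow> (nat \<Rightarrow> nat) \<Rightarrow> 'a" where
  "ordered_monomial A n t m = foldr (\<lambda>i y. (t i [^]\<^bsub>A\<^esub> m i) \<otimes>\<^bsub>A\<^esub> y) [1..<Suc n] \<one>\<^bsub>A\<^esub>"

text \<open>
  Elements of \<open>K[t\<^sub>1,\<dots>,t\<^sub>n]\<close> are those of the library's \<open>indexed_pset\<close>: functions from monomials,
  encoded as multisets of variable indices, to coefficients.
\<close>

definition poly_eval ::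
    "('k, 'm) ring_scheme \<Rightarrow> ('k, 'a, 'l) module_scheme \<Rightarrow> nat \<Rightarrow> (nat \<Rightarrow> 'a) \<Rightarrow>
      (nat multiset \<Rightarrow> 'k) \<Rightarrow> 'a" where
  "poly_eval K A n t p =
    (\<Oplus>\<^bsub>A\<^esub>\<mu>\<in>{\<mu>. p \<mu> \<noteq> \<zero>\<^bsub>K\<^esub>}. p \<mu> \<odot>\<^bsub>A\<^esub> ordered_monomial A n t (count \<mu>))"


section \<open>The algebra \<open>\<A>(\<alpha>,\<beta>,\<phi>)\<close>\<close>

datatype gen = Gu | Gd | Gt nat

abbreviation free_du :: "('k, 'm) ring_scheme \<Rightarrow> nat \<Rightarrow> ('k, gen list \<Rightarrow> 'k) module" where
  "free_du K n \<equiv> free_algebra K ({Gu, Gd} \<union> Gt ` {1..n})"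

text \<open>
  Defining relations, as pairs of a left and a right hand side. In the free algebra the \<open>t\<^sub>i\<close> do not
  commute, so \<open>\<phi>(t\<^sub>1,\<dots>,t\<^sub>n)\<close> is written there with the variables of each monomial in increasing
  order; the relations \<open>t\<^sub>i t\<^sub>j = t\<^sub>j t\<^sub>i\<close> make the order immaterial in the quotient.
\<close>

definition du_relations ::
    "('k, 'm) ring_scheme \<Rightarrow> nat \<Rightarrow> 'k \<Rightarrow> 'k \<Rightarrow> (nat multiset \<Rightarrow> 'k) \<Rightarrow>
      ((gen list \<Rightarrow> 'k) \<times> (gen list \<Rightarrow> 'k)) set" where
  "du_relations K n \<alpha> \<beta> \<phi> =
    (let F = free_du K n;
         u = free_gen K Gu;
         d = free_gen K Gd;
         t = (\<lambda>i. free_gen K (Gt i));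
         \<phi>t = poly_eval K F n t \<phi>
     in {(t i \<otimes>\<^bsub>F\<^esub> t j, t j \<otimes>\<^bsub>F\<^esub> t i) | i j. i \<in> {1..n} \<and> j \<in> {1..n}} \<union>
        {(t i \<otimes>\<^bsub>F\<^esub> u, u \<otimes>\<^bsub>F\<^esub> t i) | i. i \<in> {1..n}} \<union>
        {(t i \<otimes>\<^bsub>F\<^esub> d, d \<otimes>\<^bsub>F\<^esub> t i) | i. i \<in> {1..n}} \<union>
        {(d \<otimes>\<^bsub>F\<^esub> d \<otimes>\<^bsub>F\<^esub> u,
          \<alpha> \<odot>\<^bsub>F\<^esub> (d \<otimes>\<^bsub>F\<^esub> u \<otimes>\<^bsub>F\<^esub> d) \<oplus>\<^bsub>F\<^esub> \<beta> \<odot>\<^bsub>F\<^esub> (u \<otimes>\<^bsub>F\<^esub> d \<otimes>\<^bsub>F\<^esub> d) \<oplus>\<^bsub>F\<^esub> \<phi>t \<otimes>\<^bsub>F\<^esub> d),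
         (d \<otimes>\<^bsub>F\<^esub> u \<otimes>\<^bsub>F\<^esub> u,
          \<alpha> \<odot>\<^bsub>F\<^esub> (u \<otimes>\<^bsub>F\<^esub> d \<otimes>\<^bsub>F\<^esub> u) \<oplus>\<^bsub>F\<^esub> \<beta> \<odot>\<^bsub>F\<^esub> (u \<otimes>\<^bsub>F\<^esub> u \<otimes>\<^bsub>F\<^esub> d) \<oplus>\<^bsub>F\<^esub> u \<otimes>\<^bsub>F\<^esub> \<phi>t)})"

definition du_ideal ::
    "('k, 'm) ring_scheme \<Rightarrow> nat \<Rightarrow> 'k \<Rightarrow> 'k \<Rightarrow> (nat multiset \<Rightarrow> 'k) \<Rightarrow> (gen list \<Rightarrow> 'k) set" where
  "du_ideal K n \<alpha> \<beta> \<phi> =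
    Idl\<^bsub>free_du K n\<^esub> {a \<ominus>\<^bsub>free_du K n\<^esub> b | a b. (a, b) \<in> du_relations K n \<alpha> \<beta> \<phi>}"

definition du_algebra ::
    "('k, 'm) ring_scheme \<Rightarrow> nat \<Rightarrow> 'k \<Rightarrow> 'k \<Rightarrow> (nat multiset \<Rightarrow> 'k) \<Rightarrow>
      ('k, (gen list \<Rightarrow> 'k) set) module" where
  "du_algebra K n \<alpha> \<beta> \<phi> = quotient_algebra (free_du K n) (du_ideal K n \<alpha> \<beta> \<phi>)"

definition du_gen ::
    "('k, 'm) ring_scheme \<Rightarrow> nat \<Rightarrow> 'k \<Rightarrow> 'k \<Rightarrow> (nat multiset \<Rightarrow> 'k) \<Rightarrow> gen \<Rightarrow>
      (gen list \<Rightarrow> 'k) set" where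
  "du_gen K n \<alpha> \<beta> \<phi> x = du_ideal K n \<alpha> \<beta> \<phi> +>\<^bsub>free_du K n\<^esub> free_gen K x"

text \<open>The element \<open>u\<^sup>i (du)\<^sup>j d\<^sup>k t\<^sub>1\<^bsup>m\<^sub>1\<^esup> \<cdots> t\<^sub>n\<^bsup>m\<^sub>n\<^esup>\<close> of \<open>\<A>(\<alpha>,\<beta>,\<phi>)\<close>.\<close>

definition du_monomial ::
    "('k, 'm) ring_scheme \<Rightarrow> nat \<Rightarrow> 'k \<Rightarrow> 'k \<Rightarrow> (nat multiset \<Rightarrow> 'k) \<Rightarrow>
      nat \<times> nat \<times> nat \<times> (nat \<Rightarrow> nat) \<Rightarrow> (gen list \<Rightarrow> 'k) set" where
  "du_monomial K n \<alpha> \<beta> \<phi> = (\<lambda>(i, j, k, m).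
    let A = du_algebra K n \<alpha> \<beta> \<phi>;
        u = du_gen K n \<alpha> \<beta> \<phi> Gu;
        d = du_gen K n \<alpha> \<beta> \<phi> Gd;
        t = (\<lambda>l. du_gen K n \<alpha> \<beta> \<phi> (Gt l))
    in u [^]\<^bsub>A\<^esub> i \<otimes>\<^bsub>A\<^esub> (d \<otimes>\<^bsub>A\<^esub> u) [^]\<^bsub>A\<^esub> j \<otimes>\<^bsub>A\<^esub> d [^]\<^bsub>A\<^esub> k \<otimes>\<^bsub>A\<^esub> ordered_monomial A n t m)"

text \<open>
  Exponents \<open>(i, j, k, (m\<^sub>1,\<dots>,m\<^sub>n))\<close>; using extensional functions for \<open>m\<close>, each tuple of exponents
  occurs exactly once.
\<close>

definition du_exponents :: "nat \<Rightarrow> (nat \<times> nat \<times> nat \<times> (nat \<Rightarrow> nat)) set" where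
  "du_exponents n = UNIV \<times> UNIV \<times> UNIV \<times> ({1..n} \<rightarrow>\<^sub>E UNIV)"


section \<open>Gelfand--Kirillov dimension\<close>

text \<open>\<open>K + V + V\<^sup>2 + \<cdots> + V\<^sup>r\<close>: the empty product accounts for the summand \<open>K\<close>.\<close>

definition power_span ::
    "('k, 'm) ring_scheme \<Rightarrow> ('k, 'a, 'l) module_scheme \<Rightarrow> 'a set \<Rightarrow> nat \<Rightarrow> 'a set" where
  "power_span K A V r =
    module.span K A {foldr (monoid.mult A) vs \<one>\<^bsub>A\<^esub> | vs. set vs \<subseteq> V \<and> length vs \<le> r}"

text \<open>
  \<open>GKdim(A) = sup\<^sub>V limsup\<^sub>r log\<^sub>r dim(K + V + \<cdots> + V\<^sup>r)\<close>, over all finite-dimensional subspaces \<open>V\<close> of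
  \<open>A\<close>, as an extended real. The values at \<open>r = 0, 1\<close>, where the quotient of logarithms is meaningless,
  do not affect the limit superior. The algebra is assumed nonzero.
\<close>

definition GK_dim :: "('k, 'm) ring_scheme \<Rightarrow> ('k, 'a, 'l) module_scheme \<Rightarrow> ereal" where
  "GK_dim K A =
    (SUP V \<in> {V. subspace K V A \<and> vectorspace.fin_dim K (A\<lparr>carrier := V\<rparr>)}.
      limsup (\<lambda>r. ereal (ln (real (vectorspace.dim K (A\<lparr>carrier := power_span K A V r\<rparr>))) /
                          ln (real r))))"

end

theory Submission
  imports Defs
begin

text \<open>
  Write \<open>x = du\<close>. The relations rewrite every word into a combination of the monomials
  \<open>u\<^sup>i x\<^sup>j d\<^sup>k t\<^sub>1\<^bsup>m\<^sub>1\<^esup> \<cdots> t\<^sub>n\<^bsup>m\<^sub>n\<^esup>\<close>; what needs an argument is that these are independent, and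
  the proof constructs in advance the representation that the algebra would have on itself.

  Let \<open>M\<close> be the vector space with a basis \<open>e i j \<nu>\<close>, where \<open>\<nu>\<close> is a multiset on \<open>{0..n}\<close>. The basis
  vector stands for the monomial in which \<open>k\<close> is the multiplicity of \<open>0\<close> in \<open>\<nu>\<close> and \<open>m\<^sub>l\<close> that of \<open>l\<close>.
  Right multiplication by \<open>d\<close> or \<open>t\<^sub>l\<close> should add \<open>0\<close> or \<open>l\<close> to \<open>\<nu>\<close> and commute with all left
  multiplications, so a left multiplication is determined by its values on the vectors \<open>e i j {#}\<close>. For
  left multiplication by \<open>d\<close>, the operator \<open>down\<close>, these values are forced: \<open>d u x\<^sup>j = x\<^sup>j\<^sup>+\<^sup>1\<close>; the relation
  for \<open>du\<^sup>2\<close> gives \<open>d u\<^sup>i\<^sup>+\<^sup>2 x\<^sup>j\<close> from \<open>d u\<^sup>i\<^sup>+\<^sup>1 x\<^sup>j\<close> and \<open>d u\<^sup>i x\<^sup>j\<close>; and the relation for \<open>d\<^sup>2u\<close> gives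
  \<open>d x\<^sup>j\<^sup>+\<^sup>1 = (\<alpha> du + \<beta> ud + \<phi>) d x\<^sup>j\<close>. The last recursion applies \<open>d\<close> to \<open>d x\<^sup>j\<close> and \<open>u d x\<^sup>j\<close>, but those
  only involve powers of \<open>x\<close> up to \<open>j\<close>, so it is well-founded. The relation for \<open>du\<^sup>2\<close> then holds on \<open>M\<close> by
  construction, and so does the one for \<open>d\<^sup>2u\<close> on the vectors with \<open>i = 0\<close>; it passes from a vector \<open>v\<close> to
  \<open>u v\<close> by a short computation, which is the resolution of the overlap \<open>d\<^sup>2u\<^sup>2\<close>
  (\<open>down_up_up\<close>, \<open>down_down_up\<close>).

  Consequently the defining ideal annihilates \<open>M\<close> and the algebra acts on \<open>M\<close>. The linear map \<open>theta\<close> from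
  \<open>M\<close> to the algebra that sends basis vectors to monomials intertwines \<open>down\<close> with left multiplication by \<open>d\<close>,
  because both sides obey the recursion above. Therefore its image is a left ideal containing \<open>1\<close>, and
  it is onto; acting on \<open>e 0 0 {#}\<close> is a left inverse, so it is also injective (\<open>theta_bij\<close>). This is the
  claim about the basis.

  For the growth, give \<open>e i j \<nu>\<close> the weight \<open>c (i + 2 j) + size \<nu>\<close>, where \<open>c \<ge> 1\<close> and \<open>deg \<phi> \<le> 2 c\<close>. Every
  generator raises weights by at most \<open>c\<close>. If \<open>V\<close> is finite-dimensional, products of at most \<open>r\<close> elements of \<open>V\<close>
  therefore lie in the span of the monomials of weight at most \<open>C r\<close>, for some \<open>C\<close>, and of these there are
  at most \<open>(C r + 1)\<^sup>n\<^sup>+\<^sup>3\<close>. Conversely, if \<open>V\<close> contains \<open>u\<close>, \<open>du\<close>, \<open>d\<close> and the \<open>t\<^sub>l\<close>, then the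
  \<open>(q + 1)\<^sup>n\<^sup>+\<^sup>3\<close> independent monomials with exponents up to \<open>q\<close> are products of at most \<open>(n + 3) q\<close> elements of \<open>V\<close>.
\<close>

section \<open>Finitely supported functions and linear extension\<close>

definition delta :: "('k, 'm) ring_scheme \<Rightarrow> 's \<Rightarrow> 's \<Rightarrow> 'k" where
  "delta K s = (\<lambda>x. if x = s then \<one>\<^bsub>K\<^esub> else \<zero>\<^bsub>K\<^esub>)"

text \<open>
  The linear map that sends each basis vector \<open>delta K s\<close> to \<open>g s\<close>, evaluated at \<open>f\<close>. It is defined for
  bare functions, independently of any module record on the domain.
\<close>

definition lin_ext :: "('k, 'm) ring_scheme \<Rightarrow> ('k, 'a, 'l) module_scheme \<Rightarrow> ('s \<Rightarrow> 'a) \<Rightarrow> ('s \<Rightarrow> 'k) \<Rightarrow> 'a" where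
  "lin_ext K W g f = (\<Oplus>\<^bsub>W\<^esub>s\<in>{s. f s \<noteq> \<zero>\<^bsub>K\<^esub>}. f s \<odot>\<^bsub>W\<^esub> g s)"

lemmas linear_map_hom = mod_hom.f_hom[OF linear_map.axioms(3)]
lemmas linear_map_closed = module_hom_closed[OF linear_map_hom, THEN funcset_mem]
lemmas linear_map_add = module_hom_add[OF linear_map_hom]
lemmas linear_map_smult = module_hom_smult[OF linear_map_hom]

text \<open>
  The free module on \<open>S\<close>, as finitely supported coefficient functions. Only the additive and scalar fields
  of the record are fixed, so that a free algebra is an instance, whatever its multiplication.
\<close>

locale finsupp_space =
  fixes K :: "('k, 'm) ring_scheme" and N :: "('k, 's \<Rightarrow> 'k, 'l) module_scheme" and S :: "'s set"
  assumes field_K: "field K"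
    and carrier_N: "carrier N = {f. (\<forall>s. f s \<in> carrier K) \<and> (\<forall>s. s \<notin> S \<longrightarrow> f s = \<zero>\<^bsub>K\<^esub>) \<and>
                      finite {s. f s \<noteq> \<zero>\<^bsub>K\<^esub>}}"
    and zero_N: "\<zero>\<^bsub>N\<^esub> = (\<lambda>s. \<zero>\<^bsub>K\<^esub>)"
    and add_N: "add N = (\<lambda>f g s. f s \<oplus>\<^bsub>K\<^esub> g s)"
    and smult_N: "smult N = (\<lambda>c f s. c \<otimes>\<^bsub>K\<^esub> f s)"
begin

lemma coeff_closed: "f \<in> carrier N \<Longrightarrow> f s \<in> carrier K"
  and coeff_outside: "f \<in> carrier N \<Longrightarrow> s \<notin> S \<Longrightarrow> f s = \<zero>\<^bsub>K\<^esub>"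
  and finite_support: "f \<in> carrier N \<Longrightarrow> finite {s. f s \<noteq> \<zero>\<^bsub>K\<^esub>}"
  by (auto simp: carrier_N)

lemma support_subset: "f \<in> carrier N \<Longrightarrow> {s. f s \<noteq> \<zero>\<^bsub>K\<^esub>} \<subseteq> S"
  using coeff_outside by auto

lemma vectorspace_axioms': "vectorspace K N"
proof -
  interpret K: field K by (fact field_K)
  show ?thesis
  proof (rule vs_criteria[OF field_K])
    show "\<forall>v w. v \<in> carrier N \<and> w \<in> carrier N \<longrightarrow> v \<oplus>\<^bsub>N\<^esub> w \<in> carrier N"
    proof (intro allI impI, elim conjE)
      fix v w assume v: "v \<in> carrier N" and w: "w \<in> carrier N"
      have "finite {s. (v \<oplus>\<^bsub>N\<^esub> w) s \<noteq> \<zero>\<^bsub>K\<^esub>}"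
        by (rule finite_subset[OF _ finite_UnI[OF finite_support[OF v] finite_support[OF w]]])
           (auto simp: add_N)
      then show "v \<oplus>\<^bsub>N\<^esub> w \<in> carrier N"
        using v w by (simp add: carrier_N add_N)
    qed
    show "\<forall>v\<in>carrier N. \<exists>w\<in>carrier N. v \<oplus>\<^bsub>N\<^esub> w = \<zero>\<^bsub>N\<^esub>"
    proof
      fix v assume v: "v \<in> carrier N"
      have "finite {s. \<ominus>\<^bsub>K\<^esub> v s \<noteq> \<zero>\<^bsub>K\<^esub>}"
        by (rule finite_subset[OF _ finite_support[OF v]]) auto
      then have "(\<lambda>s. \<ominus>\<^bsub>K\<^esub> v s) \<in> carrier N" using v by (simp add: carrier_N)
      moreover have "v \<oplus>\<^bsub>N\<^esub> (\<lambda>s. \<ominus>\<^bsub>K\<^esub> v s) = \<zero>\<^bsub>N\<^esub>"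
        using coeff_closed[OF v] by (simp add: add_N zero_N K.r_neg)
      ultimately show "\<exists>w\<in>carrier N. v \<oplus>\<^bsub>N\<^esub> w = \<zero>\<^bsub>N\<^esub>" by blast
    qed
    show "\<forall>c v. c \<in> carrier K \<and> v \<in> carrier N \<longrightarrow> c \<odot>\<^bsub>N\<^esub> v \<in> carrier N"
    proof (intro allI impI, elim conjE)
      fix c v assume c: "c \<in> carrier K" and v: "v \<in> carrier N"
      have "finite {s. (c \<odot>\<^bsub>N\<^esub> v) s \<noteq> \<zero>\<^bsub>K\<^esub>}"
        by (rule finite_subset[OF _ finite_support[OF v]]) (auto simp: smult_N c)
      then show "c \<odot>\<^bsub>N\<^esub> v \<in> carrier N" using c v by (simp add: carrier_N smult_N)
    qed
  qed (auto simp: carrier_N zero_N add_N smult_N fun_eq_iff K.a_ac K.m_ac K.l_distr K.r_distr)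
qed

sublocale vectorspace K N by (rule vectorspace_axioms')

lemma delta_closed [simp, intro]: "s \<in> S \<Longrightarrow> delta K s \<in> carrier N"
  by (auto simp: carrier_N delta_def intro: finite_subset[of _ "{s}"])

text \<open>
  A finitely supported function is reached from zero by adding one multiple of a basis vector at a
  time; only the basis vectors in its support occur.
\<close>

lemma support_induct [consumes 1, case_names zero add]:
  assumes f: "f \<in> carrier N"
    and zero: "P \<zero>\<^bsub>N\<^esub>"
    and add: "\<And>g c s. g \<in> carrier N \<Longrightarrow> P g \<Longrightarrow> c \<in> carrier K \<Longrightarrow> s \<in> S \<Longrightarrow> f s \<noteq> \<zero>\<^bsub>K\<^esub>
               \<Longrightarrow> P (g \<oplus>\<^bsub>N\<^esub> c \<odot>\<^bsub>N\<^esub> delta K s)"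
  shows "P f"
proof -
  let ?r = "\<lambda>F s. if s \<in> F then f s else \<zero>\<^bsub>K\<^esub>"
  have closed: "?r F \<in> carrier N" for F
  proof -
    have "finite {s. ?r F s \<noteq> \<zero>\<^bsub>K\<^esub>}"
      by (rule finite_subset[OF _ finite_support[OF f]]) auto
    then show ?thesis using f unfolding carrier_N by auto
  qed
  have "P (?r F)" if "finite F" "F \<subseteq> {s. f s \<noteq> \<zero>\<^bsub>K\<^esub>}" for F
    using that
  proof (induction F)
    case empty
    then show ?case using zero by (simp add: zero_N)
  next
    case (insert s F)
    have "?r (insert s F) = ?r F \<oplus>\<^bsub>N\<^esub> f s \<odot>\<^bsub>N\<^esub> delta K s"
      using insert.hyps coeff_closed[OF f] by (auto simp: add_N smult_N delta_def fun_eq_iff)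
    moreover have "P (?r F \<oplus>\<^bsub>N\<^esub> f s \<odot>\<^bsub>N\<^esub> delta K s)"
      using insert coeff_closed[OF f] coeff_outside[OF f] closed by (intro add) auto
    ultimately show ?case by simp
  qed
  from this[OF finite_support[OF f] subset_refl] show ?thesis
    by (rule back_subst[of P]) auto
qed

text \<open>
  Membership in a submodule need only be tested on the basis vectors that occur in \<open>f\<close>; this is how all
  filtration estimates below are reduced to basis vectors.
\<close>

lemma linear_map_image_in_submodule:
  assumes "linear_map K N W T" and "submodule K P W" and f: "f \<in> carrier N"
    and mem: "\<And>s. s \<in> S \<Longrightarrow> f s \<noteq> \<zero>\<^bsub>K\<^esub> \<Longrightarrow> T (delta K s) \<in> P"
  shows "T f \<in> P"
proof -
  interpret T: linear_map K N W T by fact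
  interpret P: submodule K P W by fact
  from f show ?thesis
    by (induction rule: support_induct) (simp_all add: mem)
qed

lemma linear_map_eqI:
  assumes "linear_map K N W T" and "linear_map K N W T'" and f: "f \<in> carrier N"
    and eq: "\<And>s. s \<in> S \<Longrightarrow> f s \<noteq> \<zero>\<^bsub>K\<^esub> \<Longrightarrow> T (delta K s) = T' (delta K s)"
  shows "T f = T' f"
proof -
  interpret T: linear_map K N W T by fact
  interpret T': linear_map K N W T' by fact
  from f show ?thesis
    by (induction rule: support_induct) (simp_all add: eq)
qed

context
  fixes W :: "('k, 'a, 'l2) module_scheme" and g :: "'s \<Rightarrow> 'a"
  assumes W: "vectorspace K W" and g: "g \<in> S \<rightarrow> carrier W"
begin

interpretation W: vectorspace K W by (fact W)

text \<open>
  Two functions have different supports, so additivity of \<open>lin_ext\<close> requires summing over a common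
  finite superset.
\<close>

lemma lin_ext_superset:
  assumes f: "f \<in> carrier N" and "finite F" "{s. f s \<noteq> \<zero>\<^bsub>K\<^esub>} \<subseteq> F" "F \<subseteq> S"
  shows "lin_ext K W g f = (\<Oplus>\<^bsub>W\<^esub>s\<in>F. f s \<odot>\<^bsub>W\<^esub> g s)"
  unfolding lin_ext_def
proof (rule W.add.finprod_mono_neutral_cong_left)
  have gF: "g s \<in> carrier W" if "s \<in> F" for s using that assms g by auto
  show "(\<lambda>s. f s \<odot>\<^bsub>W\<^esub> g s) \<in> F \<rightarrow> carrier W"
    using gF coeff_closed[OF f] by auto
  show "f s \<odot>\<^bsub>W\<^esub> g s = \<zero>\<^bsub>W\<^esub>" if "s \<in> F - {s. f s \<noteq> \<zero>\<^bsub>K\<^esub>}" for s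
    using gF that by auto
qed (use assms in auto)

lemma lin_ext_linear: "linear_map K N W (lin_ext K W g)"
proof -
  have gc: "g s \<in> carrier W" if "s \<in> S" for s using g that by auto
  have fin: "finite {s. h s \<noteq> \<zero>\<^bsub>K\<^esub>}" and sub: "{s. h s \<noteq> \<zero>\<^bsub>K\<^esub>} \<subseteq> S" if "h \<in> carrier N" for h
    using that finite_support support_subset by auto
  have "lin_ext K W g \<in> module_hom K N W"
    unfolding module_hom_def
  proof (intro CollectI conjI allI impI funcsetI)
    fix f assume "f \<in> carrier N"
    then show "lin_ext K W g f \<in> carrier W"
      unfolding lin_ext_def using gc support_subset coeff_closed
      by (intro W.finsum_closed) (auto intro!: W.smult_closed)
  next
    fix f h assume "f \<in> carrier N \<and> h \<in> carrier N"
    then have f: "f \<in> carrier N" and h: "h \<in> carrier N" by auto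
    let ?F = "{s. f s \<noteq> \<zero>\<^bsub>K\<^esub>} \<union> {s. h s \<noteq> \<zero>\<^bsub>K\<^esub>}"
    have F: "finite ?F" "?F \<subseteq> S" using fin sub f h by auto
    have "f \<oplus>\<^bsub>N\<^esub> h \<in> carrier N" using f h by simp
    then have "lin_ext K W g (f \<oplus>\<^bsub>N\<^esub> h) = (\<Oplus>\<^bsub>W\<^esub>s\<in>?F. (f \<oplus>\<^bsub>N\<^esub> h) s \<odot>\<^bsub>W\<^esub> g s)"
      by (rule lin_ext_superset[OF _ F(1) _ F(2)]) (auto simp: add_N)
    also have "\<dots> = (\<Oplus>\<^bsub>W\<^esub>s\<in>?F. f s \<odot>\<^bsub>W\<^esub> g s \<oplus>\<^bsub>W\<^esub> h s \<odot>\<^bsub>W\<^esub> g s)"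
      using f h F(2) gc coeff_closed 
      by (intro W.finsum_cong') (auto simp: add_N subset_iff intro!: W.smult_l_distr)
    also have "\<dots> = (\<Oplus>\<^bsub>W\<^esub>s\<in>?F. f s \<odot>\<^bsub>W\<^esub> g s) \<oplus>\<^bsub>W\<^esub> (\<Oplus>\<^bsub>W\<^esub>s\<in>?F. h s \<odot>\<^bsub>W\<^esub> g s)"
      using f h F(2) gc coeff_closed by (intro W.finsum_addf) (auto simp: subset_iff)
    also have "\<dots> = lin_ext K W g f \<oplus>\<^bsub>W\<^esub> lin_ext K W g h"
      using lin_ext_superset[OF f F(1) _ F(2)] lin_ext_superset[OF h F(1) _ F(2)] by simp
    finally show "lin_ext K W g (f \<oplus>\<^bsub>N\<^esub> h) = lin_ext K W g f \<oplus>\<^bsub>W\<^esub> lin_ext K W g h" .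
  next
    fix c f assume "c \<in> carrier K \<and> f \<in> carrier N"
    then have c: "c \<in> carrier K" and f: "f \<in> carrier N" by auto
    let ?F = "{s. f s \<noteq> \<zero>\<^bsub>K\<^esub>}"
    have F: "finite ?F" "?F \<subseteq> S" using fin sub f by auto
    have "c \<odot>\<^bsub>N\<^esub> f \<in> carrier N" using c f by simp
    then have "lin_ext K W g (c \<odot>\<^bsub>N\<^esub> f) = (\<Oplus>\<^bsub>W\<^esub>s\<in>?F. (c \<odot>\<^bsub>N\<^esub> f) s \<odot>\<^bsub>W\<^esub> g s)"
      by (rule lin_ext_superset[OF _ F(1) _ F(2)]) (auto simp: smult_N c)
    also have "\<dots> = (\<Oplus>\<^bsub>W\<^esub>s\<in>?F. c \<odot>\<^bsub>W\<^esub> (f s \<odot>\<^bsub>W\<^esub> g s))"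
      using f c F(2) gc coeff_closed
      by (intro W.finsum_cong') (auto simp: smult_N subset_iff intro!: W.smult_assoc1)
    also have "\<dots> = c \<odot>\<^bsub>W\<^esub> lin_ext K W g f"
      unfolding lin_ext_def using f c F gc coeff_closed
      by (intro W.finsum_smult[symmetric]) (auto simp: subset_iff)
    finally show "lin_ext K W g (c \<odot>\<^bsub>N\<^esub> f) = c \<odot>\<^bsub>W\<^esub> lin_ext K W g f" .
  qed
  then show ?thesis
    by (intro linear_map.intro vectorspace_axioms' W mod_hom.intro mod_hom_axioms.intro
        module_axioms W.module_axioms)
qed

lemma lin_ext_delta:
  assumes "s \<in> S"
  shows "lin_ext K W g (delta K s) = g s"
proof -
  have "lin_ext K W g (delta K s) = (\<Oplus>\<^bsub>W\<^esub>x\<in>{s}. delta K s x \<odot>\<^bsub>W\<^esub> g x)"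
    using assms by (intro lin_ext_superset) (simp_all, auto simp: delta_def)
  then show ?thesis using assms g by (simp add: delta_def Pi_iff)
qed

end

end

lemma (in vectorspace) linear_mapI:
  assumes "vectorspace K W" and "\<And>x. x \<in> carrier V \<Longrightarrow> T x \<in> carrier W"
    and "\<And>x y. x \<in> carrier V \<Longrightarrow> y \<in> carrier V \<Longrightarrow> T (x \<oplus>\<^bsub>V\<^esub> y) = T x \<oplus>\<^bsub>W\<^esub> T y"
    and "\<And>c x. c \<in> carrier K \<Longrightarrow> x \<in> carrier V \<Longrightarrow> T (c \<odot>\<^bsub>V\<^esub> x) = c \<odot>\<^bsub>W\<^esub> T x"
  shows "linear_map K V W T"
proof -
  interpret W: vectorspace K W by fact
  show ?thesis
    by (intro linear_map.intro mod_hom.intro mod_hom_axioms.intro vectorspace_axioms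
        W.vectorspace_axioms module_axioms W.module_axioms)
       (auto simp: module_hom_def assms)
qed

lemma linear_map_comp:
  assumes "linear_map K U V T" and "linear_map K V W T'"
  shows "linear_map K U W (\<lambda>x. T' (T x))"
proof -
  interpret T: linear_map K U V T by fact
  interpret T': linear_map K V W T' by fact
  show ?thesis
    by (rule T.V.linear_mapI) (auto intro: T'.W.vectorspace_axioms)
qed

section \<open>Free algebras and quotient algebras\<close>

locale assoc_algebra = vectorspace K A + alg?: ring A
  for K :: "('k, 'm) ring_scheme" and A :: "('k, 'a, 'l) module_scheme" +
  assumes smult_mult_left:
      "c \<in> carrier K \<Longrightarrow> x \<in> carrier A \<Longrightarrow> y \<in> carrier A \<Longrightarrow>
        (c \<odot>\<^bsub>A\<^esub> x) \<otimes>\<^bsub>A\<^esub> y = c \<odot>\<^bsub>A\<^esub> (x \<otimes>\<^bsub>A\<^esub> y)"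
    and smult_mult_right:
      "c \<in> carrier K \<Longrightarrow> x \<in> carrier A \<Longrightarrow> y \<in> carrier A \<Longrightarrow>
        x \<otimes>\<^bsub>A\<^esub> (c \<odot>\<^bsub>A\<^esub> y) = c \<odot>\<^bsub>A\<^esub> (x \<otimes>\<^bsub>A\<^esub> y)"
begin

lemma left_mult_linear: "x \<in> carrier A \<Longrightarrow> linear_map K A A (\<lambda>y. x \<otimes>\<^bsub>A\<^esub> y)"
  by (rule linear_mapI) (auto simp: alg.r_distr smult_mult_right vectorspace_axioms)

lemma right_mult_linear: "y \<in> carrier A \<Longrightarrow> linear_map K A A (\<lambda>x. x \<otimes>\<^bsub>A\<^esub> y)"
  by (rule linear_mapI) (auto simp: alg.l_distr smult_mult_left vectorspace_axioms)

end

lemma free_algebra_finsupp_space: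
  "field K \<Longrightarrow> finsupp_space K (free_algebra K S) (lists S)"
  by (rule finsupp_space.intro) (auto simp: free_algebra_def)

lemma free_algebra_mult:
  "(f \<otimes>\<^bsub>free_algebra K S\<^esub> g) w = (\<Oplus>\<^bsub>K\<^esub>i\<in>{..length w}. f (take i w) \<otimes>\<^bsub>K\<^esub> g (drop i w))"
  and free_algebra_one: "\<one>\<^bsub>free_algebra K S\<^esub> = delta K []"
  by (simp_all add: free_algebra_def delta_def)

lemma free_gen_delta: "free_gen K x = delta K [x]"
  by (simp add: free_gen_def delta_def)

locale free_alg = field K for K :: "('k, 'm) ring_scheme" + fixes S :: "'g set"
begin

abbreviation F where "F \<equiv> free_algebra K S"

sublocale F: finsupp_space K F "lists S"
  by (rule free_algebra_finsupp_space) (rule field_axioms)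

lemma free_mult_closed:
  assumes f: "f \<in> carrier F" and g: "g \<in> carrier F"
  shows "f \<otimes>\<^bsub>F\<^esub> g \<in> carrier F"
proof -
  note [simp] = F.coeff_closed[OF f] F.coeff_closed[OF g]
  have nz: "\<exists>i. f (take i w) \<noteq> \<zero>\<^bsub>K\<^esub> \<and> g (drop i w) \<noteq> \<zero>\<^bsub>K\<^esub>" if "(f \<otimes>\<^bsub>F\<^esub> g) w \<noteq> \<zero>\<^bsub>K\<^esub>" for w
  proof (rule ccontr)
    assume *: "\<nexists>i. f (take i w) \<noteq> \<zero>\<^bsub>K\<^esub> \<and> g (drop i w) \<noteq> \<zero>\<^bsub>K\<^esub>"
    have "f (take i w) \<otimes>\<^bsub>K\<^esub> g (drop i w) = \<zero>\<^bsub>K\<^esub>" for i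
      using * by (cases "f (take i w) = \<zero>\<^bsub>K\<^esub>") auto
    then have "(f \<otimes>\<^bsub>F\<^esub> g) w = \<zero>\<^bsub>K\<^esub>" by (simp add: free_algebra_mult)
    with that show False by simp
  qed
  let ?A = "{w. f w \<noteq> \<zero>\<^bsub>K\<^esub>}" and ?B = "{w. g w \<noteq> \<zero>\<^bsub>K\<^esub>}"
  have "w \<in> (\<lambda>(v, w). v @ w) ` (?A \<times> ?B)" if "(f \<otimes>\<^bsub>F\<^esub> g) w \<noteq> \<zero>\<^bsub>K\<^esub>" for w
  proof -
    from nz[OF that] obtain i where "f (take i w) \<noteq> \<zero>\<^bsub>K\<^esub>" "g (drop i w) \<noteq> \<zero>\<^bsub>K\<^esub>" by auto
    then show ?thesis by (intro image_eqI[of _ _ "(take i w, drop i w)"]) auto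
  qed
  then have "{w. (f \<otimes>\<^bsub>F\<^esub> g) w \<noteq> \<zero>\<^bsub>K\<^esub>} \<subseteq> (\<lambda>(v, w). v @ w) ` (?A \<times> ?B)" by blast
  then have "finite {w. (f \<otimes>\<^bsub>F\<^esub> g) w \<noteq> \<zero>\<^bsub>K\<^esub>}"
    by (rule finite_subset) (intro finite_imageI finite_SigmaI F.finite_support f g)
  moreover have "(f \<otimes>\<^bsub>F\<^esub> g) w = \<zero>\<^bsub>K\<^esub>" if "w \<notin> lists S" for w
  proof (rule ccontr)
    assume "(f \<otimes>\<^bsub>F\<^esub> g) w \<noteq> \<zero>\<^bsub>K\<^esub>"
    then obtain i where "f (take i w) \<noteq> \<zero>\<^bsub>K\<^esub>" "g (drop i w) \<noteq> \<zero>\<^bsub>K\<^esub>" using nz by blast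
    then have "take i w \<in> lists S" "drop i w \<in> lists S"
      using F.coeff_outside f g by blast+
    then have "take i w @ drop i w \<in> lists S" by (simp only: append_in_lists_conv)
    with that show False by simp
  qed
  ultimately show ?thesis
    unfolding F.carrier_N by (auto simp: free_algebra_mult intro!: finsum_closed)
qed

lemma free_mult_linear_left:
  assumes g: "g \<in> carrier F"
  shows "linear_map K F F (\<lambda>f. f \<otimes>\<^bsub>F\<^esub> g)"
proof (rule F.linear_mapI[OF F.vectorspace_axioms])
  fix f h assume f: "f \<in> carrier F" and h: "h \<in> carrier F"
  note [simp] = F.coeff_closed[OF f] F.coeff_closed[OF h] F.coeff_closed[OF g]
  show "(f \<oplus>\<^bsub>F\<^esub> h) \<otimes>\<^bsub>F\<^esub> g = f \<otimes>\<^bsub>F\<^esub> g \<oplus>\<^bsub>F\<^esub> h \<otimes>\<^bsub>F\<^esub> g"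
    by (rule ext) (simp add: free_algebra_mult F.add_N l_distr Pi_def)
next
  fix c f assume c: "c \<in> carrier K" and f: "f \<in> carrier F"
  note [simp] = F.coeff_closed[OF f] F.coeff_closed[OF g]
  show "(c \<odot>\<^bsub>F\<^esub> f) \<otimes>\<^bsub>F\<^esub> g = c \<odot>\<^bsub>F\<^esub> (f \<otimes>\<^bsub>F\<^esub> g)"
    by (rule ext) (simp add: free_algebra_mult F.smult_N m_assoc c finsum_rdistr Pi_def)
qed (use g free_mult_closed in auto)

lemma free_mult_linear_right:
  assumes f: "f \<in> carrier F"
  shows "linear_map K F F (\<lambda>g. f \<otimes>\<^bsub>F\<^esub> g)"
proof (rule F.linear_mapI[OF F.vectorspace_axioms])
  fix g h assume g: "g \<in> carrier F" and h: "h \<in> carrier F"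
  note [simp] = F.coeff_closed[OF f] F.coeff_closed[OF h] F.coeff_closed[OF g]
  show "f \<otimes>\<^bsub>F\<^esub> (g \<oplus>\<^bsub>F\<^esub> h) = f \<otimes>\<^bsub>F\<^esub> g \<oplus>\<^bsub>F\<^esub> f \<otimes>\<^bsub>F\<^esub> h"
    by (rule ext) (simp add: free_algebra_mult F.add_N r_distr Pi_def)
next
  fix c g assume c: "c \<in> carrier K" and g: "g \<in> carrier F"
  note [simp] = F.coeff_closed[OF f] F.coeff_closed[OF g]
  show "f \<otimes>\<^bsub>F\<^esub> (c \<odot>\<^bsub>F\<^esub> g) = c \<odot>\<^bsub>F\<^esub> (f \<otimes>\<^bsub>F\<^esub> g)"
    by (rule ext) (simp add: free_algebra_mult F.smult_N m_lcomm c finsum_rdistr Pi_def)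
qed (use f free_mult_closed in auto)

lemma delta_mult: "delta K v \<otimes>\<^bsub>F\<^esub> delta K w = delta K (v @ w)"
proof
  fix x
  have *: "delta K v (take i x) \<otimes>\<^bsub>K\<^esub> delta K w (drop i x) =
      (if length v = i then (if x = v @ w then \<one>\<^bsub>K\<^esub> else \<zero>\<^bsub>K\<^esub>) else \<zero>\<^bsub>K\<^esub>)"
    if "i \<in> {..length x}" for i
    using that append_take_drop_id[of i x] by (auto simp: delta_def)
  have "(delta K v \<otimes>\<^bsub>F\<^esub> delta K w) x =
      (\<Oplus>\<^bsub>K\<^esub>i\<in>{..length x}. if length v = i then (if x = v @ w then \<one>\<^bsub>K\<^esub> else \<zero>\<^bsub>K\<^esub>) else \<zero>\<^bsub>K\<^esub>)"
    unfolding free_algebra_mult using * by (intro finsum_cong') auto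
  also have "\<dots> = delta K (v @ w) x"
  proof (cases "x = v @ w")
    case True
    then show ?thesis
      using add.finprod_singleton[of "length v" "{..length x}" "\<lambda>_. \<one>\<^bsub>K\<^esub>"] by (simp add: delta_def)
  qed (simp add: delta_def)
  finally show "(delta K v \<otimes>\<^bsub>F\<^esub> delta K w) x = delta K (v @ w) x" .
qed

text \<open>
  Both sides are linear in each argument, hence it suffices to compare them on words, where the product
  is concatenation.
\<close>

lemma free_mult_assoc:
  assumes f: "f \<in> carrier F" and g: "g \<in> carrier F" and h: "h \<in> carrier F"
  shows "f \<otimes>\<^bsub>F\<^esub> g \<otimes>\<^bsub>F\<^esub> h = f \<otimes>\<^bsub>F\<^esub> (g \<otimes>\<^bsub>F\<^esub> h)"
proof -
  have 1: "delta K v \<otimes>\<^bsub>F\<^esub> delta K w \<otimes>\<^bsub>F\<^esub> h = delta K v \<otimes>\<^bsub>F\<^esub> (delta K w \<otimes>\<^bsub>F\<^esub> h)"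
    if "v \<in> lists S" "w \<in> lists S" for v w
    by (rule F.linear_map_eqI[OF free_mult_linear_right
          linear_map_comp[OF free_mult_linear_right free_mult_linear_right] h])
       (use that in \<open>auto simp: delta_mult\<close>)
  have 2: "delta K v \<otimes>\<^bsub>F\<^esub> g \<otimes>\<^bsub>F\<^esub> h = delta K v \<otimes>\<^bsub>F\<^esub> (g \<otimes>\<^bsub>F\<^esub> h)" if "v \<in> lists S" for v
    by (rule F.linear_map_eqI[OF linear_map_comp[OF free_mult_linear_right free_mult_linear_left]
          linear_map_comp[OF free_mult_linear_left free_mult_linear_right] g])
       (use that h 1 in auto)
  show ?thesis
    by (rule F.linear_map_eqI[OF linear_map_comp[OF free_mult_linear_left free_mult_linear_left]
          free_mult_linear_left f])
       (use g h 2 free_mult_closed in auto)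
qed

lemma free_algebra_assoc_algebra: "assoc_algebra K F"
proof -
  have one: "\<one>\<^bsub>F\<^esub> \<in> carrier F" by (auto simp: free_algebra_one)
  have id: "linear_map K F F (\<lambda>f. f)"
    by (rule F.linear_mapI[OF F.vectorspace_axioms]) simp_all
  have "\<one>\<^bsub>F\<^esub> \<otimes>\<^bsub>F\<^esub> f = f" if f: "f \<in> carrier F" for f
    by (rule F.linear_map_eqI[OF free_mult_linear_right[OF one] id f])
       (simp add: free_algebra_one delta_mult)
  moreover have "f \<otimes>\<^bsub>F\<^esub> \<one>\<^bsub>F\<^esub> = f" if f: "f \<in> carrier F" for f
    by (rule F.linear_map_eqI[OF free_mult_linear_left[OF one] id f])
       (simp add: free_algebra_one delta_mult)
  ultimately have "monoid F"
    using one free_mult_closed free_mult_assoc by (intro monoidI) auto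
  then have "ring F"
    by (intro ringI F.abelian_group_axioms)
       (simp_all add: linear_map_add[OF free_mult_linear_left]
         linear_map_add[OF free_mult_linear_right])
  then show ?thesis
    by (intro assoc_algebra.intro F.vectorspace_axioms assoc_algebra_axioms.intro)
       (simp_all add: linear_map_smult[OF free_mult_linear_left]
         linear_map_smult[OF free_mult_linear_right])
qed

sublocale F: assoc_algebra K F by (rule free_algebra_assoc_algebra)

end

text \<open>
  Since the algebra has a unit, a two-sided ideal of its ring is closed under scalars, and the quotient
  ring is again an algebra.
\<close>

locale algebra_ideal = assoc_algebra K A + ideal I A
  for K :: "('k, 'm) ring_scheme" and A :: "('k, 'a, 'l) module_scheme" and I
begin

abbreviation Q where "Q \<equiv> quotient_algebra A I"

abbreviation proj where "proj x \<equiv> I +>\<^bsub>A\<^esub> x"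

lemma carrier_quotient: "carrier Q = proj ` carrier A"
  by (auto simp: quotient_algebra_def FactRing_def A_RCOSETS_def')

lemma proj_closed [simp, intro]: "x \<in> carrier A \<Longrightarrow> proj x \<in> carrier Q"
  by (auto simp: carrier_quotient)

lemma proj_add: "x \<in> carrier A \<Longrightarrow> y \<in> carrier A \<Longrightarrow> proj (x \<oplus>\<^bsub>A\<^esub> y) = proj x \<oplus>\<^bsub>Q\<^esub> proj y"
  by (simp add: quotient_algebra_def FactRing_def a_rcos_sum)

lemma proj_mult: "x \<in> carrier A \<Longrightarrow> y \<in> carrier A \<Longrightarrow> proj (x \<otimes>\<^bsub>A\<^esub> y) = proj x \<otimes>\<^bsub>Q\<^esub> proj y"
  unfolding quotient_algebra_def FactRing_def monoid.simps by (rule rcoset_mult_add[symmetric])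

lemma proj_one: "proj \<one>\<^bsub>A\<^esub> = \<one>\<^bsub>Q\<^esub>"
  by (simp add: quotient_algebra_def FactRing_def)

lemma proj_zero: "proj \<zero>\<^bsub>A\<^esub> = \<zero>\<^bsub>Q\<^esub>"
  using a_rcos_zero[OF ideal_axioms zero_closed] by (simp add: quotient_algebra_def FactRing_def)

lemma proj_eq_iff:
  "x \<in> carrier A \<Longrightarrow> y \<in> carrier A \<Longrightarrow> proj x = proj y \<longleftrightarrow> x \<ominus>\<^bsub>A\<^esub> y \<in> I"
  by (rule quotient_eq_iff_same_a_r_cos[symmetric]) (rule ideal_axioms)

lemma smult_ideal:
  assumes c: "c \<in> carrier K" and x: "x \<in> I"
  shows "c \<odot>\<^bsub>A\<^esub> x \<in> I"
proof -
  have xA: "x \<in> carrier A" using x by (rule a_Hcarr)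
  have "(c \<odot>\<^bsub>A\<^esub> \<one>\<^bsub>A\<^esub>) \<otimes>\<^bsub>A\<^esub> x \<in> I" using c x by (intro I_l_closed) auto
  also have "(c \<odot>\<^bsub>A\<^esub> \<one>\<^bsub>A\<^esub>) \<otimes>\<^bsub>A\<^esub> x = c \<odot>\<^bsub>A\<^esub> x" using c xA by (simp add: smult_mult_left)
  finally show ?thesis .
qed

text \<open>
  The scalar multiplication of the quotient is defined as a union over all representatives; all of them
  contribute the same coset.
\<close>

lemma proj_smult:
  assumes c: "c \<in> carrier K" and x: "x \<in> carrier A"
  shows "proj (c \<odot>\<^bsub>A\<^esub> x) = c \<odot>\<^bsub>Q\<^esub> proj x"
proof -
  have "proj (c \<odot>\<^bsub>A\<^esub> y) = proj (c \<odot>\<^bsub>A\<^esub> x)" if "y \<in> proj x" for y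
  proof -
    from that obtain h where h: "h \<in> I" "y = h \<oplus>\<^bsub>A\<^esub> x" by (auto simp: a_r_coset_def')
    then have hA: "h \<in> carrier A" using a_Hcarr by blast
    have "c \<odot>\<^bsub>A\<^esub> y \<ominus>\<^bsub>A\<^esub> c \<odot>\<^bsub>A\<^esub> x = c \<odot>\<^bsub>A\<^esub> h"
      using hA x c by (simp add: h(2) smult_r_distr a_minus_def a_assoc r_neg)
    then show ?thesis
      using smult_ideal[OF c h(1)] hA x c by (simp add: proj_eq_iff h(2))
  qed
  moreover have "proj x \<noteq> {}" using a_rcos_self[OF x] by auto
  ultimately show ?thesis by (auto simp: quotient_algebra_def)
qed

lemma quotient_assoc_algebra: "assoc_algebra K Q"
proof -
  have group: "abelian_group Q"
    by (rule abelian_groupI)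
       (auto simp: carrier_quotient a_ac r_neg simp flip: proj_zero proj_add intro!: bexI[of _ "\<ominus>\<^bsub>A\<^esub> _"])
  have "monoid Q"
    by (rule monoidI) (auto simp: carrier_quotient m_assoc simp flip: proj_one proj_mult)
  with group have ring: "ring Q"
    by (rule ringI) (auto simp: carrier_quotient l_distr r_distr simp flip: proj_add proj_mult)
  have "module K Q"
    by (rule moduleI) 
       (auto simp: carrier_quotient module.axioms(1)[OF module_axioms] group smult_l_distr smult_r_distr smult_assoc1
         simp flip: proj_add proj_smult)
  then have "vectorspace K Q"
    by (rule vectorspace.intro) (rule field_axioms)
  then show ?thesis
    by (intro assoc_algebra.intro ring assoc_algebra_axioms.intro)
       (auto simp: carrier_quotient smult_mult_left smult_mult_right simp flip: proj_smult proj_mult)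
qed

lemma proj_linear: "linear_map K A Q proj"
  using quotient_assoc_algebra
  by (intro linear_mapI assoc_algebra.axioms(1)) (auto simp: proj_add proj_smult)

end

section \<open>Representations of a free algebra\<close>

context free_alg
begin

text \<open>
  Operators \<open>op x\<close> for the generators \<open>x\<close> extend to an action of the free algebra: a word acts by
  composition, and a general element by linear extension.
\<close>

definition word_rep :: "('k, 'v, 'l) module_scheme \<Rightarrow> ('g \<Rightarrow> 'v \<Rightarrow> 'v) \<Rightarrow> ('g list \<Rightarrow> 'k) \<Rightarrow> 'v \<Rightarrow> 'v" where
  "word_rep V op f v = lin_ext K V (\<lambda>w. foldr op w v) f"

context
  fixes V :: "('k, 'v, 'l) module_scheme" and op :: "'g \<Rightarrow> 'v \<Rightarrow> 'v"
  assumes V: "vectorspace K V" and op_linear: "\<And>x. x \<in> S \<Longrightarrow> linear_map K V V (op x)"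
begin

interpretation V: vectorspace K V by (fact V)

lemma foldr_op_linear: "w \<in> lists S \<Longrightarrow> linear_map K V V (foldr op w)"
proof (induction w)
  case Nil
  show ?case by (simp, rule V.linear_mapI[OF V]) simp_all
next
  case (Cons x w)
  then show ?case using linear_map_comp[of K V V "foldr op w" V "op x"] op_linear by (simp add: comp_def)
qed

lemma word_rep_linear: "v \<in> carrier V \<Longrightarrow> linear_map K F V (\<lambda>f. word_rep V op f v)"
  unfolding word_rep_def
  by (rule F.lin_ext_linear[OF V]) (use linear_map_closed[OF foldr_op_linear] in auto)

lemma word_rep_delta: "w \<in> lists S \<Longrightarrow> v \<in> carrier V \<Longrightarrow> word_rep V op (delta K w) v = foldr op w v"
  unfolding word_rep_def
  by (rule F.lin_ext_delta[OF V]) (use linear_map_closed[OF foldr_op_linear] in auto)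

lemma word_rep_linear_right:
  assumes "f \<in> carrier F"
  shows "linear_map K V V (word_rep V op f)"
proof (rule V.linear_mapI[OF V])
  have cl: "word_rep V op f v \<in> carrier V" if "f \<in> carrier F" "v \<in> carrier V" for f v
    using linear_map_closed[OF word_rep_linear] that by blast
  note linear = linear_map_add[OF word_rep_linear] linear_map_smult[OF word_rep_linear]
    linear_map_closed[OF foldr_op_linear] linear_map_add[OF foldr_op_linear]
    linear_map_smult[OF foldr_op_linear] word_rep_delta cl
    linear_map.T0_is_0[OF word_rep_linear]
  show "word_rep V op f v \<in> carrier V" if "v \<in> carrier V" for v using assms that by (rule cl)
  show "word_rep V op f (v \<oplus>\<^bsub>V\<^esub> v') = word_rep V op f v \<oplus>\<^bsub>V\<^esub> word_rep V op f v'"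
    if v: "v \<in> carrier V" "v' \<in> carrier V" for v v'
    using assms
  proof (induction rule: F.support_induct)
    case zero
    then show ?case using v by (simp add: linear)
  next
    case (add g c s)
    then show ?case using v by (simp add: linear V.smult_r_distr V.a_ac)
  qed
  show "word_rep V op f (c \<odot>\<^bsub>V\<^esub> v) = c \<odot>\<^bsub>V\<^esub> word_rep V op f v"
    if v: "c \<in> carrier K" "v \<in> carrier V" for c v
    using assms
  proof (induction rule: F.support_induct)
    case zero
    then show ?case using v by (simp add: linear)
  next
    case (add g b s)
    then show ?case using v
      by (simp add: linear V.smult_r_distr flip: V.smult_assoc1) (simp add: m_comm)
  qed
qed

lemma word_rep_mult:
  assumes f: "f \<in> carrier F" and g: "g \<in> carrier F" and v: "v \<in> carrier V"
  shows "word_rep V op (f \<otimes>\<^bsub>F\<^esub> g) v = word_rep V op f (word_rep V op g v)"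
proof -
  have cl: "word_rep V op g v \<in> carrier V"
    using g v by (rule linear_map_closed[OF word_rep_linear_right])
  have "word_rep V op (delta K w \<otimes>\<^bsub>F\<^esub> g) v = foldr op w (word_rep V op g v)" if w: "w \<in> lists S" for w
    by (rule F.linear_map_eqI[OF linear_map_comp[OF free_mult_linear_right word_rep_linear]
          linear_map_comp[OF word_rep_linear foldr_op_linear] g])
       (use w v in \<open>simp_all add: delta_mult word_rep_delta\<close>)
  then show ?thesis
    by (intro F.linear_map_eqI[OF linear_map_comp[OF free_mult_linear_left word_rep_linear]
          word_rep_linear f])
       (use g v cl in \<open>simp_all add: word_rep_delta\<close>)
qed

text \<open>
  To see that an ideal acts by zero, it is therefore enough to test its generators.
\<close>

lemma annihilator_ideal:
  "ideal {f \<in> carrier F. \<forall>v\<in>carrier V. word_rep V op f v = \<zero>\<^bsub>V\<^esub>} F" (is "ideal ?I F")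
proof (rule idealI[OF F.alg.ring_axioms])
  note linear = linear_map_add[OF word_rep_linear] linear_map.T_neg[OF word_rep_linear]
    linear_map.T0_is_0[OF word_rep_linear] linear_map.T0_is_0[OF word_rep_linear_right]
    linear_map_closed[OF word_rep_linear_right] word_rep_mult
  show "subgroup ?I (add_monoid F)"
    by (rule F.add.subgroupI) (auto simp: linear simp flip: a_inv_def intro!: exI[of _ "\<zero>\<^bsub>F\<^esub>"])
qed (auto simp: linear_map.T0_is_0[OF word_rep_linear_right]
    linear_map_closed[OF word_rep_linear_right] word_rep_mult)

end

end

section \<open>Free modules and the defining relations\<close>

text \<open>
  The vector space with basis \<open>S\<close>. The record type demands a multiplication and a unit, which are set to zero.
\<close>

definition free_module :: "('k, 'm) ring_scheme \<Rightarrow> 's set \<Rightarrow> ('k, 's \<Rightarrow> 'k) module" where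
  "free_module K S =
    \<lparr>carrier = {f. (\<forall>s. f s \<in> carrier K) \<and> (\<forall>s. s \<notin> S \<longrightarrow> f s = \<zero>\<^bsub>K\<^esub>) \<and> finite {s. f s \<noteq> \<zero>\<^bsub>K\<^esub>}},
     monoid.mult = (\<lambda>f g s. \<zero>\<^bsub>K\<^esub>), one = (\<lambda>s. \<zero>\<^bsub>K\<^esub>), zero = (\<lambda>s. \<zero>\<^bsub>K\<^esub>),
     add = (\<lambda>f g s. f s \<oplus>\<^bsub>K\<^esub> g s), smult = (\<lambda>c f s. c \<otimes>\<^bsub>K\<^esub> f s)\<rparr>"

lemma free_module_finsupp_space: "field K \<Longrightarrow> finsupp_space K (free_module K S) S"
  by (rule finsupp_space.intro) (auto simp: free_module_def)

abbreviation polynomials :: "('k, 'm) ring_scheme \<Rightarrow> nat \<Rightarrow> ('k, nat multiset \<Rightarrow> 'k) module" where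
  "polynomials K n \<equiv> free_module K {\<mu>. set_mset \<mu> \<subseteq> {1..n}}"

lemma indexed_pset_polynomials:
  assumes "field K" and "p \<in> ring.indexed_pset K {1..n} (carrier K)"
  shows "p \<in> carrier (polynomials K n)"
proof -
  interpret K: field K by fact
  from assms(2) show ?thesis
  proof induction
    case (indexed_const k)
    have "finite {\<mu>. K.indexed_const k \<mu> \<noteq> \<zero>\<^bsub>K\<^esub>}"
      by (rule finite_subset[of _ "{{#}}"]) (auto simp: K.indexed_const_def)
    then show ?case using indexed_const by (auto simp: free_module_def K.indexed_const_def)
  next
    case (indexed_padd P Q)
    have "finite {\<mu>. K.indexed_padd P Q \<mu> \<noteq> \<zero>\<^bsub>K\<^esub>}"
      by (rule finite_subset[of _ "{\<mu>. P \<mu> \<noteq> \<zero>\<^bsub>K\<^esub>} \<union> {\<mu>. Q \<mu> \<noteq> \<zero>\<^bsub>K\<^esub>}"])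
         (use indexed_padd.IH in \<open>auto simp: K.indexed_padd_def free_module_def\<close>)
    then show ?case using indexed_padd.IH by (auto simp: free_module_def K.indexed_padd_def)
  next
    case (indexed_pmult P i)
    have "finite {\<mu>. K.indexed_pmult P i \<mu> \<noteq> \<zero>\<^bsub>K\<^esub>}"
    proof (rule finite_subset)
      show "{\<mu>. K.indexed_pmult P i \<mu> \<noteq> \<zero>\<^bsub>K\<^esub>} \<subseteq> add_mset i ` {\<mu>. P \<mu> \<noteq> \<zero>\<^bsub>K\<^esub>}"
        by (auto simp: K.indexed_pmult_def image_iff split: if_splits) 
           (metis add_mset_remove_trivial multi_member_split)
    qed (use indexed_pmult.IH in \<open>auto simp: free_module_def\<close>)
    moreover have "K.indexed_pmult P i \<mu> = \<zero>\<^bsub>K\<^esub>" if "\<not> set_mset \<mu> \<subseteq> {1..n}" for \<mu>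
    proof (cases "i \<in># \<mu>")
      case True
      then have "set_mset \<mu> = insert i (set_mset (\<mu> - {#i#}))" by (metis insert_DiffM set_mset_add_mset_insert)
      with that \<open>i \<in> {1..n}\<close> have "\<not> set_mset (\<mu> - {#i#}) \<subseteq> {1..n}" by auto
      then show ?thesis using indexed_pmult.IH by (auto simp: K.indexed_pmult_def free_module_def)
    qed (simp add: K.indexed_pmult_def)
    ultimately show ?case using indexed_pmult.IH
      by (auto simp: free_module_def K.indexed_pmult_def)
  qed
qed

lemma ordered_monomial_cong:
  "(\<And>l. l \<in> {1..n} \<Longrightarrow> m l = m' l) \<Longrightarrow> ordered_monomial A n t m = ordered_monomial A n t m'"
  unfolding ordered_monomial_def by (rule foldr_cong) auto

lemma poly_eval_lin_ext: "poly_eval K A n t p = lin_ext K A (\<lambda>\<mu>. ordered_monomial A n t (count \<mu>)) p"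
  by (simp add: poly_eval_def lin_ext_def)

lemma (in monoid) commutes_pow:
  assumes "x \<in> carrier G" "y \<in> carrier G" "x \<otimes> y = y \<otimes> x"
  shows "x \<otimes> y [^] (k::nat) = y [^] k \<otimes> x"
proof (induction k)
  case (Suc k)
  have "x \<otimes> y [^] Suc k = (x \<otimes> y [^] k) \<otimes> y" using assms by (simp add: m_assoc)
  also have "\<dots> = y [^] k \<otimes> (x \<otimes> y)" using assms by (simp add: Suc m_assoc)
  also have "\<dots> = y [^] Suc k \<otimes> x" using assms by (simp add: m_assoc)
  finally show ?case .
qed (use assms in simp)

lemma (in linear_map) map_lin_ext:
  assumes "f \<in> S \<rightarrow> carrier K" "g \<in> S \<rightarrow> carrier V" "{s. f s \<noteq> \<zero>\<^bsub>K\<^esub>} \<subseteq> S"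
  shows "T (lin_ext K V g f) = lin_ext K W (\<lambda>s. T (g s)) f"
proof -
  have "T (\<Oplus>\<^bsub>V\<^esub>s\<in>F. f s \<odot>\<^bsub>V\<^esub> g s) = (\<Oplus>\<^bsub>W\<^esub>s\<in>F. f s \<odot>\<^bsub>W\<^esub> T (g s))"
    if "F \<subseteq> S" for F
    using that
  proof (induction F rule: infinite_finite_induct)
    case (insert s F)
    then have "g s \<in> carrier V" "f s \<in> carrier K" "\<And>s. s \<in> F \<Longrightarrow> g s \<in> carrier V"
      "\<And>s. s \<in> F \<Longrightarrow> f s \<in> carrier K"
      using assms by auto
    with insert show ?case by (simp add: Pi_def)
  qed auto
  then show ?thesis unfolding lin_ext_def using assms(3) .
qed

text \<open>
  Everything about the monomials that follows from the relations alone, so that no cosets occur in these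
  computations.
\<close>

locale du_elements = assoc_algebra K A for K :: "('k, 'm) ring_scheme" and A :: "('k, 'a, 'l) module_scheme" +
  fixes n :: nat and \<alpha> \<beta> :: 'k and \<phi> :: "nat multiset \<Rightarrow> 'k" and u d :: 'a and t :: "nat \<Rightarrow> 'a"
  assumes parameters: "\<alpha> \<in> carrier K" "\<beta> \<in> carrier K" "\<phi> \<in> carrier (polynomials K n)"
    and elements [simp, intro]: "u \<in> carrier A" "d \<in> carrier A" "\<And>i. i \<in> {1..n} \<Longrightarrow> t i \<in> carrier A"
    and t_commute: "\<And>i j. i \<in> {1..n} \<Longrightarrow> j \<in> {1..n} \<Longrightarrow> t i \<otimes>\<^bsub>A\<^esub> t j = t j \<otimes>\<^bsub>A\<^esub> t i"
    and t_u_commute: "\<And>i. i \<in> {1..n} \<Longrightarrow> t i \<otimes>\<^bsub>A\<^esub> u = u \<otimes>\<^bsub>A\<^esub> t i"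
    and t_d_commute: "\<And>i. i \<in> {1..n} \<Longrightarrow> t i \<otimes>\<^bsub>A\<^esub> d = d \<otimes>\<^bsub>A\<^esub> t i"
    and ddu: "d \<otimes>\<^bsub>A\<^esub> d \<otimes>\<^bsub>A\<^esub> u =
      \<alpha> \<odot>\<^bsub>A\<^esub> (d \<otimes>\<^bsub>A\<^esub> u \<otimes>\<^bsub>A\<^esub> d) \<oplus>\<^bsub>A\<^esub> \<beta> \<odot>\<^bsub>A\<^esub> (u \<otimes>\<^bsub>A\<^esub> d \<otimes>\<^bsub>A\<^esub> d) \<oplus>\<^bsub>A\<^esub> poly_eval K A n t \<phi> \<otimes>\<^bsub>A\<^esub> d"
    and duu: "d \<otimes>\<^bsub>A\<^esub> u \<otimes>\<^bsub>A\<^esub> u =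
      \<alpha> \<odot>\<^bsub>A\<^esub> (u \<otimes>\<^bsub>A\<^esub> d \<otimes>\<^bsub>A\<^esub> u) \<oplus>\<^bsub>A\<^esub> \<beta> \<odot>\<^bsub>A\<^esub> (u \<otimes>\<^bsub>A\<^esub> u \<otimes>\<^bsub>A\<^esub> d) \<oplus>\<^bsub>A\<^esub> u \<otimes>\<^bsub>A\<^esub> poly_eval K A n t \<phi>"
begin

definition t_monomial :: "nat multiset \<Rightarrow> 'a" where
  "t_monomial \<mu> = ordered_monomial A n t (count \<mu>)"

lemma foldr_powers_closed:
  fixes m :: "nat \<Rightarrow> nat"
  shows "set xs \<subseteq> {1..n} \<Longrightarrow> foldr (\<lambda>i y. (t i [^]\<^bsub>A\<^esub> m i) \<otimes>\<^bsub>A\<^esub> y) xs \<one>\<^bsub>A\<^esub> \<in> carrier A"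
  by (induction xs) auto

lemma t_monomial_closed [simp, intro]: "t_monomial \<mu> \<in> carrier A"
  unfolding t_monomial_def ordered_monomial_def by (rule foldr_powers_closed) auto

lemma t_monomial_empty [simp]: "t_monomial {#} = \<one>\<^bsub>A\<^esub>"
proof -
  have "set xs \<subseteq> {1..n} \<Longrightarrow> foldr (\<lambda>i y. (t i [^]\<^bsub>A\<^esub> (0::nat)) \<otimes>\<^bsub>A\<^esub> y) xs \<one>\<^bsub>A\<^esub> = \<one>\<^bsub>A\<^esub>" for xs
    by (induction xs) auto
  from this[of "[1..<Suc n]"] show ?thesis
    by (simp add: t_monomial_def ordered_monomial_def atLeastLessThanSuc_atLeastAtMost del: upt_Suc)
qed

lemma foldr_powers_commute:
  fixes m :: "nat \<Rightarrow> nat"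
  assumes z: "z \<in> carrier A" "\<And>i. i \<in> {1..n} \<Longrightarrow> z \<otimes>\<^bsub>A\<^esub> t i = t i \<otimes>\<^bsub>A\<^esub> z" and "set xs \<subseteq> {1..n}"
  shows "z \<otimes>\<^bsub>A\<^esub> foldr (\<lambda>i y. (t i [^]\<^bsub>A\<^esub> m i) \<otimes>\<^bsub>A\<^esub> y) xs \<one>\<^bsub>A\<^esub> =
    foldr (\<lambda>i y. (t i [^]\<^bsub>A\<^esub> m i) \<otimes>\<^bsub>A\<^esub> y) xs \<one>\<^bsub>A\<^esub> \<otimes>\<^bsub>A\<^esub> z"
  using assms(3)
proof (induction xs)
  case (Cons x xs)
  let ?Y = "foldr (\<lambda>i y. (t i [^]\<^bsub>A\<^esub> m i) \<otimes>\<^bsub>A\<^esub> y) xs \<one>\<^bsub>A\<^esub>"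
  have x: "t x \<in> carrier A" and Y: "?Y \<in> carrier A" using Cons.prems foldr_powers_closed by auto
  have "z \<otimes>\<^bsub>A\<^esub> (t x [^]\<^bsub>A\<^esub> m x \<otimes>\<^bsub>A\<^esub> ?Y) = (z \<otimes>\<^bsub>A\<^esub> t x [^]\<^bsub>A\<^esub> m x) \<otimes>\<^bsub>A\<^esub> ?Y"
    using z x Y by (simp add: alg.m_assoc)
  also have "\<dots> = t x [^]\<^bsub>A\<^esub> m x \<otimes>\<^bsub>A\<^esub> (z \<otimes>\<^bsub>A\<^esub> ?Y)"
    using alg.commutes_pow[OF z(1) x, of "m x"] z Cons.prems x Y by (simp add: alg.m_assoc)
  also have "\<dots> = (t x [^]\<^bsub>A\<^esub> m x \<otimes>\<^bsub>A\<^esub> ?Y) \<otimes>\<^bsub>A\<^esub> z"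
    using Cons z x Y by (simp add: alg.m_assoc)
  finally show ?case by simp
qed (use z in simp)

text \<open>
  An element that commutes with all \<open>t\<^sub>i\<close> commutes with monomials in them; this is used for \<open>u\<close> and \<open>d\<close>.
\<close>

lemma t_monomial_commute:
  "z \<in> carrier A \<Longrightarrow> (\<And>i. i \<in> {1..n} \<Longrightarrow> z \<otimes>\<^bsub>A\<^esub> t i = t i \<otimes>\<^bsub>A\<^esub> z) \<Longrightarrow>
    z \<otimes>\<^bsub>A\<^esub> t_monomial \<mu> = t_monomial \<mu> \<otimes>\<^bsub>A\<^esub> z"
  unfolding t_monomial_def ordered_monomial_def by (rule foldr_powers_commute) auto

lemma foldr_powers_update:
  fixes m :: "nat \<Rightarrow> nat"
  assumes "l \<in> set xs" "distinct xs" "set xs \<subseteq> {1..n}"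
  shows "t l \<otimes>\<^bsub>A\<^esub> foldr (\<lambda>i y. (t i [^]\<^bsub>A\<^esub> m i) \<otimes>\<^bsub>A\<^esub> y) xs \<one>\<^bsub>A\<^esub> =
    foldr (\<lambda>i y. (t i [^]\<^bsub>A\<^esub> (m(l := Suc (m l))) i) \<otimes>\<^bsub>A\<^esub> y) xs \<one>\<^bsub>A\<^esub>"
  using assms
proof (induction xs)
  case (Cons x xs)
  let ?Y = "foldr (\<lambda>i y. (t i [^]\<^bsub>A\<^esub> m i) \<otimes>\<^bsub>A\<^esub> y) xs \<one>\<^bsub>A\<^esub>"
  have x: "t x \<in> carrier A" and l: "t l \<in> carrier A" and Y: "?Y \<in> carrier A"
    using Cons.prems foldr_powers_closed by auto
  show ?case
  proof (cases "x = l")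
    case True
    have "foldr (\<lambda>i y. (t i [^]\<^bsub>A\<^esub> (m(l := Suc (m l))) i) \<otimes>\<^bsub>A\<^esub> y) xs \<one>\<^bsub>A\<^esub> = ?Y"
      using Cons.prems True by (intro foldr_cong) auto
    then show ?thesis using True l Y alg.commutes_pow[OF l l, of "m l"]
      by (simp flip: alg.m_assoc)
  next
    case False
    have "t l \<otimes>\<^bsub>A\<^esub> (t x [^]\<^bsub>A\<^esub> m x \<otimes>\<^bsub>A\<^esub> ?Y) = (t l \<otimes>\<^bsub>A\<^esub> t x [^]\<^bsub>A\<^esub> m x) \<otimes>\<^bsub>A\<^esub> ?Y"
      using l x Y by (simp add: alg.m_assoc)
    also have "\<dots> = t x [^]\<^bsub>A\<^esub> m x \<otimes>\<^bsub>A\<^esub> (t l \<otimes>\<^bsub>A\<^esub> ?Y)"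
    proof -
      have "t l \<otimes>\<^bsub>A\<^esub> t x = t x \<otimes>\<^bsub>A\<^esub> t l" using Cons.prems by (intro t_commute) auto
      then show ?thesis using alg.commutes_pow[OF l x, of "m x"] l x Y by (simp add: alg.m_assoc)
    qed
    finally show ?thesis using Cons False by simp
  qed
qed simp

lemma t_monomial_add_mset:
  assumes "l \<in> {1..n}"
  shows "t_monomial (add_mset l \<mu>) = t l \<otimes>\<^bsub>A\<^esub> t_monomial \<mu>"
proof -
  have "count (add_mset l \<mu>) = (count \<mu>)(l := Suc (count \<mu> l))" by auto
  then show ?thesis
    unfolding t_monomial_def ordered_monomial_def
    using foldr_powers_update[of l "[1..<Suc n]" "count \<mu>"] assms
    by (simp only: atLeastLessThanSuc_atLeastAtMost set_upt distinct_upt simp_thms subset_refl)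
qed

text \<open>
  The right end of a monomial. It is untouched when a monomial is multiplied from the left.
\<close>

definition right_factor :: "nat multiset \<Rightarrow> 'a" where
  "right_factor \<nu> = d [^]\<^bsub>A\<^esub> count \<nu> 0 \<otimes>\<^bsub>A\<^esub> t_monomial \<nu>"

text \<open>
  The multiplicities of \<open>0, 1, \<dots>, n\<close> in \<open>\<nu>\<close> are the exponents of \<open>d, t\<^sub>1, \<dots>, t\<^sub>n\<close>; a single multiset makes right
  multiplication by these commuting elements an addition.
\<close>

definition normal_monomial :: "nat \<times> nat \<times> nat multiset \<Rightarrow> 'a" where
  "normal_monomial = (\<lambda>(i, j, \<nu>). u [^]\<^bsub>A\<^esub> i \<otimes>\<^bsub>A\<^esub> (d \<otimes>\<^bsub>A\<^esub> u) [^]\<^bsub>A\<^esub> j \<otimes>\<^bsub>A\<^esub> right_factor \<nu>)"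

lemma right_factor_closed [simp, intro]: "right_factor \<nu> \<in> carrier A"
  by (simp add: right_factor_def)

lemma normal_monomial_closed [simp, intro]: "normal_monomial x \<in> carrier A"
  by (simp add: normal_monomial_def split: prod.split)

lemma t_monomial_commute_d: "t_monomial \<mu> \<otimes>\<^bsub>A\<^esub> d = d \<otimes>\<^bsub>A\<^esub> t_monomial \<mu>"
  and t_monomial_commute_u: "t_monomial \<mu> \<otimes>\<^bsub>A\<^esub> u = u \<otimes>\<^bsub>A\<^esub> t_monomial \<mu>"
  by (auto intro!: t_monomial_commute[symmetric] simp: t_d_commute t_u_commute)

lemma t_monomial_add_0: "t_monomial (add_mset 0 \<mu>) = t_monomial \<mu>"
  unfolding t_monomial_def by (rule ordered_monomial_cong) auto

text \<open>
  Since \<open>d\<close> and the \<open>t\<^sub>l\<close> commute with each other, \<open>right_factor\<close> is multiplicative. This allows one multiset to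
  encode the exponents of \<open>d\<close> and of all \<open>t\<^sub>l\<close>.
\<close>

lemma right_factor_add:
  assumes "set_mset \<mu> \<subseteq> {0..n}"
  shows "right_factor (\<mu> + \<nu>) = right_factor \<mu> \<otimes>\<^bsub>A\<^esub> right_factor \<nu>"
  using assms
proof (induction \<mu>)
  case empty
  then show ?case by (simp add: right_factor_def)
next
  case (add l \<mu>)
  show ?case
  proof (cases "l = 0")
    case True
    have "right_factor (add_mset 0 \<mu>) = d \<otimes>\<^bsub>A\<^esub> right_factor \<mu>" for \<mu>
      using alg.commutes_pow[of d d "count \<mu> 0"]
      by (simp add: right_factor_def t_monomial_add_0 flip: alg.m_assoc)
    with True add show ?thesis by (simp add: alg.m_assoc)
  next
    case False
    with add.prems have l: "l \<in> {1..n}" by auto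
    have "right_factor (add_mset l \<mu>) = t l \<otimes>\<^bsub>A\<^esub> right_factor \<mu>" for \<mu>
    proof -
      have "t l \<otimes>\<^bsub>A\<^esub> d [^]\<^bsub>A\<^esub> count \<mu> 0 = d [^]\<^bsub>A\<^esub> count \<mu> 0 \<otimes>\<^bsub>A\<^esub> t l"
        using l by (intro alg.commutes_pow) (auto simp: t_d_commute)
      then show ?thesis using l False elements(3)[OF l]
        by (simp add: right_factor_def t_monomial_add_mset flip: alg.m_assoc)
    qed
    with add l elements(3)[OF l] show ?thesis by (simp add: alg.m_assoc)
  qed
qed

lemma right_factor_t: "0 \<notin># \<mu> \<Longrightarrow> right_factor \<mu> = t_monomial \<mu>"
  by (simp add: right_factor_def not_in_iff)

lemma normal_monomial_split: "normal_monomial (i, j, \<nu>) = normal_monomial (i, j, {#}) \<otimes>\<^bsub>A\<^esub> right_factor \<nu>"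
  by (simp add: normal_monomial_def right_factor_def)

lemma normal_monomial_add:
  "set_mset \<nu> \<subseteq> {0..n} \<Longrightarrow> normal_monomial (i, j, \<nu> + \<mu>) = normal_monomial (i, j, \<nu>) \<otimes>\<^bsub>A\<^esub> right_factor \<mu>"
  by (simp add: normal_monomial_def right_factor_add alg.m_assoc)

lemma normal_monomial_u: "normal_monomial (Suc i, j, \<nu>) = u \<otimes>\<^bsub>A\<^esub> normal_monomial (i, j, \<nu>)"
  using alg.commutes_pow[of u u i] by (simp add: normal_monomial_def flip: alg.m_assoc)

lemma normal_monomial_du: "normal_monomial (0, Suc j, \<nu>) = d \<otimes>\<^bsub>A\<^esub> (u \<otimes>\<^bsub>A\<^esub> normal_monomial (0, j, \<nu>))"
proof -
  have "normal_monomial (0, Suc j, \<nu>) = (d \<otimes>\<^bsub>A\<^esub> u) \<otimes>\<^bsub>A\<^esub> normal_monomial (0, j, \<nu>)"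
    using alg.commutes_pow[of "d \<otimes>\<^bsub>A\<^esub> u" "d \<otimes>\<^bsub>A\<^esub> u" j]
    by (simp add: normal_monomial_def flip: alg.m_assoc)
  then show ?thesis by (simp add: alg.m_assoc)
qed

lemma t_monomial_commute_right_factor:
  assumes "set_mset \<mu> \<subseteq> {1..n}" "set_mset \<nu> \<subseteq> {0..n}"
  shows "t_monomial \<mu> \<otimes>\<^bsub>A\<^esub> right_factor \<nu> = right_factor \<nu> \<otimes>\<^bsub>A\<^esub> t_monomial \<mu>"
proof -
  have "right_factor \<mu> = t_monomial \<mu>" using assms by (intro right_factor_t) auto
  moreover have "right_factor (\<mu> + \<nu>) = right_factor (\<nu> + \<mu>)" by (simp add: add.commute)
  moreover have "set_mset \<mu> \<subseteq> {0..n}" using assms by auto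
  ultimately show ?thesis using right_factor_add[of \<mu> \<nu>] right_factor_add[of \<nu> \<mu>] assms by simp
qed

lemma normal_monomial_t_monomial:
  assumes "set_mset \<mu> \<subseteq> {1..n}" "set_mset \<nu> \<subseteq> {0..n}"
  shows "t_monomial \<mu> \<otimes>\<^bsub>A\<^esub> normal_monomial (i, j, \<nu>) = normal_monomial (i, j, \<nu> + \<mu>)"
proof -
  have cu: "t_monomial \<mu> \<otimes>\<^bsub>A\<^esub> u [^]\<^bsub>A\<^esub> i = u [^]\<^bsub>A\<^esub> i \<otimes>\<^bsub>A\<^esub> t_monomial \<mu>"
    by (rule alg.commutes_pow) (auto simp: t_monomial_commute_u)
  have "t_monomial \<mu> \<otimes>\<^bsub>A\<^esub> (d \<otimes>\<^bsub>A\<^esub> u) = (t_monomial \<mu> \<otimes>\<^bsub>A\<^esub> d) \<otimes>\<^bsub>A\<^esub> u" by (simp add: alg.m_assoc)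
  also have "\<dots> = d \<otimes>\<^bsub>A\<^esub> (t_monomial \<mu> \<otimes>\<^bsub>A\<^esub> u)" by (simp add: t_monomial_commute_d alg.m_assoc)
  also have "\<dots> = d \<otimes>\<^bsub>A\<^esub> u \<otimes>\<^bsub>A\<^esub> t_monomial \<mu>" by (simp add: t_monomial_commute_u alg.m_assoc)
  finally have cdu: "t_monomial \<mu> \<otimes>\<^bsub>A\<^esub> (d \<otimes>\<^bsub>A\<^esub> u) [^]\<^bsub>A\<^esub> j = (d \<otimes>\<^bsub>A\<^esub> u) [^]\<^bsub>A\<^esub> j \<otimes>\<^bsub>A\<^esub> t_monomial \<mu>"
    by (intro alg.commutes_pow) auto
  have "t_monomial \<mu> \<otimes>\<^bsub>A\<^esub> normal_monomial (i, j, \<nu>) =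
      (t_monomial \<mu> \<otimes>\<^bsub>A\<^esub> u [^]\<^bsub>A\<^esub> i) \<otimes>\<^bsub>A\<^esub> ((d \<otimes>\<^bsub>A\<^esub> u) [^]\<^bsub>A\<^esub> j \<otimes>\<^bsub>A\<^esub> right_factor \<nu>)"
    by (simp add: normal_monomial_def alg.m_assoc)
  also have "\<dots> = u [^]\<^bsub>A\<^esub> i \<otimes>\<^bsub>A\<^esub> ((t_monomial \<mu> \<otimes>\<^bsub>A\<^esub> (d \<otimes>\<^bsub>A\<^esub> u) [^]\<^bsub>A\<^esub> j) \<otimes>\<^bsub>A\<^esub> right_factor \<nu>)"
    by (simp add: cu alg.m_assoc)
  also have "\<dots> = u [^]\<^bsub>A\<^esub> i \<otimes>\<^bsub>A\<^esub> ((d \<otimes>\<^bsub>A\<^esub> u) [^]\<^bsub>A\<^esub> j \<otimes>\<^bsub>A\<^esub> (t_monomial \<mu> \<otimes>\<^bsub>A\<^esub> right_factor \<nu>))"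
    by (simp add: cdu alg.m_assoc)
  also have "t_monomial \<mu> \<otimes>\<^bsub>A\<^esub> right_factor \<nu> = right_factor (\<nu> + \<mu>)"
  proof -
    have "right_factor \<mu> = t_monomial \<mu>" using assms by (intro right_factor_t) auto
    then show ?thesis
      using assms by (simp add: t_monomial_commute_right_factor right_factor_add)
  qed
  finally show ?thesis by (simp add: normal_monomial_def alg.m_assoc)
qed

end

section \<open>The module of normal forms\<close>

definition normal_indices :: "nat \<Rightarrow> (nat \<times> nat \<times> nat multiset) set" where
  "normal_indices n = UNIV \<times> UNIV \<times> {\<nu>. set_mset \<nu> \<subseteq> {0..n}}"

lemma mem_normal_indices: "(i, j, \<nu>) \<in> normal_indices n \<longleftrightarrow> set_mset \<nu> \<subseteq> {0..n}"
  by (simp add: normal_indices_def)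

type_synonym 'k normal_form = "nat \<times> nat \<times> nat multiset \<Rightarrow> 'k"

locale du_model = field K for K :: "('k, 'm) ring_scheme" +
  fixes n :: nat and \<alpha> \<beta> :: 'k and \<phi> :: "nat multiset \<Rightarrow> 'k"
  assumes parameters [simp]: "\<alpha> \<in> carrier K" "\<beta> \<in> carrier K" "\<phi> \<in> carrier (polynomials K n)"
begin

abbreviation M where "M \<equiv> free_module K (normal_indices n)"

sublocale P: finsupp_space K "polynomials K n" "{\<mu>. set_mset \<mu> \<subseteq> {1..n}}"
  by (rule free_module_finsupp_space) (rule field_axioms)

sublocale M: finsupp_space K M "normal_indices n"
  by (rule free_module_finsupp_space) (rule field_axioms)

definition e :: "nat \<Rightarrow> nat \<Rightarrow> nat multiset \<Rightarrow> 'k normal_form" where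
  "e i j \<nu> = delta K (i, j, \<nu>)"

text \<open>
  Right multiplication by \<open>right_factor \<mu>\<close>. For \<open>\<mu>\<close> without \<open>0\<close> this is also left multiplication by the
  monomial in the \<open>t\<^sub>l\<close>, which is central.
\<close>

definition shift :: "nat multiset \<Rightarrow> 'k normal_form \<Rightarrow> 'k normal_form" where
  "shift \<mu> = lin_ext K M (\<lambda>(i, j, \<nu>). e i j (\<nu> + \<mu>))"

definition up :: "'k normal_form \<Rightarrow> 'k normal_form" where
  "up = lin_ext K M (\<lambda>(i, j, \<nu>). e (Suc i) j \<nu>)"

text \<open>
  Multiplication by the central element \<open>\<phi>(t\<^sub>1,\<dots>,t\<^sub>n)\<close>.
\<close>

definition phi_op :: "'k normal_form \<Rightarrow> 'k normal_form" where
  "phi_op v = lin_ext K M (\<lambda>\<mu>. shift \<mu> v) \<phi>"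

text \<open>
  The second-order recursion in \<open>i\<close> for \<open>d u\<^sup>i x\<^sup>j\<close>, read off from the relation for \<open>du\<^sup>2\<close>, with initial values
  \<open>d x\<^sup>j = b\<close> and \<open>d u x\<^sup>j = x\<^sup>j\<^sup>+\<^sup>1\<close>. The pair consists of the values at \<open>i\<close> and \<open>i + 1\<close>.
\<close>

primrec down_column :: "'k normal_form \<Rightarrow> nat \<Rightarrow> nat \<Rightarrow>
    'k normal_form \<times> 'k normal_form" where
  "down_column b j 0 = (b, e 0 (Suc j) {#})"
| "down_column b j (Suc i) = (case down_column b j i of (x, y) \<Rightarrow>
    (y, \<alpha> \<odot>\<^bsub>M\<^esub> up y \<oplus>\<^bsub>M\<^esub> \<beta> \<odot>\<^bsub>M\<^esub> up (up x) \<oplus>\<^bsub>M\<^esub> phi_op (e (Suc i) j {#})))"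

definition down_at :: "(nat \<Rightarrow> 'k normal_form) \<Rightarrow> nat \<Rightarrow> nat \<Rightarrow> 'k normal_form" where
  "down_at D i j = fst (down_column (D j) j i)"

lemma down_at_0 [simp]: "down_at D 0 j = D j"
  and down_at_1 [simp]: "down_at D (Suc 0) j = e 0 (Suc j) {#}"
  and down_at_Suc_Suc [simp]: "down_at D (Suc (Suc i)) j =
    \<alpha> \<odot>\<^bsub>M\<^esub> up (down_at D (Suc i) j) \<oplus>\<^bsub>M\<^esub> \<beta> \<odot>\<^bsub>M\<^esub> up (up (down_at D i j)) \<oplus>\<^bsub>M\<^esub> phi_op (e (Suc i) j {#})"
  by (simp_all add: down_at_def split: prod.split)

text \<open>
  Left multiplication by \<open>d\<close>, provided that \<open>D j\<close> is the value of \<open>d x\<^sup>j\<close>.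
\<close>

definition down_from :: "(nat \<Rightarrow> 'k normal_form) \<Rightarrow>
    'k normal_form \<Rightarrow> 'k normal_form" where
  "down_from D = lin_ext K M (\<lambda>(i, j, \<nu>). shift \<nu> (down_at D i j))"

text \<open>
  The value of \<open>d x\<^sup>j\<^sup>+\<^sup>1 = d\<^sup>2u x\<^sup>j\<close> that the relation for \<open>d\<^sup>2u\<close> dictates when \<open>v = d x\<^sup>j\<close>.
\<close>

definition down_step where
  "down_step D v = \<alpha> \<odot>\<^bsub>M\<^esub> down_from D (up v) \<oplus>\<^bsub>M\<^esub> \<beta> \<odot>\<^bsub>M\<^esub> up (down_from D v) \<oplus>\<^bsub>M\<^esub> phi_op v"

text \<open>
  \<open>down_approx J j\<close> is the value of \<open>d x\<^sup>j\<close> for \<open>j \<le> J\<close>. The next stage applies left multiplication by \<open>d\<close> to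
  vectors that only involve powers of \<open>x\<close> up to \<open>J\<close>, so it may use the operator built from the current
  stage. The entries for \<open>j > J\<close> are a default value in the module, so that \<open>down_from\<close> is linear at every
  stage. The value \<open>e 0 0 {#0#}\<close> at \<open>j = 0\<close> is \<open>d\<close> itself.
\<close>

primrec down_approx :: "nat \<Rightarrow> nat \<Rightarrow> 'k normal_form" where
  "down_approx 0 = (\<lambda>_. e 0 0 {#0#})"
| "down_approx (Suc J) = (down_approx J)(Suc J := down_step (down_approx J) (down_approx J J))"

definition down_base :: "nat \<Rightarrow> 'k normal_form" where
  "down_base j = down_approx j j"

definition down :: "'k normal_form \<Rightarrow> 'k normal_form" where
  "down = down_from down_base"

lemma e_closed [simp, intro]: "set_mset \<nu> \<subseteq> {0..n} \<Longrightarrow> e i j \<nu> \<in> carrier M"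
  unfolding e_def by (rule M.delta_closed) (simp add: mem_normal_indices)

lemma shift_linear: "set_mset \<mu> \<subseteq> {0..n} \<Longrightarrow> linear_map K M M (shift \<mu>)"
  unfolding shift_def by (rule M.lin_ext_linear[OF M.vectorspace_axioms]) (auto simp: mem_normal_indices)

lemma shift_e: "set_mset \<mu> \<subseteq> {0..n} \<Longrightarrow> set_mset \<nu> \<subseteq> {0..n} \<Longrightarrow> shift \<mu> (e i j \<nu>) = e i j (\<nu> + \<mu>)"
  unfolding shift_def e_def[of i j \<nu>]
  by (subst M.lin_ext_delta[OF M.vectorspace_axioms]) (auto simp: mem_normal_indices)

lemma up_linear: "linear_map K M M up"
  unfolding up_def by (rule M.lin_ext_linear[OF M.vectorspace_axioms]) (auto simp: mem_normal_indices)

lemma up_e [simp]: "set_mset \<nu> \<subseteq> {0..n} \<Longrightarrow> up (e i j \<nu>) = e (Suc i) j \<nu>"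
  unfolding up_def e_def[of i j \<nu>]
  by (subst M.lin_ext_delta[OF M.vectorspace_axioms]) (auto simp: mem_normal_indices)

lemma linear_map_eqI:
  assumes "linear_map K M W T" "linear_map K M W T'" "v \<in> carrier M"
    and "\<And>i j \<nu>. set_mset \<nu> \<subseteq> {0..n} \<Longrightarrow> T (e i j \<nu>) = T' (e i j \<nu>)"
  shows "T v = T' v"
  by (rule M.linear_map_eqI[OF assms(1-3)]) (use assms(4) in \<open>auto simp: mem_normal_indices e_def\<close>)

lemmas up_simps [simp] = linear_map_closed[OF up_linear] linear_map_add[OF up_linear]
  linear_map_smult[OF up_linear]

lemmas shift_simps [simp] = linear_map_closed[OF shift_linear] linear_map_add[OF shift_linear]
  linear_map_smult[OF shift_linear]

lemma shift_empty [simp]: "v \<in> carrier M \<Longrightarrow> shift {#} v = v"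
  by (rule linear_map_eqI[OF shift_linear M.linear_mapI[OF M.vectorspace_axioms]]) (auto simp: shift_e)

lemma shift_add:
  assumes "set_mset \<mu> \<subseteq> {0..n}" "set_mset \<nu> \<subseteq> {0..n}" "v \<in> carrier M"
  shows "shift (\<mu> + \<nu>) v = shift \<mu> (shift \<nu> v)"
  by (rule linear_map_eqI[OF shift_linear linear_map_comp[OF shift_linear shift_linear]])
     (use assms in \<open>auto simp: shift_e ac_simps\<close>)

lemma shift_commute:
  assumes "set_mset \<mu> \<subseteq> {0..n}" "set_mset \<nu> \<subseteq> {0..n}" "v \<in> carrier M"
  shows "shift \<mu> (shift \<nu> v) = shift \<nu> (shift \<mu> v)"
  using shift_add[OF assms] shift_add[OF assms(2,1,3)] by (simp add: add.commute)

lemma shift_up: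
  assumes "set_mset \<mu> \<subseteq> {0..n}" "v \<in> carrier M"
  shows "shift \<mu> (up v) = up (shift \<mu> v)"
  by (rule linear_map_eqI[OF linear_map_comp[OF up_linear shift_linear] linear_map_comp[OF shift_linear up_linear]])
     (use assms in \<open>auto simp: shift_e\<close>)

lemma variables_subset: "set_mset \<mu> \<subseteq> {1..n} \<Longrightarrow> set_mset \<mu> \<subseteq> {0..n}"
  by auto

lemma map_phi_op:
  assumes T: "linear_map K M W T" and v: "v \<in> carrier M"
  shows "T (phi_op v) = lin_ext K W (\<lambda>\<mu>. T (shift \<mu> v)) \<phi>"
  unfolding phi_op_def
proof (rule linear_map.map_lin_ext[OF T])
  show "{s. \<phi> s \<noteq> \<zero>\<^bsub>K\<^esub>} \<subseteq> {\<mu>. set_mset \<mu> \<subseteq> {1..n}}" by (rule P.support_subset) (rule parameters(3))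
  show "(\<lambda>\<mu>. shift \<mu> v) \<in> {\<mu>. set_mset \<mu> \<subseteq> {1..n}} \<rightarrow> carrier M"
    using v variables_subset by auto
  show "\<phi> \<in> {\<mu>. set_mset \<mu> \<subseteq> {1..n}} \<rightarrow> carrier K" using P.coeff_closed[OF parameters(3)] by auto
qed

lemma lin_ext_phi_cong:
  assumes "\<And>\<mu>. set_mset \<mu> \<subseteq> {1..n} \<Longrightarrow> g \<mu> = h \<mu>" and "vectorspace K W"
    and "\<And>\<mu>. set_mset \<mu> \<subseteq> {1..n} \<Longrightarrow> h \<mu> \<in> carrier W"
  shows "lin_ext K W g \<phi> = lin_ext K W h \<phi>"
proof -
  interpret W: vectorspace K W by fact
  have "set_mset \<mu> \<subseteq> {1..n}" if "\<phi> \<mu> \<noteq> \<zero>\<^bsub>K\<^esub>" for \<mu>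
    using P.coeff_outside[OF parameters(3), of \<mu>] that by blast
  then show ?thesis
    unfolding lin_ext_def using assms P.coeff_closed[OF parameters(3)]
    by (intro W.finsum_cong') (auto intro!: W.smult_closed)
qed

lemma phi_op_linear: "linear_map K M M phi_op"
proof (rule M.linear_mapI[OF M.vectorspace_axioms])
  have lin: "linear_map K (polynomials K n) M (\<lambda>p. lin_ext K M (\<lambda>\<mu>. shift \<mu> v) p)"
    if "v \<in> carrier M" for v
    by (rule P.lin_ext_linear[OF M.vectorspace_axioms]) (use that variables_subset in auto)
  then show "phi_op v \<in> carrier M" if "v \<in> carrier M" for v
    unfolding phi_op_def using that linear_map_closed[OF lin parameters(3)] by simp
  have supp: "{\<mu>. \<phi> \<mu> \<noteq> \<zero>\<^bsub>K\<^esub>} \<subseteq> {\<mu>. set_mset \<mu> \<subseteq> {1..n}}" by (rule P.support_subset) (rule parameters(3))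
  have cl: "\<phi> \<mu> \<in> carrier K" for \<mu> using P.coeff_closed[OF parameters(3)] .
  have sub: "set_mset \<mu> \<subseteq> {0..n}" if "\<phi> \<mu> \<noteq> \<zero>\<^bsub>K\<^esub>" for \<mu>
    using supp that variables_subset by blast
  show "phi_op (v \<oplus>\<^bsub>M\<^esub> w) = phi_op v \<oplus>\<^bsub>M\<^esub> phi_op w" if "v \<in> carrier M" "w \<in> carrier M" for v w
  proof -
    have "phi_op (v \<oplus>\<^bsub>M\<^esub> w) =
        (\<Oplus>\<^bsub>M\<^esub>\<mu>\<in>{\<mu>. \<phi> \<mu> \<noteq> \<zero>\<^bsub>K\<^esub>}. \<phi> \<mu> \<odot>\<^bsub>M\<^esub> shift \<mu> v \<oplus>\<^bsub>M\<^esub> \<phi> \<mu> \<odot>\<^bsub>M\<^esub> shift \<mu> w)"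
      unfolding phi_op_def lin_ext_def
      by (intro M.finsum_cong') (use that sub cl in \<open>auto simp: M.smult_r_distr\<close>)
    also have "\<dots> = phi_op v \<oplus>\<^bsub>M\<^esub> phi_op w"
      unfolding phi_op_def lin_ext_def by (intro M.finsum_addf) (use that sub cl in auto)
    finally show ?thesis .
  qed
  show "phi_op (c \<odot>\<^bsub>M\<^esub> v) = c \<odot>\<^bsub>M\<^esub> phi_op v" if c: "c \<in> carrier K" and v: "v \<in> carrier M" for c v
  proof -
    have "linear_map K M M (\<lambda>v. c \<odot>\<^bsub>M\<^esub> v)"
      using c by (intro M.linear_mapI[OF M.vectorspace_axioms])
        (auto simp: M.smult_r_distr m_comm simp flip: M.smult_assoc1)
    from map_phi_op[OF this v] have "c \<odot>\<^bsub>M\<^esub> phi_op v = lin_ext K M (\<lambda>\<mu>. c \<odot>\<^bsub>M\<^esub> shift \<mu> v) \<phi>" .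
    also have "\<dots> = phi_op (c \<odot>\<^bsub>M\<^esub> v)"
      unfolding phi_op_def using c v variables_subset
      by (intro lin_ext_phi_cong[OF _ M.vectorspace_axioms]) auto
    finally show ?thesis by simp
  qed
qed

lemmas phi_op_simps [simp] = linear_map_closed[OF phi_op_linear] linear_map_add[OF phi_op_linear]
  linear_map_smult[OF phi_op_linear]

text \<open>
  \<open>phi_op\<close> is a combination of shifts, hence commutes with every operator that commutes with shifts.
\<close>

lemma phi_op_commute:
  assumes T: "linear_map K M M T" and v: "v \<in> carrier M"
    and comm: "\<And>\<mu> v. set_mset \<mu> \<subseteq> {0..n} \<Longrightarrow> v \<in> carrier M \<Longrightarrow> T (shift \<mu> v) = shift \<mu> (T v)"
  shows "T (phi_op v) = phi_op (T v)"
  unfolding map_phi_op[OF T v] phi_op_def[of "T v"]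
  by (rule lin_ext_phi_cong[OF _ M.vectorspace_axioms])
     (use v comm variables_subset linear_map_closed[OF T] in auto)

lemma phi_op_up: "v \<in> carrier M \<Longrightarrow> up (phi_op v) = phi_op (up v)"
  by (rule phi_op_commute[OF up_linear]) (auto simp: shift_up)

lemma phi_op_shift: "set_mset \<mu> \<subseteq> {0..n} \<Longrightarrow> v \<in> carrier M \<Longrightarrow> shift \<mu> (phi_op v) = phi_op (shift \<mu> v)"
  by (rule phi_op_commute[OF shift_linear]) (auto simp: shift_commute)

lemma down_at_closed:
  assumes "\<And>j. D j \<in> carrier M"
  shows "down_at D i j \<in> carrier M"
  by (induction i rule: induct_nat_012) (use assms in auto)

lemma down_from_linear: "(\<And>j. D j \<in> carrier M) \<Longrightarrow> linear_map K M M (down_from D)"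
  unfolding down_from_def
  by (rule M.lin_ext_linear[OF M.vectorspace_axioms]) (auto simp: mem_normal_indices down_at_closed)

lemma down_from_e:
  "(\<And>j. D j \<in> carrier M) \<Longrightarrow> set_mset \<nu> \<subseteq> {0..n} \<Longrightarrow> down_from D (e i j \<nu>) = shift \<nu> (down_at D i j)"
  unfolding down_from_def e_def
  by (subst M.lin_ext_delta[OF M.vectorspace_axioms]) (auto simp: mem_normal_indices down_at_closed)

lemma down_approx_closed: "down_approx J j \<in> carrier M"
proof (induction J arbitrary: j)
  case (Suc J)
  note closed = linear_map_closed[OF down_from_linear[OF Suc]]
  show ?case using Suc closed by (simp add: down_step_def)
qed simp

lemma down_base_closed [simp]: "down_base j \<in> carrier M"
  by (simp add: down_base_def down_approx_closed)

lemma down_linear: "linear_map K M M down"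
  unfolding down_def by (rule down_from_linear) simp

lemmas down_simps [simp] = linear_map_closed[OF down_linear] linear_map_add[OF down_linear]
  linear_map_smult[OF down_linear]

lemma down_e: "set_mset \<nu> \<subseteq> {0..n} \<Longrightarrow> down (e i j \<nu>) = shift \<nu> (down_at down_base i j)"
  unfolding down_def by (rule down_from_e) auto

lemma down_approx_eq: "j \<le> J \<Longrightarrow> down_approx J j = down_base j"
  by (induction J) (auto simp: down_base_def le_Suc_eq)

text \<open>
  A positive number with \<open>deg \<phi> \<le> 2 phi_bound\<close>. With it as the weight of \<open>u\<close>, and twice it as the weight of
  \<open>du\<close>, no generator raises the weight of a vector by more than \<open>phi_bound\<close>.
\<close>

definition phi_bound :: nat where
  "phi_bound = Suc (\<Sum>\<mu>\<in>{\<mu>. \<phi> \<mu> \<noteq> \<zero>\<^bsub>K\<^esub>}. size \<mu>)"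

definition weight :: "nat \<times> nat \<times> nat multiset \<Rightarrow> nat" where
  "weight = (\<lambda>(i, j, \<nu>). phi_bound * (i + 2 * j) + size \<nu>)"

lemma phi_bound_pos: "phi_bound \<ge> 1"
  by (simp add: phi_bound_def)

lemma size_le_phi_bound:
  assumes "\<phi> \<mu> \<noteq> \<zero>\<^bsub>K\<^esub>"
  shows "size \<mu> \<le> 2 * phi_bound"
proof -
  have "finite {\<mu>. \<phi> \<mu> \<noteq> \<zero>\<^bsub>K\<^esub>}" using P.finite_support[OF parameters(3)] .
  then have "size \<mu> \<le> (\<Sum>\<mu>\<in>{\<mu>. \<phi> \<mu> \<noteq> \<zero>\<^bsub>K\<^esub>}. size \<mu>)" using assms by (intro member_le_sum) auto
  then show ?thesis by (simp add: phi_bound_def)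
qed

text \<open>
  The bound \<open>J\<close> on powers of \<open>x\<close> makes the recursion for \<open>down\<close> well-founded; the bound \<open>s\<close> on weights controls
  the growth of the algebra.
\<close>

definition bounded :: "nat \<Rightarrow> nat \<Rightarrow> 'k normal_form set" where
  "bounded J s = {v \<in> carrier M. \<forall>x. v x \<noteq> \<zero>\<^bsub>K\<^esub> \<longrightarrow> fst (snd x) \<le> J \<and> weight x \<le> s}"

lemma bounded_submodule: "submodule K (bounded J s) M"
proof (rule submodule.intro)
  show "v \<oplus>\<^bsub>M\<^esub> w \<in> bounded J s" if v: "v \<in> bounded J s" "w \<in> bounded J s" for v w
  proof -
    have "v x \<noteq> \<zero>\<^bsub>K\<^esub> \<or> w x \<noteq> \<zero>\<^bsub>K\<^esub>" if "(v \<oplus>\<^bsub>M\<^esub> w) x \<noteq> \<zero>\<^bsub>K\<^esub>" for x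
      using that by (auto simp: M.add_N)
    moreover have "v \<oplus>\<^bsub>M\<^esub> w \<in> carrier M" using v by (auto simp: bounded_def)
    ultimately show ?thesis using v unfolding bounded_def by blast
  qed
  show "c \<odot>\<^bsub>M\<^esub> v \<in> bounded J s" if c: "c \<in> carrier K" and v: "v \<in> bounded J s" for c v
  proof -
    have "v x \<noteq> \<zero>\<^bsub>K\<^esub>" if "(c \<odot>\<^bsub>M\<^esub> v) x \<noteq> \<zero>\<^bsub>K\<^esub>" for x
      using that c by (auto simp: M.smult_N)
    moreover have "c \<odot>\<^bsub>M\<^esub> v \<in> carrier M" using v c by (auto simp: bounded_def)
    ultimately show ?thesis using v unfolding bounded_def by blast
  qed
qed (auto simp: bounded_def M.zero_N M.module_axioms intro: M.zero_closed[unfolded M.zero_N])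

lemmas bounded_intros = submodule.m_closed[OF bounded_submodule] submodule.smult_closed[OF bounded_submodule]
  parameters(1,2)

lemma bounded_mono: "v \<in> bounded J s \<Longrightarrow> J \<le> J' \<Longrightarrow> s \<le> s' \<Longrightarrow> v \<in> bounded J' s'"
  unfolding bounded_def by (blast intro: le_trans)

lemma bounded_carrier: "v \<in> bounded J s \<Longrightarrow> v \<in> carrier M"
  by (simp add: bounded_def)

lemma bounded_all:
  assumes "v \<in> carrier M"
  obtains J s where "v \<in> bounded J s"
proof -
  let ?S = "{x. v x \<noteq> \<zero>\<^bsub>K\<^esub>}"
  have fin: "finite ?S" using M.finite_support[OF assms] .
  have "fst (snd x) \<le> (\<Sum>x\<in>?S. fst (snd x))" "weight x \<le> (\<Sum>x\<in>?S. weight x)" if "v x \<noteq> \<zero>\<^bsub>K\<^esub>" for x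
    using that fin by (auto intro!: member_le_sum)
  then have "v \<in> bounded (\<Sum>x\<in>?S. fst (snd x)) (\<Sum>x\<in>?S. weight x)"
    using assms unfolding bounded_def by force
  then show ?thesis by (rule that)
qed

lemma e_bounded: "set_mset \<nu> \<subseteq> {0..n} \<Longrightarrow> j \<le> J \<Longrightarrow> weight (i, j, \<nu>) \<le> s \<Longrightarrow> e i j \<nu> \<in> bounded J s"
  using e_closed[of \<nu> i j] by (auto simp: bounded_def e_def delta_def split: if_splits)

lemma map_bounded:
  assumes "linear_map K M M T" and v: "v \<in> bounded J s"
    and "\<And>i j \<nu>. set_mset \<nu> \<subseteq> {0..n} \<Longrightarrow> j \<le> J \<Longrightarrow> weight (i, j, \<nu>) \<le> s \<Longrightarrow> T (e i j \<nu>) \<in> bounded J' s'"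
  shows "T v \<in> bounded J' s'"
  by (rule M.linear_map_image_in_submodule[OF assms(1) bounded_submodule bounded_carrier[OF v]])
     (use v assms(3) in \<open>auto simp: bounded_def[of J s] mem_normal_indices e_def\<close>)

lemma up_bounded: "v \<in> bounded J s \<Longrightarrow> up v \<in> bounded J (s + phi_bound)"
  by (erule map_bounded[OF up_linear]) (auto intro!: e_bounded simp: weight_def algebra_simps)

lemma shift_bounded:
  assumes \<mu>: "set_mset \<mu> \<subseteq> {0..n}" and v: "v \<in> bounded J s"
  shows "shift \<mu> v \<in> bounded J (s + size \<mu>)"
  by (rule map_bounded[OF shift_linear[OF \<mu>] v]) (use \<mu> in \<open>simp_all add: shift_e e_bounded weight_def\<close>)

lemma phi_op_bounded:
  assumes "v \<in> bounded J s"
  shows "phi_op v \<in> bounded J (s + 2 * phi_bound)"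
proof -
  have "linear_map K (polynomials K n) M (\<lambda>p. lin_ext K M (\<lambda>\<mu>. shift \<mu> v) p)"
    by (rule P.lin_ext_linear[OF M.vectorspace_axioms])
       (use bounded_carrier[OF assms] variables_subset in auto)
  then show ?thesis
    unfolding phi_op_def
  proof (rule P.linear_map_image_in_submodule[OF _ bounded_submodule parameters(3)])
    fix \<mu> assume \<mu>: "\<mu> \<in> {\<mu>. set_mset \<mu> \<subseteq> {1..n}}" "\<phi> \<mu> \<noteq> \<zero>\<^bsub>K\<^esub>"
    then have "lin_ext K M (\<lambda>\<mu>. shift \<mu> v) (delta K \<mu>) = shift \<mu> v"
      by (intro P.lin_ext_delta[OF M.vectorspace_axioms]) (use bounded_carrier[OF assms] variables_subset in auto)
    moreover have "shift \<mu> v \<in> bounded J (s + size \<mu>)"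
      using \<mu> assms variables_subset by (intro shift_bounded) auto
    ultimately show "lin_ext K M (\<lambda>\<mu>. shift \<mu> v) (delta K \<mu>) \<in> bounded J (s + 2 * phi_bound)"
      using size_le_phi_bound[OF \<mu>(2)] by (auto intro: bounded_mono)
  qed
qed

lemma down_at_bounded:
  assumes "down_base j \<in> bounded j (2 * phi_bound * j + phi_bound)"
  shows "down_at down_base i j \<in> bounded (Suc j) (phi_bound * (i + 2 * j) + phi_bound)"
proof (induction i rule: induct_nat_012)
  case 0
  show ?case using assms by (auto elim!: bounded_mono simp: algebra_simps)
next
  case 1
  show ?case by (auto intro!: e_bounded simp: weight_def algebra_simps)
next
  case (ge2 i)
  have "up (down_at down_base (Suc i) j) \<in> bounded (Suc j) (phi_bound * (Suc (Suc i) + 2 * j) + phi_bound)"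
    using up_bounded[OF ge2(2)] by (rule bounded_mono) (auto simp: algebra_simps)
  moreover have "up (up (down_at down_base i j)) \<in> bounded (Suc j) (phi_bound * (Suc (Suc i) + 2 * j) + phi_bound)"
    using up_bounded[OF up_bounded[OF ge2(1)]] by (rule bounded_mono) (auto simp: algebra_simps)
  moreover have "phi_op (e (Suc i) j {#}) \<in> bounded (Suc j) (phi_bound * (Suc (Suc i) + 2 * j) + phi_bound)"
    by (rule bounded_mono[OF phi_op_bounded[OF e_bounded[of _ j j "Suc i" "phi_bound * (Suc i + 2 * j)"]]])
       (auto simp: weight_def algebra_simps)
  ultimately show ?case by (auto intro: bounded_intros)
qed

lemma down_bounded_aux:
  assumes "v \<in> bounded J s" and base: "\<And>j. j \<le> J \<Longrightarrow> down_base j \<in> bounded j (2 * phi_bound * j + phi_bound)"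
  shows "down v \<in> bounded (Suc J) (s + phi_bound)"
proof (rule map_bounded[OF down_linear assms(1)])
  fix i j \<nu> assume \<nu>: "set_mset \<nu> \<subseteq> {0..n}" and j: "j \<le> J" and w: "weight (i, j, \<nu>) \<le> s"
  have "shift \<nu> (down_at down_base i j) \<in> bounded (Suc j) (phi_bound * (i + 2 * j) + phi_bound + size \<nu>)"
    by (rule shift_bounded[OF \<nu> down_at_bounded[OF base[OF j]]])
  then show "down (e i j \<nu>) \<in> bounded (Suc J) (s + phi_bound)"
    using j w by (auto simp: down_e[OF \<nu>] weight_def elim!: bounded_mono)
qed

lemma down_at_cong: "D j = D' j \<Longrightarrow> down_at D i j = down_at D' i j"
  by (simp add: down_at_def)

lemma linear_map_eq_on_bounded:
  assumes T: "linear_map K M W T" and T': "linear_map K M W T'" and v: "v \<in> bounded J s"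
    and eq: "\<And>i j \<nu>. j \<le> J \<Longrightarrow> set_mset \<nu> \<subseteq> {0..n} \<Longrightarrow> T (e i j \<nu>) = T' (e i j \<nu>)"
  shows "T v = T' v"
proof (rule M.linear_map_eqI[OF T T' bounded_carrier[OF v]])
  fix x assume x: "x \<in> normal_indices n" "v x \<noteq> \<zero>\<^bsub>K\<^esub>"
  obtain i j \<nu> where ij: "x = (i, j, \<nu>)" by (cases x)
  have "j \<le> J" "set_mset \<nu> \<subseteq> {0..n}" using x v by (auto simp: ij bounded_def mem_normal_indices)
  then show "T (delta K x) = T' (delta K x)" using eq by (simp add: ij e_def)
qed

text \<open>
  The value of \<open>down_from D\<close> at \<open>e i j \<nu>\<close> depends only on \<open>D j\<close>, and \<open>down_approx J\<close> has its final values for \<open>j \<le> J\<close>.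
\<close>

lemma down_from_approx:
  assumes "v \<in> bounded J s"
  shows "down_from (down_approx J) v = down v"
proof (rule linear_map_eq_on_bounded[OF down_from_linear down_linear assms])
  fix i j \<nu> assume "j \<le> J" "set_mset \<nu> \<subseteq> {0..n}"
  then show "down_from (down_approx J) (e i j \<nu>) = down (e i j \<nu>)"
    using down_at_cong[of "down_approx J" j down_base i]
    by (simp add: down_e down_from_e down_approx_closed down_approx_eq)
qed (rule down_approx_closed)

text \<open>
  The recursion for \<open>d x\<^sup>j\<close> holds with the final operator \<open>down\<close>. It must be proved together with the bound on
  \<open>d x\<^sup>j\<close>: the recursion at \<open>j + 1\<close> requires the bound at \<open>j\<close>, and the bound is obtained from the recursion.
\<close>

lemma down_base_bounded: "down_base j \<in> bounded j (2 * phi_bound * j + phi_bound)"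
  and down_base_Suc: "down_base (Suc j) = \<alpha> \<odot>\<^bsub>M\<^esub> down (up (down_base j)) \<oplus>\<^bsub>M\<^esub> \<beta> \<odot>\<^bsub>M\<^esub> up (down (down_base j))
      \<oplus>\<^bsub>M\<^esub> phi_op (down_base j)"
proof -
  have Suc_eq: "down_base (Suc j) = \<alpha> \<odot>\<^bsub>M\<^esub> down (up (down_base j)) \<oplus>\<^bsub>M\<^esub> \<beta> \<odot>\<^bsub>M\<^esub> up (down (down_base j))
      \<oplus>\<^bsub>M\<^esub> phi_op (down_base j)"
    if "down_base j \<in> bounded j (2 * phi_bound * j + phi_bound)" for j
    using down_from_approx[OF that] down_from_approx[OF up_bounded[OF that]]
    by (simp add: down_base_def down_step_def)
  have bounded: "down_base j \<in> bounded j (2 * phi_bound * j + phi_bound)" for j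
  proof (induction j rule: less_induct)
    case (less j)
    show ?case
    proof (cases j)
      case 0
      then show ?thesis using phi_bound_pos by (auto simp: down_base_def weight_def intro!: e_bounded)
    next
      case (Suc k)
      let ?B = "bounded (Suc k) (2 * phi_bound * Suc k + phi_bound)"
      have k: "down_base k \<in> bounded k (2 * phi_bound * k + phi_bound)" using less Suc by simp
      have base: "\<And>j. j \<le> k \<Longrightarrow> down_base j \<in> bounded j (2 * phi_bound * j + phi_bound)"
        using less Suc by simp
      have "down (up (down_base k)) \<in> ?B"
        by (rule bounded_mono[OF down_bounded_aux[OF up_bounded[OF k] base]]) (auto simp: algebra_simps)
      moreover have "up (down (down_base k)) \<in> ?B"
        by (rule bounded_mono[OF up_bounded[OF down_bounded_aux[OF k base]]]) (auto simp: algebra_simps)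
      moreover have "phi_op (down_base k) \<in> ?B"
        by (rule bounded_mono[OF phi_op_bounded[OF k]]) (auto simp: algebra_simps)
      ultimately show ?thesis unfolding Suc Suc_eq[OF k] by (intro bounded_intros)
    qed
  qed
  show "down_base j \<in> bounded j (2 * phi_bound * j + phi_bound)" by (rule bounded)
  show "down_base (Suc j) = \<alpha> \<odot>\<^bsub>M\<^esub> down (up (down_base j)) \<oplus>\<^bsub>M\<^esub> \<beta> \<odot>\<^bsub>M\<^esub> up (down (down_base j))
      \<oplus>\<^bsub>M\<^esub> phi_op (down_base j)" by (rule Suc_eq[OF bounded])
qed

lemma down_bounded: "v \<in> bounded J s \<Longrightarrow> down v \<in> bounded (Suc J) (s + phi_bound)"
  by (rule down_bounded_aux) (auto intro: down_base_bounded)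

lemma down_shift:
  assumes "set_mset \<mu> \<subseteq> {0..n}" "v \<in> carrier M"
  shows "down (shift \<mu> v) = shift \<mu> (down v)"
  by (rule linear_map_eqI[OF linear_map_comp[OF shift_linear down_linear] linear_map_comp[OF down_linear shift_linear]])
     (use assms in \<open>auto simp: shift_e down_e shift_add[symmetric] down_at_closed add.commute\<close>)

lemma phi_op_down: "v \<in> carrier M \<Longrightarrow> down (phi_op v) = phi_op (down v)"
  by (rule phi_op_commute[OF down_linear]) (auto simp: down_shift)

lemma linear_map_sum:
  assumes "linear_map K M M T" "linear_map K M M T'"
  shows "linear_map K M M (\<lambda>v. T v \<oplus>\<^bsub>M\<^esub> T' v)"
  by (rule M.linear_mapI[OF M.vectorspace_axioms])
     (auto simp: linear_map_closed[OF assms(1)] linear_map_closed[OF assms(2)] linear_map_add[OF assms(1)]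
       linear_map_add[OF assms(2)] linear_map_smult[OF assms(1)] linear_map_smult[OF assms(2)]
       M.smult_r_distr M.M.add.m_ac)

lemma linear_map_scale:
  assumes "linear_map K M M T" "c \<in> carrier K"
  shows "linear_map K M M (\<lambda>v. c \<odot>\<^bsub>M\<^esub> T v)"
  by (rule M.linear_mapI[OF M.vectorspace_axioms])
     (auto simp: linear_map_closed[OF assms(1)] linear_map_add[OF assms(1)] linear_map_smult[OF assms(1)]
       assms(2) M.smult_r_distr m_comm simp flip: M.smult_assoc1)

lemmas linear_map_intros = linear_map_sum linear_map_scale linear_map_comp[OF up_linear] linear_map_comp[OF down_linear]
  linear_map_comp[OF phi_op_linear] up_linear down_linear phi_op_linear parameters(1,2)

text \<open>
  The relation for \<open>du\<^sup>2\<close>: on basis vectors it is the recursion that defines \<open>down_at\<close>.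
\<close>

lemma down_up_up:
  assumes "v \<in> carrier M"
  shows "down (up (up v)) = \<alpha> \<odot>\<^bsub>M\<^esub> up (down (up v)) \<oplus>\<^bsub>M\<^esub> \<beta> \<odot>\<^bsub>M\<^esub> up (up (down v)) \<oplus>\<^bsub>M\<^esub> up (phi_op v)"
proof (rule linear_map_eqI[OF _ _ assms, where W = M])
  fix i j \<nu> assume \<nu>: "set_mset \<nu> \<subseteq> {0..n}"
  show "down (up (up (e i j \<nu>))) = \<alpha> \<odot>\<^bsub>M\<^esub> up (down (up (e i j \<nu>))) \<oplus>\<^bsub>M\<^esub>
      \<beta> \<odot>\<^bsub>M\<^esub> up (up (down (e i j \<nu>))) \<oplus>\<^bsub>M\<^esub> up (phi_op (e i j \<nu>))"
    using \<nu> by (simp add: down_e down_at_closed shift_up phi_op_shift phi_op_up shift_e)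
qed (intro linear_map_intros)+

text \<open>
  The relation for \<open>d\<^sup>2u\<close>. On basis vectors with \<open>i = 0\<close> it is the recursion for \<open>down_base\<close>. If it holds at \<open>w\<close>, it
  holds at \<open>u w\<close>: expand \<open>d (du\<^sup>2) w\<close> with the relation for \<open>du\<^sup>2\<close>; the term \<open>(du\<^sup>2) d w\<close> that arises equals
  \<open>u (d\<^sup>2u) w\<close>, since both expand to the same expression.
\<close>

lemma down_down_up:
  assumes "v \<in> carrier M"
  shows "down (down (up v)) = \<alpha> \<odot>\<^bsub>M\<^esub> down (up (down v)) \<oplus>\<^bsub>M\<^esub> \<beta> \<odot>\<^bsub>M\<^esub> up (down (down v)) \<oplus>\<^bsub>M\<^esub> phi_op (down v)"
proof (rule linear_map_eqI[OF _ _ assms, where W = M])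
  fix i j \<nu> assume \<nu>: "set_mset \<nu> \<subseteq> {0..n}"
  show "down (down (up (e i j \<nu>))) = \<alpha> \<odot>\<^bsub>M\<^esub> down (up (down (e i j \<nu>))) \<oplus>\<^bsub>M\<^esub>
      \<beta> \<odot>\<^bsub>M\<^esub> up (down (down (e i j \<nu>))) \<oplus>\<^bsub>M\<^esub> phi_op (down (e i j \<nu>))"
  proof (induction i)
    case 0
    show ?case using \<nu>
      by (simp add: down_e down_base_Suc shift_up phi_op_shift down_shift[symmetric] shift_e)
  next
    case (Suc i)
    define w where "w = e i j \<nu>"
    have w: "w \<in> carrier M" and Suc_w: "e (Suc i) j \<nu> = up w" using \<nu> by (simp_all add: w_def)
    note IH = Suc[folded w_def]
    have swap: "down (up (up (down w))) = up (down (down (up w)))"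
      unfolding IH using w by (simp add: down_up_up phi_op_up)
    have "down (down (up (up w))) = \<alpha> \<odot>\<^bsub>M\<^esub> down (up (down (up w))) \<oplus>\<^bsub>M\<^esub> \<beta> \<odot>\<^bsub>M\<^esub> down (up (up (down w))) \<oplus>\<^bsub>M\<^esub> down (up (phi_op w))"
      using w by (simp add: down_up_up)
    also have "\<dots> = \<alpha> \<odot>\<^bsub>M\<^esub> down (up (down (up w))) \<oplus>\<^bsub>M\<^esub> \<beta> \<odot>\<^bsub>M\<^esub> up (down (down (up w))) \<oplus>\<^bsub>M\<^esub> phi_op (down (up w))"
      unfolding swap using w by (simp add: phi_op_up phi_op_down)
    finally show ?case unfolding Suc_w .
  qed
qed (intro linear_map_intros)+

end

section \<open>The normal monomials form a basis\<close>

text \<open>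
  The dimension may be infinite, so there is no counting: the coefficients of a vanishing linear combination
  of images are assembled into one element of the kernel.
\<close>

lemma (in finsupp_space) basis_of_bijection:
  assumes T: "linear_map K N W T" and bij: "bij_betw T (carrier N) (carrier W)"
  shows "inj_on (\<lambda>s. T (delta K s)) S"
    and "vectorspace.basis K W ((\<lambda>s. T (delta K s)) ` S)"
proof -
  have W: "vectorspace K W" by (rule linear_map.axioms(2)[OF T])
  interpret W: vectorspace K W by (fact W)
  note [simp] = linear_map_closed[OF T]
  let ?g = "\<lambda>s. T (delta K s)"
  have g: "?g \<in> S \<rightarrow> carrier W" by auto
  have inj_T: "inj_on T (carrier N)" using bij by (rule bij_betw_imp_inj_on)
  show inj: "inj_on ?g S"
  proof (rule inj_onI)
    fix s s' assume s: "s \<in> S" "s' \<in> S" "T (delta K s) = T (delta K s')"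
    then have "delta K s = delta K s'" by (intro inj_onD[OF inj_T]) auto
    then have "delta K s s = delta K s' s" by simp
    then show "s = s'" by (auto simp: delta_def split: if_splits)
  qed
  have T_eq: "T f = lin_ext K W ?g f" if "f \<in> carrier N" for f
    by (rule linear_map_eqI[OF T lin_ext_linear[OF W g] that])
       (simp add: lin_ext_delta[OF W g])
  have "W.lin_indpt (?g ` S)"
  proof
    assume "W.lin_dep (?g ` S)"
    then obtain B a v where B: "finite B" "B \<subseteq> ?g ` S" "a \<in> B \<rightarrow> carrier K"
      and zero: "W.lincomb a B = \<zero>\<^bsub>W\<^esub>" and v: "v \<in> B" "a v \<noteq> \<zero>\<^bsub>K\<^esub>"
      unfolding W.lin_dep_def by blast
    obtain F where F: "F \<subseteq> S" "finite F" "B = ?g ` F"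
      using finite_subset_image[OF B(1,2)] by auto
    have inj_F: "inj_on ?g F" using inj F(1) by (rule inj_on_subset)
    have F_closed: "a (?g s) \<odot>\<^bsub>W\<^esub> ?g s \<in> carrier W" if "s \<in> F" for s
      using that F B(3) by (intro W.smult_closed) auto
    define f where "f = (\<lambda>s. if s \<in> F then a (?g s) else \<zero>\<^bsub>K\<^esub>)"
    have f: "f \<in> carrier N"
    proof -
      have "finite {s. f s \<noteq> \<zero>\<^bsub>K\<^esub>}" by (rule finite_subset[OF _ F(2)]) (auto simp: f_def)
      then show ?thesis using F B(3) unfolding carrier_N f_def by auto
    qed
    have "T f = (\<Oplus>\<^bsub>W\<^esub>s\<in>F. f s \<odot>\<^bsub>W\<^esub> ?g s)"
      unfolding T_eq[OF f]
      by (rule lin_ext_superset[OF W g f F(2) _ F(1)]) (auto simp: f_def)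
    also have "\<dots> = (\<Oplus>\<^bsub>W\<^esub>s\<in>F. a (?g s) \<odot>\<^bsub>W\<^esub> ?g s)"
      using F_closed by (intro W.finsum_cong') (simp_all add: f_def)
    also have "\<dots> = (\<Oplus>\<^bsub>W\<^esub>v\<in>?g ` F. a v \<odot>\<^bsub>W\<^esub> v)"
      by (rule W.add.finprod_reindex[OF _ inj_F, symmetric]) (use F_closed in blast)
    also have "\<dots> = W.lincomb a B" unfolding W.lincomb_def F(3) ..
    finally have "T f = T \<zero>\<^bsub>N\<^esub>" unfolding zero linear_map.T0_is_0[OF T] .
    then have "f = \<zero>\<^bsub>N\<^esub>" by (rule inj_onD[OF inj_T _ f M.zero_closed])
    moreover obtain s where s: "s \<in> F" "v = ?g s" using v(1) F(3) by blast
    ultimately have "f s = \<zero>\<^bsub>K\<^esub>" by (simp add: zero_N)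
    with s v(2) show False by (simp add: f_def)
  qed
  moreover have "W.span (?g ` S) = carrier W"
  proof
    have sub: "?g ` S \<subseteq> carrier W" using g by blast
    show "W.span (?g ` S) \<subseteq> carrier W" by (rule W.span_is_subset2[OF sub])
    show "carrier W \<subseteq> W.span (?g ` S)"
    proof
      fix x assume "x \<in> carrier W"
      then obtain f where f: "f \<in> carrier N" "x = T f" using bij_betw_imp_surj_on[OF bij] by blast
      show "x \<in> W.span (?g ` S)"
        unfolding f(2)
        by (rule linear_map_image_in_submodule[OF T W.span_is_submodule[OF sub] f(1)])
           (use W.in_own_span[OF sub] in blast)
    qed
  qed
  moreover have "?g ` S \<subseteq> carrier W" using g by blast
  ultimately show "W.basis (?g ` S)" unfolding W.basis_def by blast
qed

text \<open>
  The records of the free algebra and of its quotient depend on this set, so it is kept opaque.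
\<close>

definition du_generators :: "nat \<Rightarrow> gen set" where
  "du_generators n = {Gu, Gd} \<union> Gt ` {1..n}"

lemma mem_du_generators [simp]:
  "Gu \<in> du_generators n" "Gd \<in> du_generators n" "Gt l \<in> du_generators n \<longleftrightarrow> l \<in> {1..n}"
  by (auto simp: du_generators_def)

context du_model
begin

sublocale G: free_alg K "du_generators n" ..

primrec gen_op :: "gen \<Rightarrow> 'k normal_form \<Rightarrow> 'k normal_form" where
  "gen_op Gu = up"
| "gen_op Gd = down"
| "gen_op (Gt l) = shift {#l#}"

abbreviation rep where "rep \<equiv> G.word_rep M gen_op"

lemma gen_op_linear: "x \<in> du_generators n \<Longrightarrow> linear_map K M M (gen_op x)"
  using up_linear down_linear shift_linear by (auto simp: du_generators_def)

lemmas rep_linear = G.word_rep_linear[where op = gen_op, OF M.vectorspace_axioms gen_op_linear]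
lemmas rep_delta = G.word_rep_delta[where op = gen_op, OF M.vectorspace_axioms gen_op_linear]
lemmas rep_mult = G.word_rep_mult[where op = gen_op, OF M.vectorspace_axioms gen_op_linear]
lemmas rep_annihilator = G.annihilator_ideal[where op = gen_op, OF M.vectorspace_axioms gen_op_linear]

lemma free_gen_closed [simp, intro]: "x \<in> du_generators n \<Longrightarrow> free_gen K x \<in> carrier G.F"
  by (auto simp: free_gen_delta)

lemma rep_closed [simp]: "f \<in> carrier G.F \<Longrightarrow> v \<in> carrier M \<Longrightarrow> rep f v \<in> carrier M"
  using linear_map_closed[OF rep_linear] .

lemma rep_gen: "x \<in> du_generators n \<Longrightarrow> v \<in> carrier M \<Longrightarrow> rep (free_gen K x) v = gen_op x v"
  by (simp add: free_gen_delta rep_delta)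

lemma rep_one: "v \<in> carrier M \<Longrightarrow> rep \<one>\<^bsub>G.F\<^esub> v = v"
  by (simp add: free_algebra_one rep_delta)

abbreviation free_t where "free_t \<equiv> \<lambda>i. free_gen K (Gt i)"

lemma rep_t_pow:
  fixes k :: nat
  assumes "i \<in> {1..n}" "v \<in> carrier M"
  shows "rep (free_t i [^]\<^bsub>G.F\<^esub> k) v = shift (replicate_mset k i) v"
  using assms(2)
proof (induction k arbitrary: v)
  case (Suc k)
  have t: "free_t i \<in> carrier G.F" using assms(1) by auto
  have "rep (free_t i [^]\<^bsub>G.F\<^esub> Suc k) v = rep (free_t i [^]\<^bsub>G.F\<^esub> k) (shift {#i#} v)"
    using t assms Suc.prems by (simp add: rep_mult rep_gen)
  also have "\<dots> = shift (replicate_mset k i) (shift {#i#} v)"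
    using assms Suc.prems by (intro Suc.IH) auto
  also have "\<dots> = shift (replicate_mset k i + {#i#}) v"
    using assms Suc.prems by (intro shift_add[symmetric]) (auto dest: in_replicate_mset[THEN iffD1])
  finally show ?case by simp
qed (simp add: rep_one)

text \<open>
  In the free algebra the \<open>t\<^sub>i\<close> do not commute, so the product is followed along the list of factors.
\<close>

lemma rep_t_monomial:
  assumes "set_mset \<mu> \<subseteq> {1..n}" "v \<in> carrier M"
  shows "ordered_monomial G.F n free_t (count \<mu>) \<in> carrier G.F"
    and "rep (ordered_monomial G.F n free_t (count \<mu>)) v = shift \<mu> v"
proof -
  let ?f = "\<lambda>xs. foldr (\<lambda>i y. (free_t i [^]\<^bsub>G.F\<^esub> count \<mu> i) \<otimes>\<^bsub>G.F\<^esub> y) xs \<one>\<^bsub>G.F\<^esub>"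
  let ?m = "\<lambda>xs. \<Sum>i\<leftarrow>xs. replicate_mset (count \<mu> i) i"
  have t: "free_t i \<in> carrier G.F" if "i \<in> {1..n}" for i using that by auto
  have closed: "?f xs \<in> carrier G.F" if "set xs \<subseteq> {1..n}" for xs
    using that t by (induction xs) auto
  have sub: "set_mset (?m xs) \<subseteq> set xs" for xs
    by (induction xs) (auto dest: in_replicate_mset[THEN iffD1])
  have sub0: "set_mset (replicate_mset k i) \<subseteq> {0..n}" if "i \<in> {1..n}" for k i
    using that by (auto dest: in_replicate_mset[THEN iffD1])
  have rep: "rep (?f xs) v = shift (?m xs) v" if "set xs \<subseteq> {1..n}" for xs
    using that
  proof (induction xs)
    case (Cons i xs)
    have sub1: "set_mset (?m xs) \<subseteq> {0..n}" using sub[of xs] Cons.prems by auto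
    with Cons show ?case
      using t closed[of xs] sub0[of i] assms(2) by (simp add: rep_mult rep_t_pow shift_add)
  qed (simp add: rep_one assms)
  have m: "?m [1..<Suc n] = \<mu>"
  proof (rule multiset_eqI)
    fix x
    have "count (?m xs) x = (if x \<in> set xs then count \<mu> x else 0)" if "distinct xs" for xs
      using that by (induction xs) auto
    from this[of "[1..<Suc n]"] show "count (?m [1..<Suc n]) x = count \<mu> x"
      using assms(1) by (auto simp: count_eq_zero_iff simp del: upt_Suc)
  qed
  show "ordered_monomial G.F n free_t (count \<mu>) \<in> carrier G.F"
    unfolding ordered_monomial_def by (rule closed) auto
  show "rep (ordered_monomial G.F n free_t (count \<mu>)) v = shift \<mu> v"
    unfolding ordered_monomial_def using rep[of "[1..<Suc n]"] m by (simp del: upt_Suc add: atLeastLessThanSuc_atLeastAtMost)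
qed

abbreviation free_phi where "free_phi \<equiv> poly_eval K G.F n free_t \<phi>"

lemma free_t_monomial_closed:
  "(\<lambda>\<mu>. ordered_monomial G.F n free_t (count \<mu>)) \<in> {\<mu>. set_mset \<mu> \<subseteq> {1..n}} \<rightarrow> carrier G.F"
  using rep_t_monomial(1)[OF _ M.M.zero_closed] by auto

lemma phi_support: "\<phi> \<in> {\<mu>. set_mset \<mu> \<subseteq> {1..n}} \<rightarrow> carrier K"
  "{\<mu>. \<phi> \<mu> \<noteq> \<zero>\<^bsub>K\<^esub>} \<subseteq> {\<mu>. set_mset \<mu> \<subseteq> {1..n}}"
  using P.coeff_closed[OF parameters(3)] P.support_subset[OF parameters(3)] by auto

lemma free_phi_closed [simp, intro]: "free_phi \<in> carrier G.F"
  unfolding poly_eval_lin_ext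
  by (rule linear_map_closed[OF P.lin_ext_linear[OF G.F.vectorspace_axioms free_t_monomial_closed] parameters(3)])

lemma rep_phi:
  assumes "v \<in> carrier M"
  shows "rep free_phi v = phi_op v"
proof -
  have "rep free_phi v = lin_ext K M (\<lambda>\<mu>. rep (ordered_monomial G.F n free_t (count \<mu>)) v) \<phi>"
    unfolding poly_eval_lin_ext
    by (rule linear_map.map_lin_ext[OF rep_linear[OF _ assms] phi_support(1) free_t_monomial_closed phi_support(2)])
  also have "\<dots> = phi_op v"
    unfolding phi_op_def
    by (rule lin_ext_phi_cong[OF _ M.vectorspace_axioms]) (use assms variables_subset in \<open>auto simp: rep_t_monomial\<close>)
  finally show ?thesis .
qed

lemma rep_add: "f \<in> carrier G.F \<Longrightarrow> g \<in> carrier G.F \<Longrightarrow> v \<in> carrier M \<Longrightarrow> rep (f \<oplus>\<^bsub>G.F\<^esub> g) v = rep f v \<oplus>\<^bsub>M\<^esub> rep g v"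
  and rep_smult: "c \<in> carrier K \<Longrightarrow> f \<in> carrier G.F \<Longrightarrow> v \<in> carrier M \<Longrightarrow> rep (c \<odot>\<^bsub>G.F\<^esub> f) v = c \<odot>\<^bsub>M\<^esub> rep f v"
  using linear_map_add[OF rep_linear] linear_map_smult[OF rep_linear] by auto

lemma relations_closed:
  assumes "(a, b) \<in> du_relations K n \<alpha> \<beta> \<phi>"
  shows "a \<in> carrier G.F" "b \<in> carrier G.F"
  using assms unfolding du_relations_def[folded du_generators_def] Let_def by auto

lemma relations_hold:
  assumes "(a, b) \<in> du_relations K n \<alpha> \<beta> \<phi>" and v: "v \<in> carrier M"
  shows "rep a v = rep b v"
  using assms(1) unfolding du_relations_def[folded du_generators_def] Let_def
  by (auto simp: rep_mult rep_gen rep_add rep_smult rep_phi v shift_commute shift_up down_shift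
      down_up_up down_down_up)

abbreviation I where "I \<equiv> du_ideal K n \<alpha> \<beta> \<phi>"
abbreviation A where "A \<equiv> du_algebra K n \<alpha> \<beta> \<phi>"

lemma du_ideal_ideal: "ideal I G.F"
  unfolding du_ideal_def[folded du_generators_def]
  by (rule G.F.genideal_ideal) (auto dest: relations_closed)

sublocale Q: algebra_ideal K G.F I
  by (intro algebra_ideal.intro G.free_algebra_assoc_algebra du_ideal_ideal)

lemma Q_eq: "Q.Q = A"
  unfolding du_algebra_def du_generators_def ..

text \<open>
  The relations hold for the operators on \<open>M\<close>, so the defining ideal lies in the annihilator of \<open>M\<close>.
\<close>

lemma rep_ideal:
  assumes "f \<in> I" "v \<in> carrier M"
  shows "rep f v = \<zero>\<^bsub>M\<^esub>"
proof -
  have "I \<subseteq> {f \<in> carrier G.F. \<forall>v\<in>carrier M. rep f v = \<zero>\<^bsub>M\<^esub>}"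
    unfolding du_ideal_def[folded du_generators_def]
    by (rule G.F.genideal_minimal[OF rep_annihilator])
       (auto simp: relations_closed relations_hold linear_map.T_minus[OF rep_linear])
  then show ?thesis using assms by auto
qed

abbreviation gen where "gen \<equiv> du_gen K n \<alpha> \<beta> \<phi>"

lemma gen_eq: "gen x = Q.proj (free_gen K x)"
  unfolding du_gen_def du_generators_def ..

lemmas proj_closed [simp, intro] = Q.proj_closed[unfolded Q_eq]
lemmas proj_mult = Q.proj_mult[unfolded Q_eq]
lemmas proj_add = Q.proj_add[unfolded Q_eq]
lemmas proj_smult = Q.proj_smult[unfolded Q_eq]
lemmas proj_one = Q.proj_one[unfolded Q_eq]
lemmas proj_linear = Q.proj_linear[unfolded Q_eq]
lemmas A_algebra = Q.quotient_assoc_algebra[unfolded Q_eq]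

lemma A_vectorspace: "vectorspace K A"
  by (rule assoc_algebra.axioms(1)[OF A_algebra])

lemma proj_relation:
  assumes "(a, b) \<in> du_relations K n \<alpha> \<beta> \<phi>"
  shows "Q.proj a = Q.proj b"
proof -
  have "{a \<ominus>\<^bsub>G.F\<^esub> b |a b. (a, b) \<in> du_relations K n \<alpha> \<beta> \<phi>} \<subseteq> carrier G.F"
    by (auto dest: relations_closed)
  from G.F.genideal_self[OF this] have "a \<ominus>\<^bsub>G.F\<^esub> b \<in> I"
    unfolding du_ideal_def[folded du_generators_def] using assms by blast
  then show ?thesis using relations_closed[OF assms] by (simp add: Q.proj_eq_iff)
qed

lemma proj_pow:
  fixes k :: nat
  assumes "x \<in> carrier G.F"
  shows "Q.proj (x [^]\<^bsub>G.F\<^esub> k) = Q.proj x [^]\<^bsub>A\<^esub> k"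
  by (induction k) (use assms in \<open>simp_all add: proj_one proj_mult\<close>)

lemma proj_t_monomial:
  "Q.proj (ordered_monomial G.F n free_t m) = ordered_monomial A n (\<lambda>i. gen (Gt i)) m"
proof -
  let ?f = "\<lambda>xs. foldr (\<lambda>i y. (free_t i [^]\<^bsub>G.F\<^esub> m i) \<otimes>\<^bsub>G.F\<^esub> y) xs \<one>\<^bsub>G.F\<^esub>"
  have "?f xs \<in> carrier G.F \<and>
      Q.proj (?f xs) = foldr (\<lambda>i y. (gen (Gt i) [^]\<^bsub>A\<^esub> m i) \<otimes>\<^bsub>A\<^esub> y) xs \<one>\<^bsub>A\<^esub>"
    if "set xs \<subseteq> {1..n}" for xs
    using that
  proof (induction xs)
    case (Cons i xs)
    then have "free_t i \<in> carrier G.F" by auto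
    with Cons show ?case by (simp add: proj_mult proj_pow gen_eq)
  qed (simp add: proj_one)
  from this[of "[1..<Suc n]"] show ?thesis
    by (simp add: ordered_monomial_def atLeastLessThanSuc_atLeastAtMost del: upt_Suc)
qed

lemma proj_phi: "Q.proj free_phi = poly_eval K A n (\<lambda>i. gen (Gt i)) \<phi>"
  unfolding poly_eval_lin_ext
    linear_map.map_lin_ext[OF proj_linear phi_support(1) free_t_monomial_closed phi_support(2)]
    proj_t_monomial ..

lemma relations_list:
  "i \<in> {1..n} \<Longrightarrow> j \<in> {1..n} \<Longrightarrow> (free_t i \<otimes>\<^bsub>G.F\<^esub> free_t j, free_t j \<otimes>\<^bsub>G.F\<^esub> free_t i) \<in> du_relations K n \<alpha> \<beta> \<phi>"
  "i \<in> {1..n} \<Longrightarrow> (free_t i \<otimes>\<^bsub>G.F\<^esub> free_gen K Gu, free_gen K Gu \<otimes>\<^bsub>G.F\<^esub> free_t i) \<in> du_relations K n \<alpha> \<beta> \<phi>"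
  "i \<in> {1..n} \<Longrightarrow> (free_t i \<otimes>\<^bsub>G.F\<^esub> free_gen K Gd, free_gen K Gd \<otimes>\<^bsub>G.F\<^esub> free_t i) \<in> du_relations K n \<alpha> \<beta> \<phi>"
  "(free_gen K Gd \<otimes>\<^bsub>G.F\<^esub> free_gen K Gd \<otimes>\<^bsub>G.F\<^esub> free_gen K Gu,
    \<alpha> \<odot>\<^bsub>G.F\<^esub> (free_gen K Gd \<otimes>\<^bsub>G.F\<^esub> free_gen K Gu \<otimes>\<^bsub>G.F\<^esub> free_gen K Gd) \<oplus>\<^bsub>G.F\<^esub>
    \<beta> \<odot>\<^bsub>G.F\<^esub> (free_gen K Gu \<otimes>\<^bsub>G.F\<^esub> free_gen K Gd \<otimes>\<^bsub>G.F\<^esub> free_gen K Gd) \<oplus>\<^bsub>G.F\<^esub>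
    free_phi \<otimes>\<^bsub>G.F\<^esub> free_gen K Gd) \<in> du_relations K n \<alpha> \<beta> \<phi>"
  "(free_gen K Gd \<otimes>\<^bsub>G.F\<^esub> free_gen K Gu \<otimes>\<^bsub>G.F\<^esub> free_gen K Gu,
    \<alpha> \<odot>\<^bsub>G.F\<^esub> (free_gen K Gu \<otimes>\<^bsub>G.F\<^esub> free_gen K Gd \<otimes>\<^bsub>G.F\<^esub> free_gen K Gu) \<oplus>\<^bsub>G.F\<^esub>
    \<beta> \<odot>\<^bsub>G.F\<^esub> (free_gen K Gu \<otimes>\<^bsub>G.F\<^esub> free_gen K Gu \<otimes>\<^bsub>G.F\<^esub> free_gen K Gd) \<oplus>\<^bsub>G.F\<^esub>
    free_gen K Gu \<otimes>\<^bsub>G.F\<^esub> free_phi) \<in> du_relations K n \<alpha> \<beta> \<phi>"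
  unfolding du_relations_def[folded du_generators_def] Let_def by blast+

lemma gen_closed [simp, intro]: "x \<in> du_generators n \<Longrightarrow> gen x \<in> carrier A"
  by (auto simp: gen_eq)

sublocale A: du_elements K A n \<alpha> \<beta> \<phi> "gen Gu" "gen Gd" "\<lambda>i. gen (Gt i)"
proof (intro du_elements.intro A_algebra du_elements_axioms.intro)
  fix i j assume ij: "i \<in> {1..n}" "j \<in> {1..n}"
  show "gen (Gt i) \<otimes>\<^bsub>A\<^esub> gen (Gt j) = gen (Gt j) \<otimes>\<^bsub>A\<^esub> gen (Gt i)"
    using proj_relation[OF relations_list(1)[OF ij]] ij by (simp add: gen_eq proj_mult)
next
  fix i assume i: "i \<in> {1..n}"
  show "gen (Gt i) \<otimes>\<^bsub>A\<^esub> gen Gu = gen Gu \<otimes>\<^bsub>A\<^esub> gen (Gt i)"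
    using proj_relation[OF relations_list(2)[OF i]] i by (simp add: gen_eq proj_mult)
  show "gen (Gt i) \<otimes>\<^bsub>A\<^esub> gen Gd = gen Gd \<otimes>\<^bsub>A\<^esub> gen (Gt i)"
    using proj_relation[OF relations_list(3)[OF i]] i by (simp add: gen_eq proj_mult)
next
  show "gen Gd \<otimes>\<^bsub>A\<^esub> gen Gd \<otimes>\<^bsub>A\<^esub> gen Gu =
      \<alpha> \<odot>\<^bsub>A\<^esub> (gen Gd \<otimes>\<^bsub>A\<^esub> gen Gu \<otimes>\<^bsub>A\<^esub> gen Gd) \<oplus>\<^bsub>A\<^esub> \<beta> \<odot>\<^bsub>A\<^esub> (gen Gu \<otimes>\<^bsub>A\<^esub> gen Gd \<otimes>\<^bsub>A\<^esub> gen Gd) \<oplus>\<^bsub>A\<^esub>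
      poly_eval K A n (\<lambda>i. gen (Gt i)) \<phi> \<otimes>\<^bsub>A\<^esub> gen Gd"
    using proj_relation[OF relations_list(4)]
    by (simp add: gen_eq proj_mult proj_add proj_smult flip: proj_phi[unfolded gen_eq])
  show "gen Gd \<otimes>\<^bsub>A\<^esub> gen Gu \<otimes>\<^bsub>A\<^esub> gen Gu =
      \<alpha> \<odot>\<^bsub>A\<^esub> (gen Gu \<otimes>\<^bsub>A\<^esub> gen Gd \<otimes>\<^bsub>A\<^esub> gen Gu) \<oplus>\<^bsub>A\<^esub> \<beta> \<odot>\<^bsub>A\<^esub> (gen Gu \<otimes>\<^bsub>A\<^esub> gen Gu \<otimes>\<^bsub>A\<^esub> gen Gd) \<oplus>\<^bsub>A\<^esub>
      gen Gu \<otimes>\<^bsub>A\<^esub> poly_eval K A n (\<lambda>i. gen (Gt i)) \<phi>"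
    using proj_relation[OF relations_list(5)]
    by (simp add: gen_eq proj_mult proj_add proj_smult flip: proj_phi[unfolded gen_eq])
qed (use parameters(3) in auto)

subsection \<open>The comparison map is onto\<close>

definition theta :: "'k normal_form \<Rightarrow> (gen list \<Rightarrow> 'k) set" where
  "theta = lin_ext K A A.normal_monomial"

lemma theta_linear: "linear_map K M A theta"
  unfolding theta_def by (rule M.lin_ext_linear[OF A_vectorspace]) auto

lemma theta_delta: "x \<in> normal_indices n \<Longrightarrow> theta (delta K x) = A.normal_monomial x"
  unfolding theta_def by (rule M.lin_ext_delta[OF A_vectorspace]) auto

lemma theta_e [simp]: "set_mset \<nu> \<subseteq> {0..n} \<Longrightarrow> theta (e i j \<nu>) = A.normal_monomial (i, j, \<nu>)"
  by (simp add: e_def theta_delta mem_normal_indices)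

lemmas theta_simps [simp] = linear_map_closed[OF theta_linear] linear_map_add[OF theta_linear]
  linear_map_smult[OF theta_linear]

lemma theta_up: "v \<in> carrier M \<Longrightarrow> theta (up v) = gen Gu \<otimes>\<^bsub>A\<^esub> theta v"
  by (rule linear_map_eqI[OF linear_map_comp[OF up_linear theta_linear]
        linear_map_comp[OF theta_linear A.left_mult_linear]])
     (auto simp: A.normal_monomial_u)

lemma theta_shift:
  assumes \<mu>: "set_mset \<mu> \<subseteq> {0..n}" and v: "v \<in> carrier M"
  shows "theta (shift \<mu> v) = theta v \<otimes>\<^bsub>A\<^esub> A.right_factor \<mu>"
  by (rule linear_map_eqI[OF linear_map_comp[OF shift_linear[OF \<mu>] theta_linear]
        linear_map_comp[OF theta_linear A.right_mult_linear] v])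
     (use \<mu> in \<open>auto simp: A.normal_monomial_add shift_e\<close>)

lemma theta_shift_t:
  assumes \<mu>: "set_mset \<mu> \<subseteq> {1..n}" and v: "v \<in> carrier M"
  shows "theta (shift \<mu> v) = A.t_monomial \<mu> \<otimes>\<^bsub>A\<^esub> theta v"
  by (rule linear_map_eqI[OF linear_map_comp[OF shift_linear theta_linear]
        linear_map_comp[OF theta_linear A.left_mult_linear] v])
     (use \<mu> variables_subset[OF \<mu>] in \<open>simp_all add: A.normal_monomial_t_monomial shift_e\<close>)

abbreviation phi_A where "phi_A \<equiv> poly_eval K A n (\<lambda>i. gen (Gt i)) \<phi>"

lemma phi_A_closed [simp]: "phi_A \<in> carrier A"
  unfolding proj_phi[symmetric] by auto

lemma theta_phi:
  assumes v: "v \<in> carrier M"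
  shows "theta (phi_op v) = phi_A \<otimes>\<^bsub>A\<^esub> theta v"
proof -
  have "phi_A \<otimes>\<^bsub>A\<^esub> theta v = lin_ext K A (\<lambda>\<mu>. A.t_monomial \<mu> \<otimes>\<^bsub>A\<^esub> theta v) \<phi>"
    unfolding poly_eval_lin_ext A.t_monomial_def[symmetric]
    by (rule linear_map.map_lin_ext[OF A.right_mult_linear phi_support(1) _ phi_support(2)]) (use v in auto)
  also have "\<dots> = lin_ext K A (\<lambda>\<mu>. theta (shift \<mu> v)) \<phi>"
    by (rule lin_ext_phi_cong[OF _ A_vectorspace]) (use v variables_subset in \<open>auto simp: theta_shift_t\<close>)
  also have "\<dots> = theta (phi_op v)"
    by (rule map_phi_op[OF theta_linear v, symmetric])
  finally show ?thesis by simp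
qed

text \<open>
  Both sides satisfy the recursion in \<open>i\<close> given by the relation for \<open>du\<^sup>2\<close>, the right-hand side because that
  relation holds in the algebra.
\<close>

lemma theta_down_at:
  assumes base: "theta (down_base j) = gen Gd \<otimes>\<^bsub>A\<^esub> A.normal_monomial (0, j, {#})"
  shows "theta (down_at down_base i j) = gen Gd \<otimes>\<^bsub>A\<^esub> A.normal_monomial (i, j, {#})"
proof (induction i rule: induct_nat_012)
  case 0
  show ?case using base by simp
next
  case 1
  show ?case by (simp add: A.normal_monomial_du A.normal_monomial_u)
next
  case (ge2 i)
  let ?m = "A.normal_monomial (i, j, {#})"
  have "theta (phi_op (e (Suc i) j {#})) = theta (up (phi_op (e i j {#})))"
    by (simp add: phi_op_up)
  also have "\<dots> = gen Gu \<otimes>\<^bsub>A\<^esub> (phi_A \<otimes>\<^bsub>A\<^esub> ?m)" by (simp add: theta_up theta_phi)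
  finally have phi: "theta (phi_op (e (Suc i) j {#})) = gen Gu \<otimes>\<^bsub>A\<^esub> (phi_A \<otimes>\<^bsub>A\<^esub> ?m)" .
  have "gen Gd \<otimes>\<^bsub>A\<^esub> A.normal_monomial (Suc (Suc i), j, {#}) = (gen Gd \<otimes>\<^bsub>A\<^esub> gen Gu \<otimes>\<^bsub>A\<^esub> gen Gu) \<otimes>\<^bsub>A\<^esub> ?m"
    by (simp add: A.normal_monomial_u A.alg.m_assoc)
  also have "\<dots> = theta (down_at down_base (Suc (Suc i)) j)"
    unfolding A.duu using ge2
    by (simp add: theta_up phi down_at_closed A.normal_monomial_u A.alg.l_distr A.alg.m_assoc A.smult_mult_left)
  finally show ?case by simp
qed

lemma theta_down_bounded:
  assumes base: "\<And>j. j \<le> J \<Longrightarrow> theta (down_base j) = gen Gd \<otimes>\<^bsub>A\<^esub> A.normal_monomial (0, j, {#})"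
    and v: "v \<in> bounded J s"
  shows "theta (down v) = gen Gd \<otimes>\<^bsub>A\<^esub> theta v"
proof (rule linear_map_eq_on_bounded[OF linear_map_comp[OF down_linear theta_linear]
      linear_map_comp[OF theta_linear A.left_mult_linear] v])
  fix i j \<nu> assume j: "j \<le> J" and \<nu>: "set_mset \<nu> \<subseteq> {0..n}"
  show "theta (down (e i j \<nu>)) = gen Gd \<otimes>\<^bsub>A\<^esub> theta (e i j \<nu>)"
    using theta_down_at[OF base[OF j]] \<nu> A.normal_monomial_split[of i j \<nu>]
    by (simp add: down_e down_at_closed theta_shift A.alg.m_assoc)
qed simp

text \<open>
  The same for the recursion in \<open>j\<close> given by the relation for \<open>d\<^sup>2u\<close>. That recursion applies \<open>down\<close> to \<open>d x\<^sup>k\<close>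
  and \<open>u d x\<^sup>k\<close>, for which the induction hypothesis suffices by \<open>theta_down_bounded\<close>.
\<close>

lemma theta_down_base: "theta (down_base j) = gen Gd \<otimes>\<^bsub>A\<^esub> A.normal_monomial (0, j, {#})"
proof (induction j rule: less_induct)
  case (less j)
  show ?case
  proof (cases j)
    case 0
    have "A.t_monomial {#0#} = \<one>\<^bsub>A\<^esub>" using A.t_monomial_add_0[of "{#}"] by simp
    with 0 show ?thesis by (simp add: down_base_def A.normal_monomial_def A.right_factor_def)
  next
    case (Suc k)
    have base: "\<And>j. j \<le> k \<Longrightarrow> theta (down_base j) = gen Gd \<otimes>\<^bsub>A\<^esub> A.normal_monomial (0, j, {#})"
      using less Suc by simp
    let ?m = "A.normal_monomial (0, k, {#})"
    note down = theta_down_bounded[OF base down_base_bounded] theta_down_bounded[OF base up_bounded[OF down_base_bounded]]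
    have "gen Gd \<otimes>\<^bsub>A\<^esub> A.normal_monomial (0, j, {#}) = (gen Gd \<otimes>\<^bsub>A\<^esub> gen Gd \<otimes>\<^bsub>A\<^esub> gen Gu) \<otimes>\<^bsub>A\<^esub> ?m"
      by (simp add: Suc A.normal_monomial_du A.alg.m_assoc)
    also have "\<dots> = theta (down_base j)"
      unfolding A.ddu Suc down_base_Suc using base[of k]
      by (simp add: down theta_up theta_phi A.alg.l_distr A.alg.m_assoc A.smult_mult_left)
    finally show ?thesis by simp
  qed
qed

lemma theta_down: "v \<in> carrier M \<Longrightarrow> theta (down v) = gen Gd \<otimes>\<^bsub>A\<^esub> theta v"
  by (erule bounded_all) (rule theta_down_bounded[OF theta_down_base])

lemma theta_gen_op:
  assumes "x \<in> du_generators n" "v \<in> carrier M"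
  shows "theta (gen_op x v) = gen x \<otimes>\<^bsub>A\<^esub> theta v"
proof (cases x)
  case (Gt l)
  with assms(1) have l: "l \<in> {1..n}" by simp
  have "A.t_monomial {#l#} = gen (Gt l)" using A.t_monomial_add_mset[OF l, of "{#}"] Gt assms(1) by simp
  then show ?thesis using l Gt assms theta_shift_t[of "{#l#}" v] by simp
qed (use assms theta_up theta_down in auto)

abbreviation e0 where "e0 \<equiv> e 0 0 {#}"

text \<open>
  Every element of the algebra is obtained by letting a representative act on \<open>e 0 0 {#}\<close>, the vector
  that \<open>theta\<close> maps to \<open>1\<close>; in particular \<open>theta\<close> is onto.
\<close>

lemma proj_eq_theta:
  assumes "f \<in> carrier G.F"
  shows "Q.proj f = theta (rep f e0)"
proof (rule G.F.linear_map_eqI[OF proj_linear linear_map_comp[OF rep_linear theta_linear] assms])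
  fix w assume "w \<in> lists (du_generators n)"
  then have "Q.proj (delta K w) = theta (foldr gen_op w e0) \<and> foldr gen_op w e0 \<in> carrier M"
  proof (induction w)
    case Nil
    show ?case
      using proj_one by (simp add: free_algebra_one A.normal_monomial_def A.right_factor_def)
  next
    case (Cons x w)
    have "delta K (x # w) = free_gen K x \<otimes>\<^bsub>G.F\<^esub> delta K w"
      by (simp add: free_gen_delta G.delta_mult)
    with Cons show ?case
      using linear_map_closed[OF gen_op_linear] by (simp add: proj_mult theta_gen_op gen_eq)
  qed
  with \<open>w \<in> lists (du_generators n)\<close> show "Q.proj (delta K w) = theta (rep (delta K w) e0)"
    by (simp add: rep_delta)
qed auto

subsection \<open>The comparison map is injective\<close>

text \<open>
  The action on \<open>M\<close> descends to the quotient; by \<open>rep_ideal\<close> the result is the same for every representative.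
\<close>

definition act :: "(gen list \<Rightarrow> 'k) set \<Rightarrow> 'k normal_form \<Rightarrow> 'k normal_form" where
  "act a = rep (SOME f. f \<in> carrier G.F \<and> Q.proj f = a)"

lemma act_proj:
  assumes f: "f \<in> carrier G.F" and v: "v \<in> carrier M"
  shows "act (Q.proj f) v = rep f v"
proof -
  define g where "g = (SOME g. g \<in> carrier G.F \<and> Q.proj g = Q.proj f)"
  have g: "g \<in> carrier G.F" "Q.proj g = Q.proj f"
    unfolding g_def using someI[of "\<lambda>g. g \<in> carrier G.F \<and> Q.proj g = Q.proj f" f] f by auto
  then have "g \<ominus>\<^bsub>G.F\<^esub> f \<in> I" using f by (simp add: Q.proj_eq_iff)
  then have "rep g v \<ominus>\<^bsub>M\<^esub> rep f v = \<zero>\<^bsub>M\<^esub>"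
    using rep_ideal[OF _ v] linear_map.T_minus[OF rep_linear[OF _ v] g(1) f] by simp
  then show ?thesis using f g(1) v by (simp add: act_def g_def[symmetric])
qed

lemma carrier_A: "carrier A = Q.proj ` carrier G.F"
  using Q.carrier_quotient unfolding Q_eq .

lemma act_mult:
  "a \<in> carrier A \<Longrightarrow> b \<in> carrier A \<Longrightarrow> v \<in> carrier M \<Longrightarrow> act (a \<otimes>\<^bsub>A\<^esub> b) v = act a (act b v)"
  by (auto simp: carrier_A act_proj rep_mult simp flip: proj_mult)

lemma act_linear: "v \<in> carrier M \<Longrightarrow> linear_map K A M (\<lambda>a. act a v)"
  by (rule vectorspace.linear_mapI[OF A_vectorspace M.vectorspace_axioms])
     (auto simp: carrier_A act_proj rep_add rep_smult simp flip: proj_add proj_smult)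

lemma act_gen: "x \<in> du_generators n \<Longrightarrow> v \<in> carrier M \<Longrightarrow> act (gen x) v = gen_op x v"
  by (simp add: gen_eq act_proj rep_gen)

lemma down_e_0: "set_mset \<nu> \<subseteq> {0..n} \<Longrightarrow> down (e 0 0 \<nu>) = e 0 0 (add_mset 0 \<nu>)"
  by (simp add: down_e down_base_def shift_e)

lemma down_e_1: "set_mset \<nu> \<subseteq> {0..n} \<Longrightarrow> down (e (Suc 0) j \<nu>) = e 0 (Suc j) \<nu>"
  by (simp add: down_e shift_e)

lemma act_right_factor:
  assumes "set_mset \<nu> \<subseteq> {0..n}"
  shows "act (A.right_factor \<nu>) e0 = e 0 0 \<nu>"
  using assms
proof (induction \<nu>)
  case empty
  have "A.right_factor {#} = Q.proj \<one>\<^bsub>G.F\<^esub>" by (simp add: A.right_factor_def proj_one)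
  then show ?case using act_proj[OF G.F.alg.one_closed, of e0] by (simp add: rep_one)
next
  case (add l \<nu>)
  have l: "set_mset {#l#} \<subseteq> {0..n}" using add.prems by auto
  have "A.right_factor (add_mset l \<nu>) = A.right_factor {#l#} \<otimes>\<^bsub>A\<^esub> A.right_factor \<nu>"
    using A.right_factor_add[OF l, of \<nu>] by simp
  then have *: "act (A.right_factor (add_mset l \<nu>)) e0 = act (A.right_factor {#l#}) (e 0 0 \<nu>)"
    using add by (simp add: act_mult)
  show ?case
  proof (cases "l = 0")
    case True
    have "A.t_monomial {#0#} = \<one>\<^bsub>A\<^esub>" using A.t_monomial_add_0[of "{#}"] by simp
    then have "A.right_factor {#l#} = gen Gd" using True by (simp add: A.right_factor_def)
    with True add.prems show ?thesis unfolding * by (simp add: act_gen down_e_0)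
  next
    case False
    then have l': "l \<in> {1..n}" using l by auto
    have "A.right_factor {#l#} = gen (Gt l)"
      using False A.t_monomial_add_mset[OF l', of "{#}"] A.elements(3)[OF l'] by (simp add: A.right_factor_def)
    with l' add.prems show ?thesis unfolding * by (simp add: act_gen shift_e)
  qed
qed

lemma act_normal_monomial:
  assumes "set_mset \<nu> \<subseteq> {0..n}"
  shows "act (A.normal_monomial (i, j, \<nu>)) e0 = e i j \<nu>"
proof (induction i)
  case 0
  show ?case
  proof (induction j)
    case 0
    show ?case using act_right_factor[OF assms] by (simp add: A.normal_monomial_def)
  next
    case (Suc j)
    then show ?case using assms by (simp add: A.normal_monomial_du act_mult act_gen down_e_1)
  qed
next
  case (Suc i)
  then show ?case using assms by (simp add: A.normal_monomial_u act_mult act_gen)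
qed

text \<open>
  The left inverse of \<open>theta\<close>: the monomial \<open>normal_monomial (i, j, \<nu>)\<close> acts on \<open>e 0 0 {#}\<close> by building up
  \<open>e i j \<nu>\<close> one factor at a time.
\<close>

lemma act_theta: "v \<in> carrier M \<Longrightarrow> act (theta v) e0 = v"
  by (rule linear_map_eqI[OF linear_map_comp[OF theta_linear act_linear] M.linear_mapI[OF M.vectorspace_axioms]])
     (auto simp: act_normal_monomial)

lemma theta_bij: "bij_betw theta (carrier M) (carrier A)"
proof (rule bij_betw_imageI)
  show "inj_on theta (carrier M)" by (rule inj_on_inverseI[of _ "\<lambda>a. act a e0"]) (rule act_theta)
  show "theta ` carrier M = carrier A"
  proof
    show "theta ` carrier M \<subseteq> carrier A" using theta_simps(1) by blast
    show "carrier A \<subseteq> theta ` carrier M"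
    proof
      fix a assume "a \<in> carrier A"
      then obtain f where f: "f \<in> carrier G.F" "a = Q.proj f" unfolding carrier_A by blast
      show "a \<in> theta ` carrier M"
        unfolding f(2) proj_eq_theta[OF f(1)] by (rule imageI) (simp add: f(1))
    qed
  qed
qed

theorem normal_monomial_basis:
  "inj_on A.normal_monomial (normal_indices n)"
  "vectorspace.basis K A (A.normal_monomial ` normal_indices n)"
proof -
  have "inj_on (\<lambda>x. theta (delta K x)) (normal_indices n)"
    and "vectorspace.basis K A ((\<lambda>x. theta (delta K x)) ` normal_indices n)"
    by (rule M.basis_of_bijection[OF theta_linear theta_bij])+
  moreover have "(\<lambda>x. theta (delta K x)) ` normal_indices n = A.normal_monomial ` normal_indices n"
    by (rule image_cong) (auto simp: theta_delta)
  ultimately show "inj_on A.normal_monomial (normal_indices n)"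
    "vectorspace.basis K A (A.normal_monomial ` normal_indices n)"
    by (simp_all add: theta_delta cong: inj_on_cong)
qed

subsection \<open>Exponents\<close>

definition exponent_index :: "nat \<times> nat \<times> nat \<times> (nat \<Rightarrow> nat) \<Rightarrow> nat \<times> nat \<times> nat multiset" where
  "exponent_index = (\<lambda>(i, j, k, m). (i, j, replicate_mset k 0 + (\<Sum>l\<in>{1..n}. replicate_mset (m l) l)))"

lemma count_exponent_index:
  "count (replicate_mset k 0 + (\<Sum>l\<in>{1..n}. replicate_mset (m l) l)) x =
    (if x = 0 then k else if x \<le> n then m x else 0)"
proof -
  have "count (\<Sum>l\<in>{1..n}. replicate_mset (m l) l) x = (\<Sum>l\<in>{1..n}. if l = x then m l else 0)"
    by (simp add: count_sum)
  also have "\<dots> = (if x \<in> {1..n} then m x else 0)" by (simp add: sum.delta)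
  finally show ?thesis by auto
qed

lemma exponent_index_bij: "bij_betw exponent_index (du_exponents n) (normal_indices n)"
proof (rule bij_betw_byWitness[where f' = "\<lambda>(i, j, \<nu>). (i, j, count \<nu> 0, restrict (count \<nu>) {1..n})"])
  show "\<forall>x\<in>du_exponents n. (\<lambda>(i, j, \<nu>). (i, j, count \<nu> 0, restrict (count \<nu>) {1..n})) (exponent_index x) = x"
  proof
    fix x assume "x \<in> du_exponents n"
    then obtain i j k m where x: "x = (i, j, k, m)" and m: "m \<in> {1..n} \<rightarrow>\<^sub>E UNIV"
      by (auto simp: du_exponents_def)
    have "restrict (\<lambda>x. if x = 0 then k else if x \<le> n then m x else 0) {1..n} = m"
      using m by (intro extensionalityI[of _ "{1..n}"]) (auto simp: PiE_def)
    then show "(\<lambda>(i, j, \<nu>). (i, j, count \<nu> 0, restrict (count \<nu>) {1..n})) (exponent_index x) = x"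
      unfolding x exponent_index_def prod.case count_exponent_index by simp
  qed
  show "\<forall>x\<in>normal_indices n. exponent_index ((\<lambda>(i, j, \<nu>). (i, j, count \<nu> 0, restrict (count \<nu>) {1..n})) x) = x"
  proof
    fix x assume "x \<in> normal_indices n"
    then obtain i j \<nu> where x: "x = (i, j, \<nu>)" and \<nu>: "set_mset \<nu> \<subseteq> {0..n}"
      by (auto simp: normal_indices_def)
    have "replicate_mset (count \<nu> 0) 0 + (\<Sum>l\<in>{1..n}. replicate_mset (restrict (count \<nu>) {1..n} l) l) = \<nu>"
    proof (rule multiset_eqI)
      fix y
      have "count \<nu> y = 0" if "\<not> y \<le> n" using \<nu> that by (auto simp: count_eq_zero_iff)
      then show "count (replicate_mset (count \<nu> 0) 0 + (\<Sum>l\<in>{1..n}. replicate_mset (restrict (count \<nu>) {1..n} l) l)) y = count \<nu> y"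
        unfolding count_exponent_index by auto
    qed
    then show "exponent_index ((\<lambda>(i, j, \<nu>). (i, j, count \<nu> 0, restrict (count \<nu>) {1..n})) x) = x"
      unfolding x exponent_index_def prod.case by simp
  qed
  show "exponent_index ` du_exponents n \<subseteq> normal_indices n"
  proof -
    have "set_mset (replicate_mset k 0 + (\<Sum>l\<in>{1..n}. replicate_mset (m l) l)) \<subseteq> {0..n}" for k m
    proof
      fix x assume "x \<in># replicate_mset k 0 + (\<Sum>l\<in>{1..n}. replicate_mset (m l) l)"
      then have "count (replicate_mset k 0 + (\<Sum>l\<in>{1..n}. replicate_mset (m l) l)) x \<noteq> 0"
        by (simp only: count_eq_zero_iff simp_thms)
      then show "x \<in> {0..n}" unfolding count_exponent_index by (auto split: if_splits)
    qed
    then have "exponent_index x \<in> normal_indices n" for x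
      by (cases x) (simp only: exponent_index_def prod.case mem_normal_indices)
    then show ?thesis by (rule image_subsetI)
  qed
  show "(\<lambda>(i, j, \<nu>). (i, j, count \<nu> 0, restrict (count \<nu>) {1..n})) ` normal_indices n \<subseteq> du_exponents n"
    by (auto simp: du_exponents_def)
qed

lemma du_monomial_eq: "du_monomial K n \<alpha> \<beta> \<phi> x = A.normal_monomial (exponent_index x)"
proof -
  obtain i j k m where x: "x = (i, j, k, m)" by (cases x)
  let ?\<nu> = "replicate_mset k 0 + (\<Sum>l\<in>{1..n}. replicate_mset (m l) l)"
  have "ordered_monomial A n (\<lambda>l. gen (Gt l)) m = A.t_monomial ?\<nu>"
    unfolding A.t_monomial_def by (rule ordered_monomial_cong) (simp only: count_exponent_index atLeastAtMost_iff, simp)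
  moreover have "count ?\<nu> 0 = k" by (simp only: count_exponent_index simp_thms if_True)
  ultimately show ?thesis
    unfolding x du_monomial_def exponent_index_def A.normal_monomial_def A.right_factor_def Let_def prod.case
    by (simp add: A.alg.m_assoc del: count_union)
qed

theorem du_monomial_basis:
  "inj_on (du_monomial K n \<alpha> \<beta> \<phi>) (du_exponents n)"
  "vectorspace.basis K A (du_monomial K n \<alpha> \<beta> \<phi> ` du_exponents n)"
proof -
  have eq: "du_monomial K n \<alpha> \<beta> \<phi> = A.normal_monomial \<circ> exponent_index"
    by (simp add: fun_eq_iff du_monomial_eq)
  have image: "exponent_index ` du_exponents n = normal_indices n"
    using exponent_index_bij by (rule bij_betw_imp_surj_on)
  show "inj_on (du_monomial K n \<alpha> \<beta> \<phi>) (du_exponents n)"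
    unfolding eq using normal_monomial_basis(1) bij_betw_imp_inj_on[OF exponent_index_bij]
    by (intro comp_inj_on) (simp_all only: image)
  show "vectorspace.basis K A (du_monomial K n \<alpha> \<beta> \<phi> ` du_exponents n)"
    unfolding eq image_comp[symmetric] image by (rule normal_monomial_basis(2))
qed

end

section \<open>Gelfand--Kirillov dimension\<close>

text \<open>
  By the replacement theorem, independent sets in \<open>P\<close> have at most \<open>card B\<close> elements, so a maximal one exists,
  and it is a basis of \<open>P\<close>.
\<close>

lemma (in vectorspace) subspace_of_span_dim:
  assumes P: "subspace K P V" and B: "finite B" "B \<subseteq> carrier V" and sub: "P \<subseteq> span B"
  shows "vectorspace.fin_dim K (vs P)" and "vectorspace.dim K (vs P) \<le> card B"
proof -
  interpret P: vectorspace K "vs P" by (rule subspace_is_vs[OF P])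
  have subm: "submodule K P V" using P by (rule is_module)
  have le: "finite A \<and> card A \<le> card B" if A: "A \<subseteq> carrier (vs P) \<and> P.lin_indpt A" for A
  proof -
    have AP: "A \<subseteq> P" using A by simp
    have li: "lin_indpt A" using A unfolding span_li_not_depend(2)[OF AP subm] by blast
    have *: "card A' \<le> card B" if "finite A'" "A' \<subseteq> A" for A'
    proof -
      have li': "lin_indpt A'" using subset_li_is_li[OF li that(2)] .
      have sub': "A' \<subseteq> span B" using that(2) AP sub by blast
      from replacement[OF that(1) B li' sub'] obtain C where "C \<subseteq> carrier V" "int (card C) \<le> int (card B) - int (card A')"
        by blast
      then show ?thesis by linarith
    qed
    have "finite A"
    proof (rule ccontr)
      assume "infinite A"
      then obtain A' where "finite A'" "card A' = Suc (card B)" "A' \<subseteq> A"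
        using infinite_arbitrarily_large by blast
      with *[of A'] show False by simp
    qed
    with * show ?thesis by blast
  qed
  have "{} \<subseteq> carrier (vs P) \<and> P.lin_indpt {}" unfolding P.lin_dep_def by blast
  from maximal_exists[of "\<lambda>A. A \<subseteq> carrier (vs P) \<and> P.lin_indpt A", OF le this]
  obtain A where A: "finite A" "maximal A (\<lambda>A. A \<subseteq> carrier (vs P) \<and> P.lin_indpt A)" by blast
  have basis: "P.basis A" by (rule P.max_li_is_basis[OF A(2)])
  then show "P.fin_dim" using A(1) unfolding P.fin_dim_def P.basis_def by blast
  have "card A \<le> card B" using le[of A] A(2) unfolding maximal_def by blast
  then show "P.dim \<le> card B" using P.dim_basis[OF A(1) basis] by simp
qed

lemma (in vectorspace) card_le_subspace_dim:
  assumes P: "subspace K P V" and fin: "vectorspace.fin_dim K (vs P)" and A: "A \<subseteq> P" "lin_indpt A"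
  shows "card A \<le> vectorspace.dim K (vs P)"
proof -
  interpret P: vectorspace K "vs P" by (rule subspace_is_vs[OF P])
  have "P.lin_indpt A" using A span_li_not_depend(2)[OF A(1) is_module[OF P]] by simp
  then show ?thesis using P.li_le_dim(2)[OF fin] A(1) by simp
qed

lemma linear_map_span_subset:
  assumes T: "linear_map K V W T" and P: "submodule K P W" and Y: "Y \<subseteq> carrier V" "T ` Y \<subseteq> P"
    and v: "v \<in> module.span K V Y"
  shows "T v \<in> P"
proof -
  interpret V: vectorspace K V by (rule linear_map.axioms(1)[OF T])
  have "submodule K {x \<in> carrier V. T x \<in> P} V"
    by (rule submodule.intro)
       (auto simp: linear_map_add[OF T] linear_map_smult[OF T] linear_map.T0_is_0[OF T] V.module_axioms
         intro: submodule.m_closed[OF P] submodule.smult_closed[OF P] submodule.zero_closed[OF P])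
  then have "V.span Y \<subseteq> {x \<in> carrier V. T x \<in> P}"
    by (rule V.span_is_subset[rotated]) (use Y in blast)
  with v show ?thesis by blast
qed

context assoc_algebra
begin

abbreviation list_product where "list_product xs \<equiv> foldr (\<otimes>\<^bsub>A\<^esub>) xs \<one>\<^bsub>A\<^esub>"

lemma list_product_closed: "set xs \<subseteq> carrier A \<Longrightarrow> list_product xs \<in> carrier A"
  by (induction xs) auto

lemma list_product_append:
  "set xs \<subseteq> carrier A \<Longrightarrow> set ys \<subseteq> carrier A \<Longrightarrow> list_product (xs @ ys) = list_product xs \<otimes>\<^bsub>A\<^esub> list_product ys"
  by (induction xs) (auto simp: alg.m_assoc list_product_closed)

lemma list_product_replicate: "x \<in> carrier A \<Longrightarrow> list_product (replicate k x) = x [^]\<^bsub>A\<^esub> k"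
proof (induction k)
  case (Suc k)
  then show ?case using alg.commutes_pow[of x x k] by simp
qed simp

lemma ordered_monomial_list_product:
  assumes "\<And>l. l \<in> {1..n} \<Longrightarrow> t l \<in> carrier A"
  shows "ordered_monomial A n t m = list_product (concat (map (\<lambda>l. replicate (m l) (t l)) [1..<Suc n]))"
proof -
  have "foldr (\<lambda>i y. (t i [^]\<^bsub>A\<^esub> m i) \<otimes>\<^bsub>A\<^esub> y) xs \<one>\<^bsub>A\<^esub> = list_product (concat (map (\<lambda>l. replicate (m l) (t l)) xs))"
    if "set xs \<subseteq> {1..n}" for xs
    using that
  proof (induction xs)
    case (Cons l xs)
    have closed: "t l \<in> carrier A" "set (replicate (m l) (t l)) \<subseteq> carrier A"
      "set (concat (map (\<lambda>l. replicate (m l) (t l)) xs)) \<subseteq> carrier A"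
      using Cons.prems assms by auto
    have "list_product (concat (map (\<lambda>l. replicate (m l) (t l)) (l # xs))) =
        t l [^]\<^bsub>A\<^esub> m l \<otimes>\<^bsub>A\<^esub> list_product (concat (map (\<lambda>l. replicate (m l) (t l)) xs))"
      unfolding list.map concat.simps list_product_append[OF closed(2,3)] list_product_replicate[OF closed(1)] ..
    with Cons show ?case by (simp del: foldr_append)
  qed simp
  from this[of "[1..<Suc n]"] show ?thesis
    unfolding ordered_monomial_def by (simp only: set_upt atLeastLessThanSuc_atLeastAtMost subset_refl simp_thms)
qed

lemma power_span_subspace: "V \<subseteq> carrier A \<Longrightarrow> subspace K (power_span K A V r) A"
  unfolding power_span_def by (rule span_is_subspace) (use list_product_closed in blast)

end

context du_model
begin

interpretation A: vectorspace K A by (rule A_vectorspace)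

text \<open>
  An exhaustive multiplicative filtration of the algebra by finite-dimensional subspaces.
\<close>

definition word_span :: "nat \<Rightarrow> (gen list \<Rightarrow> 'k) set set" where
  "word_span l = A.span {Q.proj (delta K w) |w. w \<in> lists (du_generators n) \<and> length w \<le> l}"

lemma word_classes_closed:
  "{Q.proj (delta K w) |w. w \<in> lists (du_generators n) \<and> length w \<le> l} \<subseteq> carrier A"
  by auto

lemma word_span_submodule: "submodule K (word_span l) A"
  unfolding word_span_def by (rule A.span_is_submodule[OF word_classes_closed])

lemma word_span_closed: "word_span l \<subseteq> carrier A"
  unfolding word_span_def by (rule A.span_is_subset2[OF word_classes_closed])

lemma word_in_word_span:
  "w \<in> lists (du_generators n) \<Longrightarrow> length w \<le> l \<Longrightarrow> Q.proj (delta K w) \<in> word_span l"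
  unfolding word_span_def using A.in_own_span[OF word_classes_closed] by blast

lemma word_span_mono: "l \<le> l' \<Longrightarrow> word_span l \<subseteq> word_span l'"
  unfolding word_span_def by (rule A.span_is_monotone) auto

lemma word_span_mult:
  assumes a: "a \<in> word_span l" and b: "b \<in> word_span l'"
  shows "a \<otimes>\<^bsub>A\<^esub> b \<in> word_span (l + l')"
proof -
  have bA: "b \<in> carrier A" using b word_span_closed by auto
  have word: "Q.proj (delta K w) \<otimes>\<^bsub>A\<^esub> b \<in> word_span (l + l')"
    if w: "w \<in> lists (du_generators n)" "length w \<le> l" for w
  proof (rule linear_map_span_subset[OF A.left_mult_linear word_span_submodule word_classes_closed _ b[unfolded word_span_def]])
    show "Q.proj (delta K w) \<in> carrier A" using w by auto
    show "(\<lambda>y. Q.proj (delta K w) \<otimes>\<^bsub>A\<^esub> y) ` {Q.proj (delta K w) |w. w \<in> lists (du_generators n) \<and> length w \<le> l'} \<subseteq> word_span (l + l')"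
    proof (rule image_subsetI)
      fix y assume "y \<in> {Q.proj (delta K w) |w. w \<in> lists (du_generators n) \<and> length w \<le> l'}"
      then obtain w' where w': "w' \<in> lists (du_generators n)" "length w' \<le> l'" and y: "y = Q.proj (delta K w')"
        by blast
      have "Q.proj (delta K w) \<otimes>\<^bsub>A\<^esub> Q.proj (delta K w') = Q.proj (delta K (w @ w'))"
        using w w' proj_mult[of "delta K w" "delta K w'"] by (simp add: G.delta_mult)
      then show "Q.proj (delta K w) \<otimes>\<^bsub>A\<^esub> y \<in> word_span (l + l')"
        using w w' y by (simp add: word_in_word_span)
    qed
  qed
  show ?thesis
    by (rule linear_map_span_subset[OF A.right_mult_linear[OF bA] word_span_submodule word_classes_closed _ a[unfolded word_span_def]])
       (use word in blast)
qed

lemma word_span_list_product: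
  "set vs \<subseteq> word_span l \<Longrightarrow> A.list_product vs \<in> word_span (l * length vs)"
proof (induction vs)
  case Nil
  have "\<one>\<^bsub>A\<^esub> = Q.proj (delta K [])" using proj_one by (simp add: free_algebra_one)
  then show ?case using word_in_word_span[of "[]" 0] by simp
next
  case (Cons v vs)
  then show ?case using word_span_mult[of v l "A.list_product vs" "l * length vs"] by simp
qed

lemma word_span_exhaustive:
  assumes "a \<in> carrier A"
  obtains l where "a \<in> word_span l"
proof -
  obtain f where f: "f \<in> carrier G.F" "a = Q.proj f" using assms unfolding carrier_A by blast
  have fin: "finite {w. f w \<noteq> \<zero>\<^bsub>K\<^esub>}" by (rule G.F.finite_support[OF f(1)])
  have "Q.proj f \<in> word_span (\<Sum>w\<in>{w. f w \<noteq> \<zero>\<^bsub>K\<^esub>}. length w)"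
    by (rule G.F.linear_map_image_in_submodule[OF proj_linear word_span_submodule f(1)])
       (use fin in \<open>auto intro!: word_in_word_span member_le_sum\<close>)
  with f that show ?thesis by blast
qed

lemma finite_word_span:
  assumes "finite Y" "Y \<subseteq> carrier A"
  shows "\<exists>l. Y \<subseteq> word_span l"
  using assms
proof (induction Y)
  case (insert x Y)
  then obtain l l' where "Y \<subseteq> word_span l" "x \<in> word_span l'"
    using word_span_exhaustive by (metis insert_subset)
  then have "insert x Y \<subseteq> word_span (l + l')"
    using word_span_mono[of l "l + l'"] word_span_mono[of l' "l + l'"] by auto
  then show ?case by blast
qed simp

definition light_indices :: "nat \<Rightarrow> (nat \<times> nat \<times> nat multiset) set" where
  "light_indices s = {x \<in> normal_indices n. weight x \<le> s}"

lemma card_light_indices: "finite (light_indices s)" "card (light_indices s) \<le> Suc s ^ (n + 3)"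
proof -
  \<comment> \<open>Record the exponents of \<open>x\<close> as a function on \<open>{..<n + 3}\<close>: multiplicities first, then \<open>i\<close> and \<open>j\<close>.\<close>
  define h where "h = (\<lambda>(i, j, \<nu>). \<lambda>p\<in>{..<n + 3}. if p = n + 1 then i else if p = n + 2 then j else count \<nu> p)"
  have inj: "inj_on h (light_indices s)"
  proof (rule inj_onI)
    fix x y assume x: "x \<in> light_indices s" and y: "y \<in> light_indices s" and eq: "h x = h y"
    obtain i j \<nu> i' j' \<nu>' where xy: "x = (i, j, \<nu>)" "y = (i', j', \<nu>')" by (cases x, cases y)
    have p: "h x p = h y p" for p using eq by simp
    have "count \<nu> p = count \<nu>' p" for p
    proof (cases "p \<le> n")
      case True
      then show ?thesis using p[of p] by (simp add: h_def xy)
    next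
      case False
      then have "p \<notin># \<nu>" "p \<notin># \<nu>'" using x y by (auto simp: light_indices_def xy mem_normal_indices)
      then show ?thesis by (simp add: not_in_iff)
    qed
    then show "x = y" using p[of "n + 1"] p[of "n + 2"] by (simp add: h_def xy multiset_eq_iff)
  qed
  have img: "h ` light_indices s \<subseteq> {..<n + 3} \<rightarrow>\<^sub>E {..s}"
  proof
    fix f assume "f \<in> h ` light_indices s"
    then obtain i j \<nu> where f: "f = h (i, j, \<nu>)" and w: "weight (i, j, \<nu>) \<le> s"
      by (auto simp: light_indices_def)
    have "1 * (i + 2 * j) \<le> phi_bound * (i + 2 * j)" using phi_bound_pos by (intro mult_le_mono1)
    then have "i + 2 * j + size \<nu> \<le> s" using w unfolding weight_def prod.case mult_1
      by (rule order_trans[OF add_right_mono])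
    then have "i \<le> s" "j \<le> s" "size \<nu> \<le> s" by auto
    moreover have "count \<nu> p \<le> s" for p using le_trans[OF count_le_size \<open>size \<nu> \<le> s\<close>] .
    ultimately show "f \<in> {..<n + 3} \<rightarrow>\<^sub>E {..s}"
      unfolding f h_def prod.case by auto
  qed
  have fin: "finite ({..<n + 3} \<rightarrow>\<^sub>E {..s})" by (rule finite_PiE) auto
  show "finite (light_indices s)" using inj_on_finite[OF inj img fin] .
  show "card (light_indices s) \<le> Suc s ^ (n + 3)"
    using card_inj_on_le[OF inj img fin] by (simp add: card_PiE)
qed

text \<open>
  A word is \<open>theta\<close> of the vector obtained by letting its letters act on \<open>e 0 0 {#}\<close>, and each letter raises the
  weight by at most \<open>phi_bound\<close>.
\<close>

lemma word_span_light:
  "word_span l \<subseteq> A.span (A.normal_monomial ` light_indices (phi_bound * l))"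
proof -
  let ?B = "A.normal_monomial ` light_indices (phi_bound * l)"
  have B: "?B \<subseteq> carrier A" by auto
  have "Q.proj (delta K w) \<in> A.span ?B" if w: "w \<in> lists (du_generators n)" "length w \<le> l" for w
  proof -
    have "\<exists>J. foldr gen_op w e0 \<in> bounded J (phi_bound * length w)"
      using w(1)
    proof (induction w)
      case Nil
      show ?case by (auto intro!: exI[of _ 0] e_bounded simp: weight_def)
    next
      case (Cons x w)
      then obtain J where J: "foldr gen_op w e0 \<in> bounded J (phi_bound * length w)" by auto
      have x: "x \<in> du_generators n" using Cons by simp
      have "gen_op x (foldr gen_op w e0) \<in> bounded (Suc J) (phi_bound * length w + phi_bound)"
      proof (cases x)
        case (Gt i)
        with x have "shift {#i#} (foldr gen_op w e0) \<in> bounded J (phi_bound * length w + size {#i#})"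
          by (intro shift_bounded J) auto
        with Gt phi_bound_pos show ?thesis by (auto intro: bounded_mono)
      qed (use up_bounded[OF J] down_bounded[OF J] in \<open>auto intro: bounded_mono\<close>)
      then show ?case by (auto simp: add.commute)
    qed
    then obtain J where J: "foldr gen_op w e0 \<in> bounded J (phi_bound * length w)" by blast
    have le: "phi_bound * length w \<le> phi_bound * l" using w(2) by simp
    have light: "x \<in> light_indices (phi_bound * l)" if "foldr gen_op w e0 x \<noteq> \<zero>\<^bsub>K\<^esub>" "x \<in> normal_indices n" for x
    proof -
      have "weight x \<le> phi_bound * length w" using J that(1) unfolding bounded_def by blast
      then show ?thesis using le_trans[OF _ le] that(2) unfolding light_indices_def by blast
    qed
    have "Q.proj (delta K w) = theta (foldr gen_op w e0)"
      using proj_eq_theta[of "delta K w"] w(1) by (simp add: rep_delta)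
    also have "\<dots> \<in> A.span ?B"
    proof (rule M.linear_map_image_in_submodule[OF theta_linear A.span_is_submodule[OF B] bounded_carrier[OF J]])
      fix x assume "x \<in> normal_indices n" "foldr gen_op w e0 x \<noteq> \<zero>\<^bsub>K\<^esub>"
      then have "theta (delta K x) \<in> ?B" using light by (simp add: theta_delta)
      then show "theta (delta K x) \<in> A.span ?B" using A.in_own_span[OF B] by blast
    qed
    finally show ?thesis .
  qed
  then show ?thesis
    unfolding word_span_def by (intro A.span_is_subset A.span_is_submodule[OF B]) blast
qed

text \<open>
  A finite-dimensional \<open>V\<close> lies in some \<open>word_span l\<close>, hence products of at most \<open>r\<close> of its elements lie in
  \<open>word_span (l r)\<close>, which is spanned by monomials of weight linear in \<open>r\<close>.
\<close>

lemma power_span_dim_upper: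
  assumes V: "subspace K V A" "vectorspace.fin_dim K (A\<lparr>carrier := V\<rparr>)"
  obtains C where
    "\<And>r. vectorspace.fin_dim K (A\<lparr>carrier := power_span K A V r\<rparr>)"
    "\<And>r. vectorspace.dim K (A\<lparr>carrier := power_span K A V r\<rparr>) \<le> Suc (C * r) ^ (n + 3)"
proof -
  have subm: "submodule K V A" using V(1) by (rule A.is_module)
  have VA: "V \<subseteq> carrier A" using submodule.subset[OF subm] .
  interpret V: vectorspace K "A\<lparr>carrier := V\<rparr>" by (rule A.subspace_is_vs[OF V(1)])
  obtain Y where Y: "finite Y" "Y \<subseteq> V" "V.span Y = V"
    using V(2) unfolding V.fin_dim_def by auto
  then have VX: "V = A.span Y" using A.span_li_not_depend(1)[OF Y(2) subm] by simp
  obtain l where l: "Y \<subseteq> word_span l" using finite_word_span[OF Y(1)] Y(2) VA by blast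
  have Vl: "V \<subseteq> word_span l" unfolding VX by (rule A.span_is_subset[OF l word_span_submodule])
  have sub: "power_span K A V r \<subseteq> A.span (A.normal_monomial ` light_indices (phi_bound * l * r))" for r
  proof -
    have "A.list_product vs \<in> word_span (l * r)" if "set vs \<subseteq> V" "length vs \<le> r" for vs
      using word_span_list_product[of vs l] word_span_mono[of "l * length vs" "l * r"] that Vl by auto
    then have "power_span K A V r \<subseteq> word_span (l * r)"
      unfolding power_span_def by (intro A.span_is_subset word_span_submodule) blast
    with word_span_light[of "l * r"] show ?thesis by (auto simp: mult.assoc)
  qed
  have B: "finite (A.normal_monomial ` light_indices s)" "A.normal_monomial ` light_indices s \<subseteq> carrier A"
    "card (A.normal_monomial ` light_indices s) \<le> Suc s ^ (n + 3)" for s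
    using card_light_indices[of s] card_image_le[OF card_light_indices(1)[of s], of A.normal_monomial]
    by (auto intro: le_trans)
  note dim = A.subspace_of_span_dim[OF A.power_span_subspace[OF VA] B(1,2) sub]
  show ?thesis
  proof (rule that)
    show "vectorspace.fin_dim K (A\<lparr>carrier := power_span K A V r\<rparr>)" for r by (rule dim(1))
    show "vectorspace.dim K (A\<lparr>carrier := power_span K A V r\<rparr>) \<le> Suc (phi_bound * l * r) ^ (n + 3)" for r
      by (rule le_trans[OF dim(2) B(3)])
  qed
qed

definition generating_set :: "(gen list \<Rightarrow> 'k) set set" where
  "generating_set = {gen Gu, gen Gd \<otimes>\<^bsub>A\<^esub> gen Gu, gen Gd} \<union> (\<lambda>l. gen (Gt l)) ` {1..n}"

lemma du_monomial_in_power_span: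
  assumes gens: "generating_set \<subseteq> V" "V \<subseteq> carrier A" and x: "x \<in> {..q} \<times> {..q} \<times> {..q} \<times> ({1..n} \<rightarrow>\<^sub>E {..q})"
    and r: "(n + 3) * q \<le> r"
  shows "du_monomial K n \<alpha> \<beta> \<phi> x \<in> power_span K A V r"
proof -
  obtain i j k m where x_eq: "x = (i, j, k, m)" and le: "i \<le> q" "j \<le> q" "k \<le> q"
    and m: "\<And>l. l \<in> {1..n} \<Longrightarrow> m l \<le> q" using x by (auto simp: PiE_def Pi_def)
  let ?ts = "concat (map (\<lambda>l. replicate (m l) (gen (Gt l))) [1..<Suc n])"
  let ?vs = "replicate i (gen Gu) @ replicate j (gen Gd \<otimes>\<^bsub>A\<^esub> gen Gu) @ replicate k (gen Gd) @ ?ts"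
  have ts: "set ?ts \<subseteq> carrier A" "set ?ts \<subseteq> generating_set" by (auto simp: generating_set_def)
  have vs: "set ?vs \<subseteq> generating_set" using ts(2) by (auto simp: generating_set_def)
  have "length ?ts = (\<Sum>l\<leftarrow>[1..<Suc n]. m l)" by (simp add: length_concat comp_def)
  also have "\<dots> = (\<Sum>l\<in>{1..n}. m l)"
    by (simp only: sum_list_distinct_conv_sum_set distinct_upt set_upt atLeastLessThanSuc_atLeastAtMost)
  also have "\<dots> \<le> n * q" using sum_bounded_above[of "{1..n}" m q] m by simp
  finally have len: "length ?vs \<le> r" using le r by (simp add: algebra_simps)
  have prod: "A.list_product ?vs = du_monomial K n \<alpha> \<beta> \<phi> x"
  proof -
    have gens: "gen Gu \<in> carrier A" "gen Gd \<in> carrier A" "gen Gd \<otimes>\<^bsub>A\<^esub> gen Gu \<in> carrier A" by auto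
    have c: "set (replicate i (gen Gu)) \<subseteq> carrier A" "set (replicate k (gen Gd)) \<subseteq> carrier A"
      "set (replicate j (gen Gd \<otimes>\<^bsub>A\<^esub> gen Gu)) \<subseteq> carrier A"
      using gens by auto
    have c': "set (replicate k (gen Gd) @ ?ts) \<subseteq> carrier A"
      "set (replicate j (gen Gd \<otimes>\<^bsub>A\<^esub> gen Gu) @ replicate k (gen Gd) @ ?ts) \<subseteq> carrier A"
      unfolding set_append using c ts(1) by blast+
    have "A.list_product ?vs = gen Gu [^]\<^bsub>A\<^esub> i \<otimes>\<^bsub>A\<^esub> ((gen Gd \<otimes>\<^bsub>A\<^esub> gen Gu) [^]\<^bsub>A\<^esub> j \<otimes>\<^bsub>A\<^esub>
        (gen Gd [^]\<^bsub>A\<^esub> k \<otimes>\<^bsub>A\<^esub> A.list_product ?ts))"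
      unfolding A.list_product_append[OF c(1) c'(2)] A.list_product_append[OF c(3) c'(1)]
        A.list_product_append[OF c(2) ts(1)] A.list_product_replicate[OF gens(1)]
        A.list_product_replicate[OF gens(2)] A.list_product_replicate[OF gens(3)] ..
    also have "A.list_product ?ts = ordered_monomial A n (\<lambda>l. gen (Gt l)) m"
      by (rule A.ordered_monomial_list_product[symmetric]) auto
    finally show ?thesis
      unfolding x_eq du_monomial_def Let_def prod.case
      using A.list_product_closed[OF ts(1)] A.ordered_monomial_list_product[of n "\<lambda>l. gen (Gt l)" m]
      by (simp add: A.alg.m_assoc del: upt_Suc)
  qed
  have closed: "{A.list_product vs |vs. set vs \<subseteq> V \<and> length vs \<le> r} \<subseteq> carrier A"
    using A.list_product_closed gens(2) by blast
  have "A.list_product ?vs \<in> {A.list_product vs |vs. set vs \<subseteq> V \<and> length vs \<le> r}"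
    using len vs gens(1) by blast
  then show ?thesis
    unfolding power_span_def prod using A.in_own_span[OF closed] by blast
qed

text \<open>
  A monomial with all \<open>n + 3\<close> exponents at most \<open>q\<close> is a product of at most \<open>(n + 3) q\<close> elements of the generating
  set; \<open>r div (n + 3)\<close> is the largest \<open>q\<close> for which this is at most \<open>r\<close>.
\<close>

lemma power_span_dim_lower:
  obtains V where "subspace K V A" "vectorspace.fin_dim K (A\<lparr>carrier := V\<rparr>)"
    "\<And>r. Suc (r div (n + 3)) ^ (n + 3) \<le> vectorspace.dim K (A\<lparr>carrier := power_span K A V r\<rparr>)"
proof -
  define V where "V = A.span generating_set"
  have gens: "generating_set \<subseteq> carrier A" "finite generating_set" by (auto simp: generating_set_def)
  have V: "subspace K V A" unfolding V_def by (rule A.span_is_subspace[OF gens(1)])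
  have fin: "vectorspace.fin_dim K (A\<lparr>carrier := V\<rparr>)"
    by (rule A.subspace_of_span_dim(1)[OF V gens(2,1)]) (simp add: V_def)
  have gV: "generating_set \<subseteq> V" unfolding V_def by (rule A.in_own_span[OF gens(1)])
  have VA: "V \<subseteq> carrier A" unfolding V_def by (rule A.span_is_subset2[OF gens(1)])
  obtain C where C: "\<And>r. vectorspace.fin_dim K (A\<lparr>carrier := power_span K A V r\<rparr>)"
    using power_span_dim_upper[OF V fin] by blast
  have "Suc (r div (n + 3)) ^ (n + 3) \<le> vectorspace.dim K (A\<lparr>carrier := power_span K A V r\<rparr>)" for r
  proof -
    define q where "q = r div (n + 3)"
    let ?E = "{..q} \<times> {..q} \<times> {..q} \<times> ({1..n} \<rightarrow>\<^sub>E {..q})"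
    have E: "?E \<subseteq> du_exponents n" by (auto simp: du_exponents_def PiE_def)
    have "card ?E = Suc q ^ (n + 3)" by (simp add: card_cartesian_product card_PiE numeral_3_eq_3 del: mult_Suc mult_Suc_right)
    also have "card ?E = card (du_monomial K n \<alpha> \<beta> \<phi> ` ?E)"
      by (rule card_image[symmetric]) (rule inj_on_subset[OF du_monomial_basis(1) E])
    finally have card: "Suc q ^ (n + 3) = card (du_monomial K n \<alpha> \<beta> \<phi> ` ?E)" by simp
    have "A.lin_indpt (du_monomial K n \<alpha> \<beta> \<phi> ` du_exponents n)"
      using du_monomial_basis(2) unfolding A.basis_def by blast
    then have li: "A.lin_indpt (du_monomial K n \<alpha> \<beta> \<phi> ` ?E)"
      by (rule A.subset_li_is_li) (use E in blast)
    have "(n + 3) * q \<le> r" unfolding q_def by (rule times_div_less_eq_dividend)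
    then have sub: "du_monomial K n \<alpha> \<beta> \<phi> ` ?E \<subseteq> power_span K A V r"
      using du_monomial_in_power_span[OF gV VA] by blast
    show ?thesis
      unfolding q_def[symmetric] card by (rule A.card_le_subspace_dim[OF A.power_span_subspace[OF VA] C sub li])
  qed
  with V fin show ?thesis by (rule that)
qed

end

text \<open>
  A function of the form \<open>(b r)\<^sup>N\<close> has logarithm \<open>N (c + ln r)\<close> with \<open>c = ln b\<close>; the constant \<open>c\<close> disappears in the
  limit.
\<close>

lemma log_growth_tendsto:
  fixes c :: real
  shows "(\<lambda>r. ereal (N * (c + ln (real r)) / ln (real r))) \<longlonglongrightarrow> ereal N"
proof -
  have "filterlim (\<lambda>r. ln (real r)) at_top sequentially"
    by (rule filterlim_compose[OF ln_at_top filterlim_real_sequentially])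
  then have "(\<lambda>r. c / ln (real r)) \<longlonglongrightarrow> 0"
    by (intro tendsto_divide_0[OF tendsto_const] filterlim_at_top_imp_at_infinity)
  then have "(\<lambda>r. N * (c / ln (real r) + 1)) \<longlonglongrightarrow> N * (0 + 1)"
    by (intro tendsto_intros)
  moreover have "\<forall>\<^sub>F r in sequentially. N * (c / ln (real r) + 1) = N * (c + ln (real r)) / ln (real r)"
    using eventually_ge_at_top[of 2] by eventually_elim (simp add: field_simps)
  ultimately have "(\<lambda>r. N * (c + ln (real r)) / ln (real r)) \<longlonglongrightarrow> N"
    by (simp add: tendsto_cong)
  then show ?thesis by simp
qed

lemma limsup_log_growth_le:
  fixes D :: "nat \<Rightarrow> nat"
  assumes "\<And>r. D r \<le> Suc (C * r) ^ N"
  shows "limsup (\<lambda>r. ereal (ln (real (D r)) / ln (real r))) \<le> ereal (real N)"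
proof -
  have "\<forall>\<^sub>F r in sequentially. ereal (ln (real (D r)) / ln (real r)) \<le>
      ereal (real N * (ln (real (Suc C)) + ln (real r)) / ln (real r))"
    using eventually_ge_at_top[of 2]
  proof eventually_elim
    case (elim r)
    have "Suc (C * r) \<le> Suc C * r" using elim by simp
    then have "D r \<le> (Suc C * r) ^ N" using assms[of r] power_mono[of "Suc (C * r)" "Suc C * r" N] by linarith
    then have "real (D r) \<le> real ((Suc C * r) ^ N)" by (simp only: of_nat_le_iff)
    then have le: "real (D r) \<le> (real (Suc C) * real r) ^ N" by (simp only: of_nat_power of_nat_mult)
    have "ln (real (D r)) \<le> ln ((real (Suc C) * real r) ^ N)"
    proof (cases "D r = 0")
      case True
      have "1 * 1 \<le> real (Suc C) * real r" using elim by (intro mult_mono) auto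
      then have "1 \<le> (real (Suc C) * real r) ^ N" by simp
      with True show ?thesis by simp
    next
      case False
      then show ?thesis using le by (subst ln_le_cancel_iff) (use elim in auto)
    qed
    also have "\<dots> = real N * (ln (real (Suc C)) + ln (real r))"
      using elim by (simp add: ln_realpow ln_mult del: of_nat_Suc)
    finally show ?case using elim by (simp add: divide_right_mono)
  qed
  then have "limsup (\<lambda>r. ereal (ln (real (D r)) / ln (real r))) \<le>
      limsup (\<lambda>r. ereal (real N * (ln (real (Suc C)) + ln (real r)) / ln (real r)))"
    by (rule Limsup_mono)
  also have "\<dots> = ereal (real N)" by (rule lim_imp_Limsup[OF _ log_growth_tendsto]) simp
  finally show ?thesis .
qed

lemma limsup_log_growth_ge:
  fixes D :: "nat \<Rightarrow> nat"
  assumes "\<And>r. Suc (r div N) ^ N \<le> D r" and "N > 0"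
  shows "ereal (real N) \<le> limsup (\<lambda>r. ereal (ln (real (D r)) / ln (real r)))"
proof -
  have "\<forall>\<^sub>F r in sequentially. ereal (real N * (- ln (real N) + ln (real r)) / ln (real r)) \<le>
      ereal (ln (real (D r)) / ln (real r))"
    using eventually_ge_at_top[of 2]
  proof eventually_elim
    case (elim r)
    have "r \<le> N * Suc (r div N)"
      using mult_div_mod_eq[of N r] mod_less_divisor[OF assms(2), of r] unfolding mult_Suc_right by linarith
    then have "real r \<le> real N * real (Suc (r div N))" by (metis of_nat_le_iff of_nat_mult)
    then have "real r / real N \<le> real (Suc (r div N))" using assms(2) by (simp add: field_simps)
    then have "(real r / real N) ^ N \<le> real (Suc (r div N)) ^ N" by (intro power_mono) auto
    also have "\<dots> \<le> real (D r)" using assms(1)[of r] by (metis of_nat_le_iff of_nat_power)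
    finally have le: "(real r / real N) ^ N \<le> real (D r)" .
    have pos: "0 < (real r / real N) ^ N" using elim assms(2) by simp
    have "real N * (- ln (real N) + ln (real r)) = ln ((real r / real N) ^ N)"
      using elim assms(2) by (simp add: ln_realpow ln_div)
    also have "\<dots> \<le> ln (real (D r))" using le pos by (subst ln_le_cancel_iff) auto
    finally show ?case using elim by (simp add: divide_right_mono)
  qed
  then have "limsup (\<lambda>r. ereal (real N * (- ln (real N) + ln (real r)) / ln (real r))) \<le>
      limsup (\<lambda>r. ereal (ln (real (D r)) / ln (real r)))"
    by (rule Limsup_mono)
  moreover have "limsup (\<lambda>r. ereal (real N * (- ln (real N) + ln (real r)) / ln (real r))) = ereal (real N)"
    by (rule lim_imp_Limsup[OF _ log_growth_tendsto]) simp
  ultimately show ?thesis by simp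
qed

theorem (in du_model) GK_dim_eq: "GK_dim K A = ereal (real (n + 3))"
proof (rule antisym)
  show "GK_dim K A \<le> ereal (real (n + 3))"
    unfolding GK_dim_def
  proof (rule SUP_least)
    fix V assume "V \<in> {V. subspace K V A \<and> vectorspace.fin_dim K (A\<lparr>carrier := V\<rparr>)}"
    then have V: "subspace K V A" "vectorspace.fin_dim K (A\<lparr>carrier := V\<rparr>)" by auto
    from power_span_dim_upper[OF V] obtain C where
      "\<And>r. vectorspace.dim K (A\<lparr>carrier := power_span K A V r\<rparr>) \<le> Suc (C * r) ^ (n + 3)" by blast
    then show "limsup (\<lambda>r. ereal (ln (real (vectorspace.dim K (A\<lparr>carrier := power_span K A V r\<rparr>))) / ln (real r)))
        \<le> ereal (real (n + 3))"
      by (rule limsup_log_growth_le)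
  qed
  from power_span_dim_lower obtain V where V: "subspace K V A" "vectorspace.fin_dim K (A\<lparr>carrier := V\<rparr>)"
    and lower: "\<And>r. Suc (r div (n + 3)) ^ (n + 3) \<le> vectorspace.dim K (A\<lparr>carrier := power_span K A V r\<rparr>)"
    by blast
  show "ereal (real (n + 3)) \<le> GK_dim K A"
    unfolding GK_dim_def
    by (rule SUP_upper2[of V]) (use V limsup_log_growth_ge[OF lower] in auto)
qed

theorem theorem1p1:
  fixes K :: "('k, 'm) ring_scheme" and n :: nat and \<alpha> \<beta> :: 'k
    and \<phi> :: "nat multiset \<Rightarrow> 'k"
  assumes "field K"
    and "n \<ge> 1"
    and "\<alpha> \<in> carrier K"
    and "\<beta> \<in> carrier K"
    and "\<phi> \<in> ring.indexed_pset K {1..n} (carrier K)"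
  shows "inj_on (du_monomial K n \<alpha> \<beta> \<phi>) (du_exponents n) \<and>
         vectorspace.basis K (du_algebra K n \<alpha> \<beta> \<phi>) (du_monomial K n \<alpha> \<beta> \<phi> ` du_exponents n) \<and>
         GK_dim K (du_algebra K n \<alpha> \<beta> \<phi>) = ereal (real (n + 3))"
proof -
  interpret du_model K n \<alpha> \<beta> \<phi>
    using assms indexed_pset_polynomials by (intro du_model.intro du_model_axioms.intro) auto
  show ?thesis using du_monomial_basis GK_dim_eq by blast
qed

end
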